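(* Let $R$ be a reduced root system in a finite-dimensional Euclidean space $V$ with simple system $S$, let $k\ge 0$ be a multiplicity function, and let $X^W$ be the associated radial Dunkl process with values in the closed Weyl chamber $\overline{C}$. For $\alpha_0\in S$ let $$T_{\alpha_0}:=\inf\{t>0:\ \langle\alpha_0,X_t^W\rangle=0\},$$ and let $T_0:=\inf\{t>0:\ X_t^W\in\partial C\}$, so that $T_0=\inf_{\alpha\in S}T_{\alpha}$. If $\alpha_0\in S$ satisfies $0\le k(\alpha_0)<1/2$, then $(\langle\alpha_0,X_t^W\rangle)_{t\ge0}$ hits $0$ almost surely. Therefore $T_0\le T_{\alpha_0}<\infty$ almost surely.
   Context: $(V,\langle\cdot,\cdot\rangle)$ is a finite-dimensional Euclidean space, $|\alpha|^2=\langle\alpha,\alpha\rangle$. For $\alpha\neq 0$, $H_\alpha$ is the hyperplane orthogonal to $\alpha$ and $\sigma_\alpha(x)=x-2\frac{\langle\alpha,x\rangle}{|\alpha|^2}\alpha$. A reduced root system $R$ is a finite set of nonzero vectors of $V$ such that $R\cap\mathbb{R}\alpha=\{\alpha,-\alpha\}$ and $\sigma_\alpha(R)=R$ for all $\alpha\in R$. A simple system $S\subset R$ is a basis of $\mathrm{span}(R)$ such that every root is a linear combination of elements of $S$ with coefficients all of the same sign; the positive system $R_+$ is the set of roots that are nonnegative combinations of elements of $S$. $W$ is the finite group generated by the $\sigma_\alpha$, $\alpha\in R$. The positive Weyl chamber is $C=\{x\in V:\langle\alpha,x\rangle>0\ \forall\alpha\in R_+\}=\{x\in V:\langle\alpha,x\rangle>0\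 \forall\alpha\in S\}$, with closure $\overline{C}$ and boundary $\partial C$. A multiplicity function is a $W$-invariant function $k:R\to[0,\infty)$. The radial Dunkl process $X^W$ is the $\overline{C}$-valued Markov process with continuous paths whose generator is $$\mathscr{L}_k^W u(x)=\frac12\Delta u(x)+\sum_{\alpha\in R_+}k(\alpha)\frac{\langle\alpha,\nabla u(x)\rangle}{\langle\alpha,x\rangle},$$ acting on $u\in C^2(\overline{C})$ satisfying the boundary conditions $\langle\nabla u(x),\alpha\rangle=0$ for all $x\in H_\alpha$, $\alpha\in R_+$. *)

theory Defs
  imports "HOL-Probability.Probability"
begin

definition root_reflection :: "'a::euclidean_space \<Rightarrow> 'a \<Rightarrow> 'a" where
  "root_reflection \<alpha> x = x - (2 * (\<alpha> \<bullet> x) / (norm \<alpha>)\<^sup>2) *\<^sub>R \<alpha>"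

definition reduced_root_system :: "'a::euclidean_space set \<Rightarrow> bool" where
  "reduced_root_system R \<longleftrightarrow>
     finite R \<and> 0 \<notin> R \<and>
     (\<forall>\<alpha>\<in>R. R \<inter> span {\<alpha>} = {\<alpha>, - \<alpha>} \<and> root_reflection \<alpha> ` R = R)"

definition nonneg_comb :: "'a::euclidean_space set \<Rightarrow> 'a \<Rightarrow> bool" where
  "nonneg_comb S \<beta> \<longleftrightarrow> (\<exists>c. (\<forall>\<alpha>\<in>S. 0 \<le> c \<alpha>) \<and> \<beta> = (\<Sum>\<alpha>\<in>S. c \<alpha> *\<^sub>R \<alpha>))"

definition simple_system :: "'a::euclidean_space set \<Rightarrow> 'a set \<Rightarrow> bool" where
  "simple_system R S \<longleftrightarrow>
     S \<subseteq> R \<and> independent S \<and> span S = span R \<and>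
     (\<forall>\<beta>\<in>R. nonneg_comb S \<beta> \<or> nonneg_comb S (- \<beta>))"

definition positive_roots :: "'a::euclidean_space set \<Rightarrow> 'a set \<Rightarrow> 'a set" where
  "positive_roots R S = {\<beta>\<in>R. nonneg_comb S \<beta>}"

text \<open>Inverses need no separate clause, since the generators are involutions.\<close>

inductive_set weyl_group :: "'a::euclidean_space set \<Rightarrow> ('a \<Rightarrow> 'a) set"
  for R :: "'a set" where
  id: "id \<in> weyl_group R"
| comp: "\<alpha> \<in> R \<Longrightarrow> w \<in> weyl_group R \<Longrightarrow> root_reflection \<alpha> \<circ> w \<in> weyl_group R"

definition multiplicity_function :: "'a::euclidean_space set \<Rightarrow> ('a \<Rightarrow> real) \<Rightarrow> bool" where
  "multiplicity_function R k \<longleftrightarrow>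
     (\<forall>\<alpha>\<in>R. 0 \<le> k \<alpha>) \<and> (\<forall>w\<in>weyl_group R. \<forall>\<alpha>\<in>R. k (w \<alpha>) = k \<alpha>)"

definition weyl_chamber :: "'a::euclidean_space set \<Rightarrow> 'a set \<Rightarrow> 'a set" where
  "weyl_chamber R S = {x. \<forall>\<alpha>\<in>positive_roots R S. \<alpha> \<bullet> x > 0}"

text \<open>
  Derivatives are taken within a set \<open>D\<close>, which below is always the closed chamber. As this is
  a convex set with nonempty interior, they are unique, they are the ordinary derivatives in
  the open chamber, and \<open>C2_on D u\<close> says that \<open>u\<close> is \<open>C\<^sup>2\<close> in the interior with derivatives up to
  order two extending continuously to \<open>D\<close>.
\<close>

definition gradient_within :: "'a::euclidean_space set \<Rightarrow> ('a \<Rightarrow> real) \<Rightarrow> 'a \<Rightarrow> 'a" where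
  "gradient_within D u x = (\<Sum>b\<in>Basis. frechet_derivative u (at x within D) b *\<^sub>R b)"

definition hessian_within :: "'a::euclidean_space set \<Rightarrow> ('a \<Rightarrow> real) \<Rightarrow> 'a \<Rightarrow> 'a \<Rightarrow> 'a" where
  "hessian_within D u x = frechet_derivative (gradient_within D u) (at x within D)"

definition laplacian_within :: "'a::euclidean_space set \<Rightarrow> ('a \<Rightarrow> real) \<Rightarrow> 'a \<Rightarrow> real" where
  "laplacian_within D u x = (\<Sum>b\<in>Basis. hessian_within D u x b \<bullet> b)"

definition C2_on :: "'a::euclidean_space set \<Rightarrow> ('a \<Rightarrow> real) \<Rightarrow> bool" where
  "C2_on D u \<longleftrightarrow>
     u differentiable_on D \<and> gradient_within D u differentiable_on D \<and>
     (\<forall>v. continuous_on D (\<lambda>x. hessian_within D u x v))"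

text \<open>
  The quotients in the generator are singular on the walls. For \<open>u\<close> in the domain below, the
  expression extends continuously from the open to the closed chamber, and \<open>Lim\<close> is this
  extension; at points of the open chamber it is just the value of the expression.
\<close>

definition radial_dunkl_generator ::
    "'a::euclidean_space set \<Rightarrow> 'a set \<Rightarrow> ('a \<Rightarrow> real) \<Rightarrow> ('a \<Rightarrow> real) \<Rightarrow> 'a \<Rightarrow> real" where
  "radial_dunkl_generator R S k u x =
     (let C = weyl_chamber R S in
      Lim (at x within C)
        (\<lambda>y. laplacian_within (closure C) u y / 2 +
             (\<Sum>\<alpha>\<in>positive_roots R S.
                k \<alpha> * ((\<alpha> \<bullet> gradient_within (closure C) u y) / (\<alpha> \<bullet> y)))))"

text \<open>
  Compact support makes \<open>u\<close> and its image under the generator bounded; for arbitrary \<open>C\<^sup>2\<close>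
  functions the transition semigroup need not even be defined. The support is compact in the
  closed chamber, so \<open>u\<close> need not vanish near the walls.
\<close>

definition radial_dunkl_domain :: "'a::euclidean_space set \<Rightarrow> 'a set \<Rightarrow> ('a \<Rightarrow> real) set" where
  "radial_dunkl_domain R S =
     (let D = closure (weyl_chamber R S) in
      {u. C2_on D u \<and> compact (closure {x\<in>D. u x \<noteq> 0}) \<and>
          (\<forall>\<alpha>\<in>positive_roots R S. \<forall>x\<in>D. \<alpha> \<bullet> x = 0 \<longrightarrow> gradient_within D u x \<bullet> \<alpha> = 0)})"

definition transition_semigroup :: "'a measure \<Rightarrow> (real \<Rightarrow> 'a \<Rightarrow> 'a measure) \<Rightarrow> bool" where
  "transition_semigroup E P \<longleftrightarrow>
     (\<forall>t\<ge>0. P t \<in> E \<rightarrow>\<^sub>M prob_algebra E) \<and>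
     (\<forall>x\<in>space E. P 0 x = return E x) \<and>
     (\<forall>s\<ge>0. \<forall>t\<ge>0. \<forall>x\<in>space E. P (s + t) x = P s x \<bind> P t)"

definition natural_filtration ::
    "'w measure \<Rightarrow> 'a measure \<Rightarrow> (real \<Rightarrow> 'w \<Rightarrow> 'a) \<Rightarrow> real \<Rightarrow> 'w measure" where
  "natural_filtration M E X t =
     sigma (space M) {X s -` A \<inter> space M | s A. 0 \<le> s \<and> s \<le> t \<and> A \<in> sets E}"

definition markov_process ::
    "'w measure \<Rightarrow> 'a measure \<Rightarrow> (real \<Rightarrow> 'a \<Rightarrow> 'a measure) \<Rightarrow> (real \<Rightarrow> 'w \<Rightarrow> 'a) \<Rightarrow> bool" where
  "markov_process M E P X \<longleftrightarrow>
     prob_space M \<and> transition_semigroup E P \<and>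
     (\<forall>t\<ge>0. X t \<in> M \<rightarrow>\<^sub>M E) \<and>
     (\<forall>s\<ge>0. \<forall>t\<ge>0. \<forall>A\<in>sets E. AE \<omega> in M.
        real_cond_exp M (natural_filtration M E X s) (\<lambda>\<omega>'. indicator A (X (s + t) \<omega>')) \<omega> =
        measure (P t (X s \<omega>)) A)"

text \<open>
  The initial distribution is arbitrary. The last clause states that the infinitesimal generator
  of the semigroup, with respect to the supremum norm on the closed chamber, is given on the
  domain by the differential operator.
\<close>

definition radial_dunkl_process ::
    "'a::euclidean_space set \<Rightarrow> 'a set \<Rightarrow> ('a \<Rightarrow> real) \<Rightarrow> 'w measure \<Rightarrow> (real \<Rightarrow> 'w \<Rightarrow> 'a) \<Rightarrow> bool"
  where
  "radial_dunkl_process R S k M X \<longleftrightarrow>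
     (let D = closure (weyl_chamber R S); E = restrict_space borel D in
      (\<forall>\<omega>\<in>space M. continuous_on {0..} (\<lambda>t. X t \<omega>)) \<and>
      (\<exists>P. markov_process M E P X \<and>
         (\<forall>u\<in>radial_dunkl_domain R S.
            uniform_limit D (\<lambda>t x. ((\<integral>y. u y \<partial>P t x) - u x) / t)
              (radial_dunkl_generator R S k u) (at_right 0))))"

definition hitting_time :: "(real \<Rightarrow> 'w \<Rightarrow> 'b) \<Rightarrow> 'b set \<Rightarrow> 'w \<Rightarrow> ereal" where
  "hitting_time Y A \<omega> = Inf {ereal t | t. t > 0 \<and> Y t \<omega> \<in> A}"

end

theory Submission
  imports Defs
begin

text \<open>
  Write \<open>y = \<alpha>\<^sub>0 \<bullet> x\<close>, \<open>n = |\<alpha>\<^sub>0|\<^sup>2\<close> and \<open>k\<^sub>0 = k \<alpha>\<^sub>0\<close>. On a function \<open>f(y)\<close> the differential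
  expression of the generator is
  \<open>n (f''(y) / 2 + k\<^sub>0 f'(y) / y) + f'(y) \<Sum>\<^sub>\<alpha> k(\<alpha>) (\<alpha> \<bullet> \<alpha>\<^sub>0) / (\<alpha> \<bullet> x)\<close>, the sum running over the positive
  roots other than \<open>\<alpha>\<^sub>0\<close>. The reflection in \<open>\<alpha>\<^sub>0\<close> permutes these roots, and the two terms of each pair
  add up to something nonpositive, so for increasing \<open>f\<close> the process \<open>y\<close> is dominated by a Bessel process of
  dimension \<open>1 + 2 k\<^sub>0 < 2\<close>. Concretely, \<open>f(y) = y\<^sup>a\<close> with \<open>a = (1 - 2 k\<^sub>0) / 2\<close> has generator at most
  \<open>- (a\<^sup>2 / 2) n y\<^sup>a\<^sup>-\<^sup>2\<close>. A process started at \<open>y \<le> r\<close> then cannot stay in \<open>0 < y \<le> \<rho>\<close> for ever, and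
  leaves this strip through its upper end with probability at most of order \<open>(r / \<rho>)\<^sup>a\<close>; let \<open>\<rho>\<close> grow.

  The obstacle is that \<open>f(y)\<close> is not in the domain of the generator: on the wall of another simple root
  \<open>\<alpha>\<close> its normal derivative is \<open>f'(y) (\<alpha> \<bullet> \<alpha>\<^sub>0)\<close>, which may be negative. On the chamber, however,
  \<open>y\<close> is the minimum of \<open>\<beta> \<bullet> x\<close> over the images \<open>\<beta>\<close> of \<open>\<alpha>\<^sub>0\<close> under the parabolic subgroup fixing the
  coefficient of \<open>\<alpha>\<^sub>0\<close>. The soft minimum \<open>\<psi> = - \<epsilon> ln (\<Sum>\<^sub>\<beta> exp (- \<beta> \<bullet> x / \<epsilon>))\<close> is smooth and
  invariant under this subgroup, hence satisfies the Neumann condition on all walls that matter where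
  \<open>y > 0\<close>, and it differs from \<open>y\<close> by at most a multiple of \<open>\<epsilon>\<close>. Two facts make \<open>\<psi>\<close> as good as \<open>y\<close>. The
  drift of \<open>\<psi>\<close> is still at most \<open>k\<^sub>0 n / y\<close> (\<open>softmin_drift_bound\<close>): the new positive contributions, which
  come from \<open>\<beta> \<noteq> \<alpha>\<^sub>0\<close>, are absorbed by the strongly negative drift that the concavity of \<open>\<psi>\<close> produces near
  the other walls once \<open>\<epsilon>\<close> is small compared with \<open>y\<close>. And the loss in \<open>|\<nabla>\<psi>|\<^sup>2 \<le> n\<close> is compensated by the
  Laplacian \<open>- (n - |\<nabla>\<psi>|\<^sup>2) / \<epsilon>\<close> of \<open>\<psi>\<close> (\<open>bessel_generator_estimate\<close>). Cutting \<open>\<psi>\<^sup>a\<close> off for large \<open>|x|\<close>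
  and flattening it for small \<open>\<psi>\<close> gives functions in the domain (\<open>test_function_exists\<close>); since the paths are
  continuous, the cutoffs can be removed at the end.

  On the probabilistic side no stochastic calculus is used. For a function \<open>u\<close> in the domain
  the transition operators satisfy \<open>P\<^sub>h u \<le> u - c h\<close> on the region where the generator is at most
  \<open>- 2 c\<close>, for all small \<open>h\<close>, because difference quotients converge uniformly. Summing this along the
  time grid of mesh \<open>h\<close> up to the exit from the region is a finite telescoping argument
  (\<open>discrete_exit_bound\<close>) and bounds the probabilities of not leaving the region in time and of leaving it at the
  wrong end. Every path with \<open>y > 0\<close> throughout is caught by these events as soon as the cutoffs are generous enough
  (\<open>survival_outer_bound\<close>), so such paths form a null set.
\<close>

section \<open>Root systems seen from one simple root\<close>

lemma root_reflection_linear: "linear (root_reflection \<alpha>)"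
proof (rule linearI)
  show "root_reflection \<alpha> (x + y) = root_reflection \<alpha> x + root_reflection \<alpha> y" for x y
    by (simp add: root_reflection_def inner_add_right distrib_left add_divide_distrib scaleR_add_left)
  show "root_reflection \<alpha> (r *\<^sub>R x) = r *\<^sub>R root_reflection \<alpha> x" for r x
    by (simp add: root_reflection_def scaleR_diff_right mult.left_commute mult.commute)
qed
lemma root_reflection_root: "\<alpha> \<noteq> 0 \<Longrightarrow> root_reflection \<alpha> \<alpha> = - \<alpha>"
  by (simp add: root_reflection_def power2_norm_eq_inner scaleR_2)

lemma inner_root_reflection: "\<alpha> \<noteq> 0 \<Longrightarrow> root_reflection \<alpha> x \<bullet> root_reflection \<alpha> y = x \<bullet> y"
  by (simp add: root_reflection_def power2_norm_eq_inner inner_diff_left inner_diff_right inner_commute field_simps)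

lemma inner_root_reflection_left:
  "root_reflection \<beta> \<alpha> \<bullet> x = \<alpha> \<bullet> x - 2 * (\<alpha> \<bullet> \<beta>) / (norm \<beta>)\<^sup>2 * (\<beta> \<bullet> x)"
  by (simp add: root_reflection_def inner_diff_left inner_commute[of \<alpha> \<beta>])

lemma root_reflection_swap: "\<alpha> \<noteq> 0 \<Longrightarrow> root_reflection \<alpha> x \<bullet> y = x \<bullet> root_reflection \<alpha> y"
  by (simp add: root_reflection_def inner_diff_left inner_diff_right inner_commute)

lemma root_reflection_involution: 
  assumes "\<alpha> \<noteq> 0" shows "root_reflection \<alpha> (root_reflection \<alpha> x) = x"
proof -
  have "root_reflection \<alpha> (root_reflection \<alpha> x) = root_reflection \<alpha> x - (2 * (\<alpha> \<bullet> x) / (norm \<alpha>)\<^sup>2) *\<^sub>R root_reflection \<alpha> \<alpha>"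
    using root_reflection_linear[of \<alpha>] by (subst (2) root_reflection_def) (simp add: linear_diff linear_scale)
  then show ?thesis using root_reflection_root[OF assms] by (simp add: root_reflection_def)
qed

lemma norm_root_reflection: "\<alpha> \<noteq> 0 \<Longrightarrow> norm (root_reflection \<alpha> x) = norm x"
  by (simp add: norm_eq_sqrt_inner inner_root_reflection)

lemma root_reflection_neg: "root_reflection (- \<alpha>) x = root_reflection \<alpha> x"
  by (simp add: root_reflection_def)

lemma root_reflection_conjugate:
  assumes "\<gamma> \<noteq> 0"
  shows "root_reflection (root_reflection \<gamma> \<beta>) x = root_reflection \<gamma> (root_reflection \<beta> (root_reflection \<gamma> x))"
proof -
  have "root_reflection \<gamma> (root_reflection \<beta> (root_reflection \<gamma> x))
     = root_reflection \<gamma> (root_reflection \<gamma> x - (2 * (\<beta> \<bullet> root_reflection \<gamma> x) / (norm \<beta>)\<^sup>2) *\<^sub>R \<beta>)"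
    by (simp add: root_reflection_def[of \<beta>])
  also have "\<dots> = root_reflection \<gamma> (root_reflection \<gamma> x)
       - (2 * (\<beta> \<bullet> root_reflection \<gamma> x) / (norm \<beta>)\<^sup>2) *\<^sub>R root_reflection \<gamma> \<beta>"
    using root_reflection_linear[of \<gamma>] by (simp add: linear_diff linear_scale)
  also have "\<dots> = root_reflection (root_reflection \<gamma> \<beta>) x"
    using assms by (simp add: root_reflection_involution root_reflection_def[of "root_reflection \<gamma> \<beta>"]
        norm_root_reflection root_reflection_swap)
  finally show ?thesis by simp
qed

text \<open>The cancellations between roots are all of this kind: an involution pairs the terms, and only
  the sums over pairs have a sign.\<close>

lemma sum_involution_nonpos:
  fixes T :: "'b \<Rightarrow> real"
  assumes "\<And>z. z \<in> Z \<Longrightarrow> i z \<in> Z" "\<And>z. z \<in> Z \<Longrightarrow> i (i z) = z"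
    and "\<And>z. z \<in> Z \<Longrightarrow> T z + T (i z) \<le> 0"
  shows "sum T Z \<le> 0"
proof -
  have "sum T Z = (\<Sum>z\<in>Z. T (i z))"
    by (rule sum.reindex_bij_witness[where i = i and j = i]) (use assms in auto)
  then have "2 * sum T Z = (\<Sum>z\<in>Z. T z + T (i z))" by (simp add: sum.distrib)
  also have "\<dots> \<le> 0" using assms(3) by (rule sum_nonpos)
  finally show ?thesis by simp
qed

locale simple_root_data =
  fixes R S :: "'a::euclidean_space set" and k :: "'a \<Rightarrow> real" and \<alpha>\<^sub>0 :: 'a
  assumes root_system: "reduced_root_system R"
    and simple: "simple_system R S"
    and multiplicity: "multiplicity_function R k"
    and root0: "\<alpha>\<^sub>0 \<in> S"
begin

abbreviation "pos \<equiv> positive_roots R S"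

lemma finite_roots: "finite R" and roots_nonzero: "\<alpha> \<in> R \<Longrightarrow> \<alpha> \<noteq> 0"
  and simple_subset: "S \<subseteq> R"
  using root_system simple by (auto simp: reduced_root_system_def simple_system_def)

lemma finite_simple: "finite S"
  using finite_roots simple_subset finite_subset by blast

lemma root0_root: "\<alpha>\<^sub>0 \<in> R" using root0 simple_subset by auto

lemma reflection_root: "\<alpha> \<in> R \<Longrightarrow> \<beta> \<in> R \<Longrightarrow> root_reflection \<alpha> \<beta> \<in> R"
  using root_system by (auto simp: reduced_root_system_def)

lemma neg_root: "\<alpha> \<in> R \<Longrightarrow> - \<alpha> \<in> R"
  using reflection_root[of \<alpha> \<alpha>] roots_nonzero by (simp add: root_reflection_root)

lemma multiplicity_nonneg: "\<alpha> \<in> R \<Longrightarrow> 0 \<le> k \<alpha>"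
  using multiplicity by (simp add: multiplicity_function_def)

lemma multiplicity_reflection: "\<alpha> \<in> R \<Longrightarrow> \<beta> \<in> R \<Longrightarrow> k (root_reflection \<alpha> \<beta>) = k \<beta>"
  using multiplicity weyl_group.comp[OF _ weyl_group.id, of \<alpha> R]
  by (fastforce simp: multiplicity_function_def)

lemma multiplicity_neg: "\<alpha> \<in> R \<Longrightarrow> k (- \<alpha>) = k \<alpha>"
  using multiplicity_reflection[of \<alpha> \<alpha>] roots_nonzero by (simp add: root_reflection_root)

text \<open>The coordinates with respect to the simple system, extended from \<open>span S\<close> to linear functionals on the
  whole space so that linearity holds without side conditions.\<close>

definition coord :: "'a \<Rightarrow> 'a \<Rightarrow> real" where
  "coord s = (SOME f. linear f \<and> (\<forall>t\<in>S. f t = (if t = s then 1 else 0)))"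

lemma coord_spec: "linear (coord s) \<and> (\<forall>t\<in>S. coord s t = (if t = s then 1 else 0))"
proof -
  have "independent S" using simple by (simp add: simple_system_def)
  then have "\<exists>f. linear f \<and> (\<forall>t\<in>S. f t = (if t = s then 1 else (0::real)))"
    by (rule linear_independent_extend)
  then show ?thesis unfolding coord_def by (rule someI_ex)
qed

lemma linear_coord: "linear (coord s)" and coord_simple: "t \<in> S \<Longrightarrow> coord s t = (if t = s then 1 else 0)"
  using coord_spec by auto

lemma coord_neg: "coord s (- v) = - coord s v"
  and coord_diff: "coord s (v - w) = coord s v - coord s w"
  and coord_scale: "coord s (r *\<^sub>R v) = r * coord s v"
  using linear_coord[of s] by (simp_all add: linear_neg linear_diff linear_scale)

lemma coord_reflection: "coord s (root_reflection \<alpha> \<beta>) = coord s \<beta> - 2 * (\<alpha> \<bullet> \<beta>) / (norm \<alpha>)\<^sup>2 * coord s \<alpha>"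
  by (simp add: root_reflection_def coord_diff coord_scale)

lemma coord_sum: "s \<in> S \<Longrightarrow> coord s (\<Sum>t\<in>S. c t *\<^sub>R t) = c s"
proof -
  assume "s \<in> S"
  have "coord s (\<Sum>t\<in>S. c t *\<^sub>R t) = (\<Sum>t\<in>S. coord s (c t *\<^sub>R t))"
    using linear_coord[of s] by (simp add: linear_sum)
  also have "\<dots> = (\<Sum>t\<in>S. if t = s then c s else 0)"
    by (intro sum.cong) (auto simp: coord_scale coord_simple)
  finally show ?thesis using \<open>s \<in> S\<close> finite_simple by simp
qed

lemma nonneg_comb_coord:
  assumes "nonneg_comb S \<beta>"
  shows "s \<in> S \<Longrightarrow> 0 \<le> coord s \<beta>" and "(\<Sum>s\<in>S. coord s \<beta> *\<^sub>R s) = \<beta>"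
proof -
  obtain c where c: "\<forall>\<alpha>\<in>S. 0 \<le> c \<alpha>" "\<beta> = (\<Sum>\<alpha>\<in>S. c \<alpha> *\<^sub>R \<alpha>)"
    using assms by (auto simp: nonneg_comb_def)
  have *: "coord s \<beta> = c s" if "s \<in> S" for s using c that coord_sum by simp
  show "s \<in> S \<Longrightarrow> 0 \<le> coord s \<beta>" using c * by simp
  show "(\<Sum>s\<in>S. coord s \<beta> *\<^sub>R s) = \<beta>" using * c(2) by (metis (no_types, lifting) sum.cong)
qed

lemma pos_root: "\<beta> \<in> pos \<Longrightarrow> \<beta> \<in> R" by (simp add: positive_roots_def)

lemma pos_coord: "\<beta> \<in> pos \<Longrightarrow> s \<in> S \<Longrightarrow> 0 \<le> coord s \<beta>"
  by (simp add: positive_roots_def nonneg_comb_coord)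

lemma pos_expansion: "\<beta> \<in> pos \<Longrightarrow> (\<Sum>s\<in>S. coord s \<beta> *\<^sub>R s) = \<beta>"
  by (simp add: positive_roots_def nonneg_comb_coord(2))

lemma pos_or_neg: "\<beta> \<in> R \<Longrightarrow> \<beta> \<in> pos \<or> - \<beta> \<in> pos"
  using simple neg_root by (auto simp: positive_roots_def simple_system_def)

lemma coord_pos_imp_pos: "\<beta> \<in> R \<Longrightarrow> s \<in> S \<Longrightarrow> 0 < coord s \<beta> \<Longrightarrow> \<beta> \<in> pos"
  using pos_or_neg[of \<beta>] pos_coord[of "- \<beta>" s] by (auto simp: coord_neg)

lemma not_pos_and_neg: "\<beta> \<in> pos \<Longrightarrow> - \<beta> \<notin> pos"
proof
  assume *: "\<beta> \<in> pos" "- \<beta> \<in> pos"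
  then have "coord s \<beta> = 0" if "s \<in> S" for s
    using pos_coord[OF _ that, of \<beta>] pos_coord[OF _ that, of "-\<beta>"] by (simp add: coord_neg)
  then have "\<beta> = 0" using pos_expansion[OF *(1)] by simp
  then show False using roots_nonzero pos_root * by blast
qed

lemma simple_pos: "s \<in> S \<Longrightarrow> s \<in> pos"
  using coord_pos_imp_pos[of s s] simple_subset coord_simple by auto

text \<open>The reflection in \<open>\<alpha>\<^sub>0\<close> changes only the coordinate at \<open>\<alpha>\<^sub>0\<close>. A positive root other than
  \<open>\<alpha>\<^sub>0\<close> has another positive coordinate because the system is reduced, and one positive coordinate
  makes a root positive.\<close>

lemma simple_reflection_pos:
  assumes "\<alpha> \<in> pos" "\<alpha> \<noteq> \<alpha>\<^sub>0"
  shows "root_reflection \<alpha>\<^sub>0 \<alpha> \<in> pos"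
proof -
  have "\<exists>s\<in>S - {\<alpha>\<^sub>0}. coord s \<alpha> > 0"
  proof (rule ccontr)
    assume "\<not> ?thesis"
    then have *: "coord s \<alpha> = 0" if "s \<in> S - {\<alpha>\<^sub>0}" for s
      using pos_coord[OF assms(1)] that by force
    have "\<alpha> = (\<Sum>s\<in>S. coord s \<alpha> *\<^sub>R s)" by (rule pos_expansion[OF assms(1), symmetric])
    also have "\<dots> = (\<Sum>s\<in>{\<alpha>\<^sub>0}. coord s \<alpha> *\<^sub>R s)"
      using * root0 by (intro sum.mono_neutral_right finite_simple) auto
    finally have "\<alpha> = coord \<alpha>\<^sub>0 \<alpha> *\<^sub>R \<alpha>\<^sub>0" by simp
    then have "\<alpha> \<in> R \<inter> span {\<alpha>\<^sub>0}" using pos_root[OF assms(1)]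
      by (metis IntI insertI1 span_base span_scale)
    then have "\<alpha> = - \<alpha>\<^sub>0"
      using root_system root0_root assms(2) by (auto simp: reduced_root_system_def)
    then show False using simple_pos[OF root0] not_pos_and_neg assms(1) by auto
  qed
  then obtain s where s: "s \<in> S" "s \<noteq> \<alpha>\<^sub>0" "coord s \<alpha> > 0" by auto
  then have "coord s (root_reflection \<alpha>\<^sub>0 \<alpha>) > 0" by (simp add: coord_reflection coord_simple root0)
  then show ?thesis
    using s coord_pos_imp_pos reflection_root root0_root pos_root[OF assms(1)] by blast
qed

text \<open>The roots are graded by their coordinate at \<open>\<alpha>\<^sub>0\<close>. Degree zero is the root system of the parabolic (Levi)
  subgroup, generated by the reflections that preserve the grading; the roots of positive degree are positive.

  The set \<open>orbit\<close> plays the role of the Levi orbit of \<open>\<alpha>\<^sub>0\<close>. It is cut out by properties of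
  \<open>\<alpha>\<^sub>0\<close> that Levi reflections preserve, which makes its stability a direct verification. The last
  property stands in for \<open>\<beta>\<close> being simple with respect to a conjugate simple system: its reflection
  sends no root of positive degree, other than \<open>\<beta>\<close>, to negative degree.\<close>

definition upper :: "'a set" where "upper = {\<alpha>\<in>R. 0 < coord \<alpha>\<^sub>0 \<alpha>}"
definition levi :: "'a set" where "levi = {\<gamma>\<in>R. coord \<alpha>\<^sub>0 \<gamma> = 0}"
definition orbit :: "'a set" where
  "orbit = {\<beta>\<in>R. coord \<alpha>\<^sub>0 \<beta> = 1 \<and> norm \<beta> = norm \<alpha>\<^sub>0 \<and> k \<beta> = k \<alpha>\<^sub>0 \<and>
     (\<forall>\<alpha>\<in>upper - {\<beta>}. 0 \<le> coord \<alpha>\<^sub>0 (root_reflection \<beta> \<alpha>))}"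

lemma upper_pos: "\<alpha> \<in> upper \<Longrightarrow> \<alpha> \<in> pos"
  using coord_pos_imp_pos root0 by (auto simp: upper_def)

lemma upper_root: "\<alpha> \<in> upper \<Longrightarrow> \<alpha> \<in> R"
  and levi_root: "\<alpha> \<in> levi \<Longrightarrow> \<alpha> \<in> R"
  and orbit_root: "\<alpha> \<in> orbit \<Longrightarrow> \<alpha> \<in> R"
  and orbit_upper: "\<beta> \<in> orbit \<Longrightarrow> \<beta> \<in> upper"
  by (auto simp: upper_def levi_def orbit_def)

lemma finite_orbit: "finite orbit" and finite_levi: "finite levi" and finite_upper: "finite upper"
  and finite_pos: "finite pos"
  using finite_roots by (auto simp: upper_def levi_def orbit_def positive_roots_def)

lemma pos_split: "pos = (pos \<inter> levi) \<union> upper" "(pos \<inter> levi) \<inter> upper = {}"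
  using upper_pos pos_coord[OF _ root0] pos_root by (fastforce simp: levi_def upper_def)+

lemma root0_orbit: "\<alpha>\<^sub>0 \<in> orbit"
proof -
  have "0 \<le> coord \<alpha>\<^sub>0 (root_reflection \<alpha>\<^sub>0 \<alpha>)" if "\<alpha> \<in> upper - {\<alpha>\<^sub>0}" for \<alpha>
    using simple_reflection_pos pos_coord upper_pos root0 that by auto
  then show ?thesis by (simp add: orbit_def root0_root coord_simple root0)
qed

lemma levi_reflection_coord: "\<gamma> \<in> levi \<Longrightarrow> coord \<alpha>\<^sub>0 (root_reflection \<gamma> v) = coord \<alpha>\<^sub>0 v"
  by (simp add: coord_reflection levi_def)

lemma levi_neg: "\<gamma> \<in> levi \<Longrightarrow> - \<gamma> \<in> levi" by (simp add: levi_def neg_root coord_neg)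

text \<open>The last property of \<open>orbit\<close> is transported by conjugation, as Levi reflections permute \<open>upper\<close>.\<close>

lemma levi_reflection_orbit:
  assumes "\<gamma> \<in> levi" "\<beta> \<in> orbit"
  shows "root_reflection \<gamma> \<beta> \<in> orbit"
proof -
  have g: "\<gamma> \<in> R" "\<gamma> \<noteq> 0" using assms levi_root roots_nonzero by auto
  have "0 \<le> coord \<alpha>\<^sub>0 (root_reflection (root_reflection \<gamma> \<beta>) \<alpha>)"
    if a: "\<alpha> \<in> upper - {root_reflection \<gamma> \<beta>}" for \<alpha>
  proof -
    have "root_reflection \<gamma> \<alpha> \<in> upper"
      using a g assms by (auto simp: upper_def reflection_root levi_reflection_coord)
    moreover have "root_reflection \<gamma> \<alpha> \<noteq> \<beta>" using a g root_reflection_involution[of \<gamma> \<alpha>] by auto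
    ultimately have "0 \<le> coord \<alpha>\<^sub>0 (root_reflection \<beta> (root_reflection \<gamma> \<alpha>))"
      using assms(2) by (simp add: orbit_def)
    then show ?thesis using g assms by (simp add: root_reflection_conjugate levi_reflection_coord)
  qed
  then show ?thesis
    using assms g by (auto simp: orbit_def reflection_root levi_reflection_coord norm_root_reflection
        multiplicity_reflection)
qed

text \<open>Away from the wall of \<open>\<alpha>\<^sub>0\<close> no root of positive degree is small; for members of \<open>orbit\<close>, which
  have degree one, this says that \<open>\<alpha>\<^sub>0\<close> attains the minimum over \<open>orbit\<close> on the closed chamber.\<close>

lemma inner_upper_ge:
  assumes "\<alpha> \<in> upper" "\<And>s. s \<in> S \<Longrightarrow> 0 \<le> s \<bullet> x"
  shows "coord \<alpha>\<^sub>0 \<alpha> * (\<alpha>\<^sub>0 \<bullet> x) \<le> \<alpha> \<bullet> x"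
proof -
  have "\<alpha> \<bullet> x = (\<Sum>s\<in>S. coord s \<alpha> *\<^sub>R s) \<bullet> x" using pos_expansion[OF upper_pos[OF assms(1)]] by simp
  also have "\<dots> = (\<Sum>s\<in>S. coord s \<alpha> * (s \<bullet> x))" by (simp add: inner_sum_left)
  also have "\<dots> \<ge> (\<Sum>s\<in>{\<alpha>\<^sub>0}. coord s \<alpha> * (s \<bullet> x))"
    using assms pos_coord[OF upper_pos[OF assms(1)]] root0 finite_simple by (intro sum_mono2) auto
  finally show ?thesis by simp
qed

lemma pos_inner_zero:
  assumes "\<alpha> \<in> pos" "\<And>s. s \<in> S \<Longrightarrow> 0 \<le> s \<bullet> x" "\<alpha> \<bullet> x = 0"
  shows "\<exists>s\<in>S. s \<bullet> x = 0"
proof (rule ccontr)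
  assume "\<not> ?thesis"
  then have pos: "0 < s \<bullet> x" if "s \<in> S" for s using assms(2)[OF that] that by force
  have "0 = (\<Sum>s\<in>S. coord s \<alpha> *\<^sub>R s) \<bullet> x" using pos_expansion[OF assms(1)] assms(3) by simp
  also have "\<dots> = (\<Sum>s\<in>S. coord s \<alpha> * (s \<bullet> x))" by (simp add: inner_sum_left)
  finally have "\<forall>s\<in>S. coord s \<alpha> * (s \<bullet> x) = 0"
    using sum_nonneg_eq_0_iff[OF finite_simple, of "\<lambda>s. coord s \<alpha> * (s \<bullet> x)"]
      assms(1,2) pos_coord by (metis mult_nonneg_nonneg)
  then have "\<forall>s\<in>S. coord s \<alpha> = 0" using pos by force
  then have "\<alpha> = 0" using pos_expansion[OF assms(1)] by simp
  then show False using assms(1) pos_root roots_nonzero by blast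
qed

end

section \<open>Drift of the soft minimum over a Levi orbit\<close>

text \<open>The analytic core of the drift estimate. Here \<open>g\<close> is the value of a Levi root \<open>\<gamma>\<close>, and \<open>u\<close>, \<open>v\<close> are the
  values of the two roots of positive degree that arise from \<open>\<gamma>\<close> by reflection in the two members of
  \<open>orbit\<close> exchanged by \<open>\<gamma>\<close>. Multiplied out, the claim is \<open>(1 + g / D)\<^sup>2 \<le> exp (L g)\<close>, which
  explains the threshold \<open>2 / D\<close>.\<close>

lemma exponential_pair_bound:
  fixes g D u v p L :: real
  assumes "0 < g" "0 < D" "g + D \<le> u" "D \<le> v" "0 < p" "2 / D \<le> L"
  shows "p * (1 / u - 1 / g) + p * exp (- (L * g)) * (1 / v + 1 / g) \<le> 0"
proof -
  define E where "E = exp (- (L * g))"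
  have "(1 + g / D)\<^sup>2 \<le> (exp (g / D))\<^sup>2"
    using assms exp_ge_add_one_self[of "g / D"] by (intro power_mono) auto
  also have "\<dots> = exp (2 / D * g)" by (simp add: exp_double[symmetric])
  also have "\<dots> \<le> exp (L * g)"
    using assms mult_right_mono[of "2 / D" L g] by (simp del: times_divide_eq_left)
  finally have "(1 + g / D)\<^sup>2 * E \<le> exp (L * g) * E" by (simp add: E_def)
  then have E: "(1 + g / D)\<^sup>2 * E \<le> 1" by (simp add: E_def exp_minus)
  have "1 / u \<le> 1 / (g + D)" "1 / v \<le> 1 / D" using assms by (auto simp: frac_le)
  then have "1 / u - 1 / g \<le> 1 / (g + D) - 1 / g" "E * (1 / v + 1 / g) \<le> E * (1 / D + 1 / g)"
    by (auto simp: E_def)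
  moreover have "1 / (g + D) - 1 / g + E * (1 / D + 1 / g) = D / (g * (g + D)) * ((1 + g / D)\<^sup>2 * E - 1)"
  proof -
    have "1 / (g + D) - 1 / g = - (D / (g * (g + D)))" using assms by (simp add: field_simps)
    moreover have "1 / D + 1 / g = D / (g * (g + D)) * (1 + g / D)\<^sup>2"
    proof -
      have "1 + g / D = (g + D) / D" using assms by (simp add: add_divide_distrib)
      moreover have "D / (g * w) * (w / D)\<^sup>2 = w / (g * D)" if "w \<noteq> 0" for w
        using assms that by (simp add: power2_eq_square)
      moreover have "1 / D + 1 / g = (g + D) / (g * D)" using assms by (simp add: field_simps)
      ultimately show ?thesis using assms by simp
    qed
    ultimately show ?thesis by (simp only: right_diff_distrib) simp
  qed
  moreover have "D / (g * (g + D)) * ((1 + g / D)\<^sup>2 * E - 1) \<le> 0"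
    using E assms by (intro mult_nonneg_nonpos) auto
  ultimately have "1 / u - 1 / g + E * (1 / v + 1 / g) \<le> 0" by linarith
  then have "p * (1 / u - 1 / g + E * (1 / v + 1 / g)) \<le> 0" using assms by (intro mult_nonneg_nonpos) auto
  then show ?thesis by (simp add: E_def algebra_simps)
qed

context simple_root_data
begin

text \<open>The classical cancellation: the reflection in \<open>\<beta>\<close> pairs these roots, and since \<open>\<beta> \<bullet> x > 0\<close> the root
  with positive product with \<open>\<beta>\<close> has the larger value at \<open>x\<close>, hence the smaller weight.\<close>

lemma upper_pair_drift_nonpos:
  assumes x: "\<And>\<alpha>. \<alpha> \<in> pos \<Longrightarrow> 0 < \<alpha> \<bullet> x" and b: "\<beta> \<in> orbit"
  shows "(\<Sum>\<alpha>\<in>{\<alpha>\<in>upper. 0 < coord \<alpha>\<^sub>0 (root_reflection \<beta> \<alpha>)}. k \<alpha> * (\<alpha> \<bullet> \<beta>) / (\<alpha> \<bullet> x)) \<le> 0"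
proof (rule sum_involution_nonpos[where i = "root_reflection \<beta>"])
  have b': "\<beta> \<in> R" "\<beta> \<noteq> 0" using b orbit_root roots_nonzero by auto
  fix \<alpha> assume a: "\<alpha> \<in> {\<alpha>\<in>upper. 0 < coord \<alpha>\<^sub>0 (root_reflection \<beta> \<alpha>)}"
  show inv: "root_reflection \<beta> (root_reflection \<beta> \<alpha>) = \<alpha>" using b' by (simp add: root_reflection_involution)
  have u: "root_reflection \<beta> \<alpha> \<in> upper" using a b' by (auto simp: upper_def reflection_root)
  then show "root_reflection \<beta> \<alpha> \<in> {\<alpha>\<in>upper. 0 < coord \<alpha>\<^sub>0 (root_reflection \<beta> \<alpha>)}"
    using a inv by (auto simp: upper_def)
  have pos: "0 < \<alpha> \<bullet> x" "0 < root_reflection \<beta> \<alpha> \<bullet> x" "0 < \<beta> \<bullet> x"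
    using u a b x upper_pos orbit_upper by auto
  define r where "r = 2 * (\<alpha> \<bullet> \<beta>) / (norm \<beta>)\<^sup>2 * (\<beta> \<bullet> x)"
  have r: "root_reflection \<beta> \<alpha> \<bullet> x = \<alpha> \<bullet> x - r"
    by (simp add: inner_root_reflection_left r_def)
  have ab: "root_reflection \<beta> \<alpha> \<bullet> \<beta> = - (\<alpha> \<bullet> \<beta>)"
    using b' root_reflection_swap[of \<beta> \<alpha> \<beta>] by (simp add: root_reflection_root)
  have k: "k (root_reflection \<beta> \<alpha>) = k \<alpha>" using b' a upper_root multiplicity_reflection by auto
  have "0 \<le> (\<alpha> \<bullet> \<beta>) * r"
    using pos(3) mult_nonneg_nonneg[of "(\<alpha> \<bullet> \<beta>)\<^sup>2 / (norm \<beta>)\<^sup>2" "2 * (\<beta> \<bullet> x)"]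
    by (simp add: r_def power2_eq_square mult_ac)
  then have "0 \<le> (\<alpha> \<bullet> \<beta>) * r / ((\<alpha> \<bullet> x) * (\<alpha> \<bullet> x - r))"
    using pos r by auto
  moreover have "(\<alpha> \<bullet> \<beta>) / (\<alpha> \<bullet> x) - (\<alpha> \<bullet> \<beta>) / (\<alpha> \<bullet> x - r) = - ((\<alpha> \<bullet> \<beta>) * r / ((\<alpha> \<bullet> x) * (\<alpha> \<bullet> x - r)))"
    using pos r by (simp add: field_simps)
  ultimately have "k \<alpha> * ((\<alpha> \<bullet> \<beta>) / (\<alpha> \<bullet> x) - (\<alpha> \<bullet> \<beta>) / (\<alpha> \<bullet> x - r)) \<le> 0"
    using multiplicity_nonneg a upper_root by (intro mult_nonneg_nonpos) auto
  then show "k \<alpha> * (\<alpha> \<bullet> \<beta>) / (\<alpha> \<bullet> x) +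
      k (root_reflection \<beta> \<alpha>) * (root_reflection \<beta> \<alpha> \<bullet> \<beta>) / (root_reflection \<beta> \<alpha> \<bullet> x) \<le> 0"
    unfolding k ab r by (simp add: algebra_simps)
qed

text \<open>The roots of positive degree that the reflection in \<open>\<beta>\<close> sends to degree zero are not covered by the
  pairing inside \<open>upper\<close>. They are parametrised by the Levi roots having negative product with \<open>\<beta>\<close>.\<close>

lemma levi_reflection_into_upper:
  assumes "\<gamma> \<in> levi" "\<beta> \<in> orbit" "\<gamma> \<bullet> \<beta> < 0"
  shows "root_reflection \<beta> \<gamma> \<in> upper"
    and "coord \<alpha>\<^sub>0 (root_reflection \<beta> \<gamma>) = - 2 * (\<gamma> \<bullet> \<beta>) / (norm \<alpha>\<^sub>0)\<^sup>2"
proof -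
  have b: "coord \<alpha>\<^sub>0 \<beta> = 1" "norm \<beta> = norm \<alpha>\<^sub>0" "\<beta> \<in> R" "\<beta> \<noteq> 0"
    using assms(2) roots_nonzero[OF orbit_root[OF assms(2)]] by (simp_all add: orbit_def)
  show c: "coord \<alpha>\<^sub>0 (root_reflection \<beta> \<gamma>) = - 2 * (\<gamma> \<bullet> \<beta>) / (norm \<alpha>\<^sub>0)\<^sup>2"
    using assms(1) b by (simp add: coord_reflection levi_def inner_commute)
  have "0 < - 2 * (\<gamma> \<bullet> \<beta>) / (norm \<alpha>\<^sub>0)\<^sup>2"
    using assms(3) b by (intro divide_pos_pos) auto
  then show "root_reflection \<beta> \<gamma> \<in> upper"
    using c b assms(1) levi_root reflection_root by (simp add: upper_def)
qed

text \<open>Split \<open>upper\<close> according to the degree of the reflected root: \<open>\<beta>\<close> itself gives the Bessel drift, positive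
  degree gives pairs of nonpositive sum, and degree zero leaves the sum over Levi roots on the right.\<close>

lemma upper_drift_bound:
  assumes x: "\<And>\<alpha>. \<alpha> \<in> pos \<Longrightarrow> 0 < \<alpha> \<bullet> x" and b: "\<beta> \<in> orbit"
  shows "(\<Sum>\<alpha>\<in>upper. k \<alpha> * (\<alpha> \<bullet> \<beta>) / (\<alpha> \<bullet> x)) \<le>
    k \<alpha>\<^sub>0 * (norm \<alpha>\<^sub>0)\<^sup>2 / (\<beta> \<bullet> x) +
    (\<Sum>\<gamma>\<in>{\<gamma>\<in>levi. \<gamma> \<bullet> \<beta> < 0}. k \<gamma> * - (\<gamma> \<bullet> \<beta>) / (root_reflection \<beta> \<gamma> \<bullet> x))"
    (is "sum ?t upper \<le> _ + ?r")
proof -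
  let ?P1 = "{\<alpha>\<in>upper. 0 < coord \<alpha>\<^sub>0 (root_reflection \<beta> \<alpha>)}"
  let ?P0 = "{\<alpha>\<in>upper. coord \<alpha>\<^sub>0 (root_reflection \<beta> \<alpha>) = 0}"
  have b': "\<beta> \<in> R" "\<beta> \<noteq> 0" "\<beta> \<in> upper" "coord \<alpha>\<^sub>0 \<beta> = 1" "norm \<beta> = norm \<alpha>\<^sub>0" "k \<beta> = k \<alpha>\<^sub>0"
    using b orbit_upper[OF b] roots_nonzero[OF orbit_root[OF b]] by (simp_all add: orbit_def)
  have neg: "coord \<alpha>\<^sub>0 (root_reflection \<beta> \<beta>) = -1" using b' by (simp add: root_reflection_root coord_neg)
  have "\<forall>\<alpha>\<in>upper - {\<beta>}. 0 \<le> coord \<alpha>\<^sub>0 (root_reflection \<beta> \<alpha>)" using b by (simp add: orbit_def)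
  then have "\<forall>\<alpha>\<in>upper. \<alpha> = \<beta> \<or> \<alpha> \<in> ?P1 \<or> \<alpha> \<in> ?P0" by force
  then have "upper = insert \<beta> (?P1 \<union> ?P0)" using b'(3) by blast
  then have "sum ?t upper = sum ?t (insert \<beta> (?P1 \<union> ?P0))" by simp
  also have "\<dots> = ?t \<beta> + sum ?t (?P1 \<union> ?P0)"
    using finite_upper neg by (intro sum.insert) auto
  also have "sum ?t (?P1 \<union> ?P0) = sum ?t ?P1 + sum ?t ?P0"
    using finite_upper by (intro sum.union_disjoint) auto
  also have "sum ?t ?P0 = ?r"
  proof (rule sum.reindex_bij_witness[where i = "root_reflection \<beta>" and j = "root_reflection \<beta>"])
    fix \<alpha> assume a: "\<alpha> \<in> ?P0"
    show "root_reflection \<beta> (root_reflection \<beta> \<alpha>) = \<alpha>" using b' by (simp add: root_reflection_involution)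
    have ab: "root_reflection \<beta> \<alpha> \<bullet> \<beta> = - (\<alpha> \<bullet> \<beta>)"
      using b' root_reflection_swap[of \<beta> \<alpha> \<beta>] by (simp add: root_reflection_root)
    have "coord \<alpha>\<^sub>0 \<alpha> = 2 * (\<alpha> \<bullet> \<beta>) / (norm \<beta>)\<^sup>2"
      using a b' by (simp add: coord_reflection inner_commute)
    moreover have "0 < coord \<alpha>\<^sub>0 \<alpha>" using a by (simp add: upper_def)
    ultimately have "0 < \<alpha> \<bullet> \<beta>" using b' by (simp add: zero_less_divide_iff)
    then show "root_reflection \<beta> \<alpha> \<in> {\<gamma>\<in>levi. \<gamma> \<bullet> \<beta> < 0}"
      using a b' ab reflection_root upper_root by (auto simp: levi_def)
    show "k (root_reflection \<beta> \<alpha>) * - (root_reflection \<beta> \<alpha> \<bullet> \<beta>) / (root_reflection \<beta> (root_reflection \<beta> \<alpha>) \<bullet> x)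
       = ?t \<alpha>"
      using a b' ab multiplicity_reflection upper_root by (simp add: root_reflection_involution)
  next
    fix \<gamma> assume g: "\<gamma> \<in> {\<gamma>\<in>levi. \<gamma> \<bullet> \<beta> < 0}"
    show "root_reflection \<beta> (root_reflection \<beta> \<gamma>) = \<gamma>" using b' by (simp add: root_reflection_involution)
    then show "root_reflection \<beta> \<gamma> \<in> ?P0"
      using g b levi_reflection_into_upper(1) by (auto simp: levi_def)
  qed
  also have "?t \<beta> = k \<alpha>\<^sub>0 * (norm \<alpha>\<^sub>0)\<^sup>2 / (\<beta> \<bullet> x)"
    using b' by (simp add: power2_norm_eq_inner[symmetric])
  finally show ?thesis using upper_pair_drift_nonpos[OF x b] by linarith
qed

text \<open>Each term is even in \<open>\<gamma>\<close>, so the representative of \<open>{\<gamma>, - \<gamma>}\<close> may be chosen by the sign of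
  \<open>\<gamma> \<bullet> \<beta>\<close> instead of by positivity. This matches the index set left over by
  \<open>upper_drift_bound\<close>.\<close>

lemma levi_drift_reorient:
  assumes b: "\<beta> \<in> orbit"
  shows "(\<Sum>\<gamma>\<in>pos \<inter> levi. k \<gamma> * (\<gamma> \<bullet> \<beta>) / (\<gamma> \<bullet> x)) =
    (\<Sum>\<gamma>\<in>{\<gamma>\<in>levi. \<gamma> \<bullet> \<beta> < 0}. k \<gamma> * (\<gamma> \<bullet> \<beta>) / (\<gamma> \<bullet> x))" (is "sum ?t _ = _")
proof -
  have "sum ?t (pos \<inter> levi) = sum ?t {\<gamma>\<in>pos \<inter> levi. \<gamma> \<bullet> \<beta> \<noteq> 0}"
    using finite_pos by (intro sum.mono_neutral_right) auto
  also have "\<dots> = sum ?t {\<gamma>\<in>levi. \<gamma> \<bullet> \<beta> < 0}"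
  proof (rule sum.reindex_bij_witness[where
      i = "\<lambda>\<gamma>. if \<gamma> \<in> pos then \<gamma> else - \<gamma>" and j = "\<lambda>\<gamma>. if \<gamma> \<bullet> \<beta> < 0 then \<gamma> else - \<gamma>"])
  qed (use not_pos_and_neg pos_or_neg[OF levi_root] levi_neg multiplicity_neg[OF levi_root] in
      \<open>auto split: if_splits\<close>)
  finally show ?thesis .
qed

text \<open>Here \<open>\<beta>'\<close> is the member of \<open>orbit\<close> farther from the minimum at \<open>x\<close>. Its exponential weight is smaller by
  the factor \<open>exp (- s (\<gamma> \<bullet> x) / \<epsilon>)\<close>, and \<open>sep\<close> asks exactly that this decay is fast enough for
  \<open>exponential_pair_bound\<close>.\<close>

lemma levi_pair_drift_nonpos:
  assumes x: "\<And>\<alpha>. \<alpha> \<in> pos \<Longrightarrow> 0 < \<alpha> \<bullet> x" and d: "0 < \<delta>" "\<delta> \<le> \<alpha>\<^sub>0 \<bullet> x" and e: "0 < \<epsilon>"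
    and sep: "\<And>\<gamma> \<beta>. \<gamma> \<in> levi \<Longrightarrow> \<beta> \<in> orbit \<Longrightarrow> \<gamma> \<bullet> \<beta> \<noteq> 0 \<Longrightarrow>
          \<epsilon> \<le> 2 * (\<gamma> \<bullet> \<beta>)\<^sup>2 / ((norm \<alpha>\<^sub>0)\<^sup>2 * (norm \<gamma>)\<^sup>2) * \<delta>"
    and g: "\<gamma> \<in> levi" and b: "\<beta> \<in> orbit" and gb: "\<gamma> \<bullet> \<beta> < 0" and gx: "0 < \<gamma> \<bullet> x"
    and b': "\<beta>' = root_reflection \<gamma> \<beta>"
  shows "exp (- (\<beta> \<bullet> x) / \<epsilon>) * (1 / (root_reflection \<beta> \<gamma> \<bullet> x) - 1 / (\<gamma> \<bullet> x)) +
     exp (- (\<beta>' \<bullet> x) / \<epsilon>) * (1 / (root_reflection \<beta>' (- \<gamma>) \<bullet> x) + 1 / (\<gamma> \<bullet> x)) \<le> 0"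
proof -
  define c where "c = - 2 * (\<gamma> \<bullet> \<beta>) / (norm \<alpha>\<^sub>0)\<^sup>2"
  define s where "s = - 2 * (\<gamma> \<bullet> \<beta>) / (norm \<gamma>)\<^sup>2"
  have nz: "\<gamma> \<noteq> 0" "\<alpha>\<^sub>0 \<noteq> 0" "norm \<beta> = norm \<alpha>\<^sub>0"
    using b roots_nonzero[OF levi_root[OF g]] roots_nonzero[OF root0_root] by (simp_all add: orbit_def)
  have b'o: "\<beta>' \<in> orbit" using g b b' levi_reflection_orbit by simp
  have c0: "0 < c" unfolding c_def using gb nz by (intro divide_pos_pos) auto
  have gb': "\<gamma> \<bullet> \<beta>' = - (\<gamma> \<bullet> \<beta>)"
    using nz b' root_reflection_swap[of \<gamma> \<gamma> \<beta>] by (simp add: root_reflection_root)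
  have S: "0 \<le> s \<bullet> x" if "s \<in> S" for s using x simple_pos that by (simp add: less_imp_le)
  have ge: "\<delta> * c \<le> \<alpha> \<bullet> x" if "\<alpha> \<in> upper" "coord \<alpha>\<^sub>0 \<alpha> = c" for \<alpha>
  proof -
    have "c * \<delta> \<le> c * (\<alpha>\<^sub>0 \<bullet> x)" using d c0 by (intro mult_left_mono) auto
    then show ?thesis using inner_upper_ge[OF that(1) S] that(2) by (simp add: mult.commute[of \<delta>])
  qed
  have bx: "\<delta> \<le> \<beta> \<bullet> x"
    using inner_upper_ge[OF orbit_upper[OF b] S] b d by (simp add: orbit_def)
  have 1: "root_reflection \<beta> \<gamma> \<bullet> x = \<gamma> \<bullet> x + c * (\<beta> \<bullet> x)"
    using nz by (simp add: inner_root_reflection_left c_def)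
  have 2: "\<delta> * c \<le> root_reflection \<beta>' (- \<gamma>) \<bullet> x"
    using levi_reflection_into_upper[of "- \<gamma>" \<beta>'] g b'o gb gb' levi_neg[OF g]
    by (intro ge) (simp_all add: c_def)
  have 3: "\<beta>' \<bullet> x = \<beta> \<bullet> x + s * (\<gamma> \<bullet> x)"
    by (simp add: b' inner_root_reflection_left s_def inner_commute[of \<beta> \<gamma>])
  have 4: "exp (- (\<beta>' \<bullet> x) / \<epsilon>) = exp (- (\<beta> \<bullet> x) / \<epsilon>) * exp (- (s / \<epsilon> * (\<gamma> \<bullet> x)))"
    unfolding 3 by (simp add: exp_add[symmetric] add_divide_distrib algebra_simps diff_divide_distrib)
  have "\<epsilon> \<le> s * (\<delta> * c) / 2"
    using sep[OF g b] gb by (simp add: s_def c_def power2_eq_square mult_ac)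
  then have 5: "2 / (\<delta> * c) \<le> s / \<epsilon>"
    using e d c0 by (simp add: field_simps)
  have "\<delta> * c \<le> c * (\<beta> \<bullet> x)" using bx c0 by (simp add: mult.commute)
  then show ?thesis unfolding 4
    using exponential_pair_bound[of "\<gamma> \<bullet> x" "\<delta> * c" "root_reflection \<beta> \<gamma> \<bullet> x"
        "root_reflection \<beta>' (- \<gamma>) \<bullet> x" "exp (- (\<beta> \<bullet> x) / \<epsilon>)" "s / \<epsilon>"]
      gx d c0 1 2 5 by simp
qed

text \<open>The weights \<open>exp (- \<beta> \<bullet> x / \<epsilon>)\<close> are those of the gradient of the soft minimum. After removing the Bessel
  drift, everything left is a sum over pairs \<open>(\<beta>, \<gamma>)\<close> with \<open>\<gamma> \<bullet> \<beta> < 0\<close>, on which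
  \<open>(\<beta>, \<gamma>) \<mapsto> (\<sigma>\<^sub>\<gamma> \<beta>, - \<gamma>)\<close> is an involution with nonpositive pair sums.\<close>

lemma softmin_drift_bound:
  assumes x: "\<And>\<alpha>. \<alpha> \<in> pos \<Longrightarrow> 0 < \<alpha> \<bullet> x" and d: "0 < \<delta>" "\<delta> \<le> \<alpha>\<^sub>0 \<bullet> x" and e: "0 < \<epsilon>"
    and sep: "\<And>\<gamma> \<beta>. \<gamma> \<in> levi \<Longrightarrow> \<beta> \<in> orbit \<Longrightarrow> \<gamma> \<bullet> \<beta> \<noteq> 0 \<Longrightarrow>
          \<epsilon> \<le> 2 * (\<gamma> \<bullet> \<beta>)\<^sup>2 / ((norm \<alpha>\<^sub>0)\<^sup>2 * (norm \<gamma>)\<^sup>2) * \<delta>"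
  shows "(\<Sum>\<alpha>\<in>pos. k \<alpha> * ((\<Sum>\<beta>\<in>orbit. exp (- (\<beta> \<bullet> x) / \<epsilon>) * (\<alpha> \<bullet> \<beta>)) / (\<alpha> \<bullet> x)))
     \<le> k \<alpha>\<^sub>0 * (norm \<alpha>\<^sub>0)\<^sup>2 / (\<alpha>\<^sub>0 \<bullet> x) * (\<Sum>\<beta>\<in>orbit. exp (- (\<beta> \<bullet> x) / \<epsilon>))"
proof -
  define p where "p \<beta> = exp (- (\<beta> \<bullet> x) / \<epsilon>)" for \<beta>
  define q where "q = k \<alpha>\<^sub>0 * (norm \<alpha>\<^sub>0)\<^sup>2"
  let ?t = "\<lambda>\<alpha> \<beta>. k \<alpha> * (\<alpha> \<bullet> \<beta>) / (\<alpha> \<bullet> x)"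
  let ?N = "\<lambda>\<beta>. {\<gamma>\<in>levi. \<gamma> \<bullet> \<beta> < 0}"
  define h where "h \<beta> \<gamma> = k \<gamma> * - (\<gamma> \<bullet> \<beta>) * (p \<beta> * (1 / (root_reflection \<beta> \<gamma> \<bullet> x) - 1 / (\<gamma> \<bullet> x)))" for \<beta> \<gamma>
  have S: "0 \<le> s \<bullet> x" if "s \<in> S" for s using x simple_pos that by (simp add: less_imp_le)
  have "(\<Sum>\<alpha>\<in>pos. k \<alpha> * ((\<Sum>\<beta>\<in>orbit. p \<beta> * (\<alpha> \<bullet> \<beta>)) / (\<alpha> \<bullet> x)))
     = (\<Sum>\<alpha>\<in>pos. \<Sum>\<beta>\<in>orbit. p \<beta> * ?t \<alpha> \<beta>)"
    by (simp add: sum_distrib_left sum_divide_distrib mult_ac)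
  also have "\<dots> = (\<Sum>\<beta>\<in>orbit. p \<beta> * (\<Sum>\<alpha>\<in>pos. ?t \<alpha> \<beta>))"
    by (subst sum.swap) (simp add: sum_distrib_left)
  also have "\<dots> \<le> (\<Sum>\<beta>\<in>orbit. p \<beta> * (q / (\<alpha>\<^sub>0 \<bullet> x)) + (\<Sum>\<gamma>\<in>?N \<beta>. h \<beta> \<gamma>))"
  proof (rule sum_mono)
    fix \<beta> assume b: "\<beta> \<in> orbit"
    have "(\<Sum>\<alpha>\<in>pos. ?t \<alpha> \<beta>) = (\<Sum>\<alpha>\<in>pos \<inter> levi. ?t \<alpha> \<beta>) + (\<Sum>\<alpha>\<in>upper. ?t \<alpha> \<beta>)"
      using finite_pos finite_upper pos_split(2) by (subst pos_split(1)) (simp add: sum.union_disjoint)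
    also have "\<dots> \<le> (\<Sum>\<gamma>\<in>?N \<beta>. ?t \<gamma> \<beta>) + (q / (\<beta> \<bullet> x) +
        (\<Sum>\<gamma>\<in>?N \<beta>. k \<gamma> * - (\<gamma> \<bullet> \<beta>) / (root_reflection \<beta> \<gamma> \<bullet> x)))"
      using upper_drift_bound[OF x b] levi_drift_reorient[OF b] by (simp add: q_def)
    also have "\<dots> \<le> (\<Sum>\<gamma>\<in>?N \<beta>. ?t \<gamma> \<beta>) + (q / (\<alpha>\<^sub>0 \<bullet> x) +
        (\<Sum>\<gamma>\<in>?N \<beta>. k \<gamma> * - (\<gamma> \<bullet> \<beta>) / (root_reflection \<beta> \<gamma> \<bullet> x)))"
      using inner_upper_ge[OF orbit_upper[OF b] S] b d multiplicity_nonneg[OF root0_root]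
      by (intro add_mono order_refl divide_left_mono mult_pos_pos)
        (auto simp: orbit_def q_def)
    also have "\<dots> = q / (\<alpha>\<^sub>0 \<bullet> x) +
        (\<Sum>\<gamma>\<in>?N \<beta>. k \<gamma> * - (\<gamma> \<bullet> \<beta>) * (1 / (root_reflection \<beta> \<gamma> \<bullet> x) - 1 / (\<gamma> \<bullet> x)))"
      by (simp add: sum.distrib[symmetric] algebra_simps)
    finally have "p \<beta> * (\<Sum>\<alpha>\<in>pos. ?t \<alpha> \<beta>) \<le> p \<beta> * (q / (\<alpha>\<^sub>0 \<bullet> x) +
        (\<Sum>\<gamma>\<in>?N \<beta>. k \<gamma> * - (\<gamma> \<bullet> \<beta>) * (1 / (root_reflection \<beta> \<gamma> \<bullet> x) - 1 / (\<gamma> \<bullet> x))))"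
      by (intro mult_left_mono) (auto simp: p_def)
    also have "\<dots> = p \<beta> * (q / (\<alpha>\<^sub>0 \<bullet> x)) + (\<Sum>\<gamma>\<in>?N \<beta>. h \<beta> \<gamma>)"
      by (simp add: distrib_left sum_distrib_left h_def mult_ac)
    finally show "p \<beta> * (\<Sum>\<alpha>\<in>pos. ?t \<alpha> \<beta>) \<le> p \<beta> * (q / (\<alpha>\<^sub>0 \<bullet> x)) + (\<Sum>\<gamma>\<in>?N \<beta>. h \<beta> \<gamma>)" .
  qed
  also have "\<dots> = q / (\<alpha>\<^sub>0 \<bullet> x) * (\<Sum>\<beta>\<in>orbit. p \<beta>) + (\<Sum>(\<beta>, \<gamma>)\<in>Sigma orbit ?N. h \<beta> \<gamma>)"
    using finite_orbit finite_levi by (simp add: sum.distrib sum.Sigma sum_distrib_left mult.commute)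
  also have "(\<Sum>(\<beta>, \<gamma>)\<in>Sigma orbit ?N. h \<beta> \<gamma>) \<le> 0"
  proof (rule sum_involution_nonpos[where i = "\<lambda>(\<beta>, \<gamma>). (root_reflection \<gamma> \<beta>, - \<gamma>)"])
    fix z assume z: "z \<in> Sigma orbit ?N"
    obtain \<beta> \<gamma> where zz: "z = (\<beta>, \<gamma>)" by (cases z)
    have bg: "\<beta> \<in> orbit" "\<gamma> \<in> levi" "\<gamma> \<bullet> \<beta> < 0" using z zz by auto
    have nz: "\<gamma> \<noteq> 0" using bg roots_nonzero levi_root by auto
    define \<beta>' where "\<beta>' = root_reflection \<gamma> \<beta>"
    have b': "\<beta>' \<in> orbit" "- \<gamma> \<in> levi" "root_reflection \<gamma> \<beta>' = \<beta>"
      using bg levi_reflection_orbit levi_neg nz by (auto simp: \<beta>'_def root_reflection_involution)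
    have gb': "\<gamma> \<bullet> \<beta>' = - (\<gamma> \<bullet> \<beta>)"
      using nz root_reflection_swap[of \<gamma> \<gamma> \<beta>] by (simp add: \<beta>'_def root_reflection_root)
    show "(case z of (\<beta>, \<gamma>) \<Rightarrow> (root_reflection \<gamma> \<beta>, - \<gamma>)) \<in> Sigma orbit ?N"
      using zz b' bg gb' by (simp add: \<beta>'_def[symmetric])
    show "(case case z of (\<beta>, \<gamma>) \<Rightarrow> (root_reflection \<gamma> \<beta>, - \<gamma>) of (\<beta>, \<gamma>) \<Rightarrow> (root_reflection \<gamma> \<beta>, - \<gamma>)) = z"
      using zz nz by (simp add: root_reflection_neg root_reflection_involution)
    have "\<gamma> \<bullet> x \<noteq> 0"
      using x[of \<gamma>] x[of "- \<gamma>"] pos_or_neg[of \<gamma>] bg levi_root by auto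
    then have *: "p \<beta> * (1 / (root_reflection \<beta> \<gamma> \<bullet> x) - 1 / (\<gamma> \<bullet> x)) +
        p \<beta>' * (1 / (root_reflection \<beta>' (- \<gamma>) \<bullet> x) - 1 / (- \<gamma> \<bullet> x)) \<le> 0"
    proof (cases "0 < \<gamma> \<bullet> x")
      case True
      then show ?thesis
        using levi_pair_drift_nonpos[OF x d e sep bg(2,1,3) True \<beta>'_def] by (simp add: p_def)
    next
      case False
      then have "0 < - \<gamma> \<bullet> x" using \<open>\<gamma> \<bullet> x \<noteq> 0\<close> by simp
      moreover have "- \<gamma> \<bullet> \<beta>' < 0" "\<beta> = root_reflection (- \<gamma>) \<beta>'"
        using gb' bg(3) b'(3) by (simp_all add: root_reflection_neg)
      ultimately have "exp (- (\<beta>' \<bullet> x) / \<epsilon>) * (1 / (root_reflection \<beta>' (- \<gamma>) \<bullet> x) - 1 / (- \<gamma> \<bullet> x)) +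
          exp (- (\<beta> \<bullet> x) / \<epsilon>) * (1 / (root_reflection \<beta> (- (- \<gamma>)) \<bullet> x) + 1 / (- \<gamma> \<bullet> x)) \<le> 0"
        by (intro levi_pair_drift_nonpos[OF x d e sep b'(2,1)])
      then show ?thesis by (simp add: p_def)
    qed
    have "k (- \<gamma>) = k \<gamma>" using multiplicity_neg bg levi_root by auto
    then have "h \<beta> \<gamma> + h \<beta>' (- \<gamma>) = k \<gamma> * - (\<gamma> \<bullet> \<beta>) * (p \<beta> * (1 / (root_reflection \<beta> \<gamma> \<bullet> x) - 1 / (\<gamma> \<bullet> x)) +
        p \<beta>' * (1 / (root_reflection \<beta>' (- \<gamma>) \<bullet> x) - 1 / (- \<gamma> \<bullet> x)))"
      by (simp only: h_def gb' inner_minus_left distrib_left minus_minus)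
    also have "\<dots> \<le> 0"
      using * bg multiplicity_nonneg levi_root by (intro mult_nonneg_nonpos mult_nonneg_nonneg) auto
    finally show "(case z of (\<beta>, \<gamma>) \<Rightarrow> h \<beta> \<gamma>) +
        (case case z of (\<beta>, \<gamma>) \<Rightarrow> (root_reflection \<gamma> \<beta>, - \<gamma>) of (\<beta>, \<gamma>) \<Rightarrow> h \<beta> \<gamma>) \<le> 0"
      using zz by (simp add: \<beta>'_def)
  qed
  finally show ?thesis by (simp add: p_def q_def)
qed

end

section \<open>Smooth functions on a closed chamber and the generator at its walls\<close>

text \<open>Carrying the gradient and the Hessian as explicit functions lets the Laplacian and the drift of a
  composite test function be read off from the rules below.\<close>

definition C2_with :: "('a::euclidean_space \<Rightarrow> real) \<Rightarrow> ('a \<Rightarrow> 'a) \<Rightarrow> ('a \<Rightarrow> 'a \<Rightarrow> 'a) \<Rightarrow> bool" where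
  "C2_with u g h \<longleftrightarrow> (\<forall>x. (u has_derivative (\<lambda>v. g x \<bullet> v)) (at x)) \<and>
     (\<forall>x. (g has_derivative h x) (at x)) \<and> (\<forall>v. continuous_on UNIV (\<lambda>x. h x v))"

lemma C2_withD:
  assumes "C2_with u g h"
  shows "(u has_derivative (\<lambda>v. g x \<bullet> v)) (at x)" "(g has_derivative h x) (at x)"
    "continuous_on UNIV (\<lambda>x. h x v)" "continuous_on UNIV u" "continuous_on UNIV g"
  using assms
  by (auto simp: C2_with_def continuous_on_eq_continuous_at intro: has_derivative_continuous)

lemma C2_with_inner: "C2_with (\<lambda>x. \<beta> \<bullet> x) (\<lambda>_. \<beta>) (\<lambda>_ _. 0)"
  by (auto simp: C2_with_def intro!: derivative_eq_intros)

lemma C2_with_inner_self: "C2_with (\<lambda>x. x \<bullet> x) (\<lambda>x. 2 *\<^sub>R x) (\<lambda>_ v. 2 *\<^sub>R v)"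
  by (auto simp: C2_with_def inner_commute intro!: derivative_eq_intros)

lemma C2_with_const: "C2_with (\<lambda>_. c) (\<lambda>_. 0) (\<lambda>_ _. 0)"
  by (auto simp: C2_with_def)

lemma C2_with_add:
  assumes "C2_with u g h" "C2_with u' g' h'"
  shows "C2_with (\<lambda>x. u x + u' x) (\<lambda>x. g x + g' x) (\<lambda>x v. h x v + h' x v)"
  using assms
  by (auto simp: C2_with_def inner_add_left intro!: has_derivative_add continuous_on_add)

lemma C2_with_sum:
  assumes "finite A" "\<And>i. i \<in> A \<Longrightarrow> C2_with (u i) (g i) (h i)"
  shows "C2_with (\<lambda>x. \<Sum>i\<in>A. u i x) (\<lambda>x. \<Sum>i\<in>A. g i x) (\<lambda>x v. \<Sum>i\<in>A. h i x v)"
  using assms by (induction rule: finite_induct) (auto intro: C2_with_const C2_with_add)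

lemma C2_with_mult:
  assumes "C2_with u g h" "C2_with u' g' h'"
  shows "C2_with (\<lambda>x. u x * u' x) (\<lambda>x. u x *\<^sub>R g' x + u' x *\<^sub>R g x)
    (\<lambda>x v. u x *\<^sub>R h' x v + (g x \<bullet> v) *\<^sub>R g' x + (u' x *\<^sub>R h x v + (g' x \<bullet> v) *\<^sub>R g x))"
proof -
  note d = C2_withD[OF assms(1)] C2_withD[OF assms(2)]
  show ?thesis unfolding C2_with_def
  proof (intro conjI allI)
    fix x
    show "((\<lambda>x. u x * u' x) has_derivative (\<lambda>v. (u x *\<^sub>R g' x + u' x *\<^sub>R g x) \<bullet> v)) (at x)"
      by (rule has_derivative_eq_rhs[OF has_derivative_mult[OF d(1,6)]]) (auto simp: inner_add_left mult_ac)
    show "((\<lambda>x. u x *\<^sub>R g' x + u' x *\<^sub>R g x) has_derivative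
        (\<lambda>v. u x *\<^sub>R h' x v + (g x \<bullet> v) *\<^sub>R g' x + (u' x *\<^sub>R h x v + (g' x \<bullet> v) *\<^sub>R g x))) (at x)"
      by (intro has_derivative_add has_derivative_scaleR d)
  next
    fix v
    show "continuous_on UNIV (\<lambda>x. u x *\<^sub>R h' x v + (g x \<bullet> v) *\<^sub>R g' x + (u' x *\<^sub>R h x v + (g' x \<bullet> v) *\<^sub>R g x))"
      by (intro continuous_intros d)
  qed
qed

lemma C2_with_compose:
  assumes u: "C2_with u g h" and r: "\<And>x. u x \<in> A"
    and f: "\<And>s. s \<in> A \<Longrightarrow> (f has_real_derivative f' s) (at s)"
    and f': "\<And>s. s \<in> A \<Longrightarrow> (f' has_real_derivative f'' s) (at s)"
    and f'': "continuous_on A f''"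
  shows "C2_with (\<lambda>x. f (u x)) (\<lambda>x. f' (u x) *\<^sub>R g x)
    (\<lambda>x v. f' (u x) *\<^sub>R h x v + (f'' (u x) * (g x \<bullet> v)) *\<^sub>R g x)"
proof -
  note d = C2_withD[OF u]
  have c: "continuous_on UNIV (\<lambda>x. f' (u x))" "continuous_on UNIV (\<lambda>x. f'' (u x))"
  proof -
    have "continuous_on A f'" using f' by (intro DERIV_continuous_on) (blast intro: has_field_derivative_at_within)
    then show "continuous_on UNIV (\<lambda>x. f' (u x))"
      by (rule continuous_on_compose2[OF _ d(4)]) (use r in auto)
    show "continuous_on UNIV (\<lambda>x. f'' (u x))"
      by (rule continuous_on_compose2[OF f'' d(4)]) (use r in auto)
  qed
  show ?thesis unfolding C2_with_def
  proof (intro conjI allI)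
    fix x
    have 1: "((\<lambda>x. f' (u x)) has_derivative (\<lambda>v. f'' (u x) * (g x \<bullet> v))) (at x)"
      using has_derivative_compose[OF d(1) f'[OF r[of x], unfolded has_field_derivative_def]]
      by simp
    show "((\<lambda>x. f (u x)) has_derivative (\<lambda>v. (f' (u x) *\<^sub>R g x) \<bullet> v)) (at x)"
      using has_derivative_compose[OF d(1) f[OF r[of x], unfolded has_field_derivative_def]]
      by simp
    show "((\<lambda>x. f' (u x) *\<^sub>R g x) has_derivative
        (\<lambda>v. f' (u x) *\<^sub>R h x v + (f'' (u x) * (g x \<bullet> v)) *\<^sub>R g x)) (at x)"
      by (intro has_derivative_scaleR 1 d)
  next
    fix v
    show "continuous_on UNIV (\<lambda>x. f' (u x) *\<^sub>R h x v + (f'' (u x) * (g x \<bullet> v)) *\<^sub>R g x)"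
      by (intro continuous_intros c d)
  qed
qed

text \<open>Along the segment to any point of \<open>D\<close> the derivative is one-dimensional and hence unique; the segments
  to an interior ball span the space.\<close>

lemma has_derivative_within_convex_unique:
  fixes f :: "'a::euclidean_space \<Rightarrow> 'b::real_normed_vector"
  assumes D: "convex D" "interior D \<noteq> {}" "x \<in> D"
    and f: "(f has_derivative f1) (at x within D)" "(f has_derivative f2) (at x within D)"
  shows "f1 = f2"
proof -
  define L where "L v = f1 v - f2 v" for v
  have L: "((\<lambda>_. 0) has_derivative L) (at x within D)"
    unfolding L_def using has_derivative_diff[OF f] by simp
  then have lin: "linear L" by (rule has_derivative_linear)
  have zero: "L (z - x) = 0" if "z \<in> D" for z
  proof -
    let ?p = "\<lambda>t::real. x + t *\<^sub>R (z - x)"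
    have "?p ` {0..1} \<subseteq> D"
    proof
      fix w assume "w \<in> ?p ` {0..1}"
      then obtain t where t: "0 \<le> t" "t \<le> 1" "w = x + t *\<^sub>R (z - x)" by auto
      have "w = (1 - t) *\<^sub>R x + t *\<^sub>R z" using t(3) by (simp add: algebra_simps)
      then show "w \<in> D" using convexD[OF D(1) D(3) that, of "1 - t" t] t by simp
    qed
    then have "((\<lambda>_. 0) has_derivative L) (at (?p 0) within ?p ` {0..1})"
      using L by (auto intro: has_derivative_subset)
    moreover have "(?p has_derivative (\<lambda>t. t *\<^sub>R (z - x))) (at 0 within {0..1})"
      by (auto intro!: derivative_eq_intros)
    ultimately have "((\<lambda>_. 0) has_derivative (\<lambda>t. L (t *\<^sub>R (z - x)))) (at (0::real) within {0..1})"
      using has_derivative_in_compose[of ?p _ 0 "{0..1}" "\<lambda>_. 0" L] by simp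
    then have "((\<lambda>_. 0) has_vector_derivative L (z - x)) (at (0::real) within {0..1})"
      using lin by (simp add: has_vector_derivative_def linear_scale)
    moreover have "((\<lambda>_. 0) has_vector_derivative (0::'b)) (at (0::real) within {0..1})" by simp
    moreover have "at (0::real) within {0..1} \<noteq> bot" by (simp add: trivial_limit_within)
    ultimately show ?thesis by (metis vector_derivative_unique_within)
  qed
  obtain c e where e: "0 < e" "ball c e \<subseteq> D"
    using D(2) mem_interior by (metis equals0I)
  have "L v = 0" for v
  proof (cases "v = 0")
    case False
    define r where "r = e / (2 * norm v)"
    have r: "r > 0" using e False by (simp add: r_def)
    have "c + r *\<^sub>R v \<in> ball c e" "c \<in> ball c e" using e False by (auto simp: r_def dist_norm)
    then have "L (c + r *\<^sub>R v - x) = 0" "L (c - x) = 0" using e zero by blast+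
    moreover have "c + r *\<^sub>R v - x = (c - x) + r *\<^sub>R v" by simp
    ultimately have "r *\<^sub>R L v = 0" using lin by (metis add_0 linear_add linear_scale)
    then show ?thesis using r by simp
  qed (use lin in \<open>simp add: linear_0\<close>)
  then show ?thesis by (auto simp: L_def)
qed

lemma C2_with_within:
  assumes D: "convex D" "interior D \<noteq> {}" and u: "C2_with u g h"
  shows "x \<in> D \<Longrightarrow> gradient_within D u x = g x"
    and "x \<in> D \<Longrightarrow> hessian_within D u x = h x"
    and "x \<in> D \<Longrightarrow> laplacian_within D u x = (\<Sum>b\<in>Basis. h x b \<bullet> b)"
    and "C2_on D u"
proof -
  have du: "(u has_derivative (\<lambda>v. g x \<bullet> v)) (at x within D)" for x
    using C2_withD(1)[OF u] by (rule has_derivative_at_withinI)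
  have dg: "(g has_derivative h x) (at x within D)" for x
    using C2_withD(2)[OF u] by (rule has_derivative_at_withinI)
  have frechet: "frechet_derivative f (at x within D) = f'"
    if "x \<in> D" "(f has_derivative f') (at x within D)" for x f' and f :: "'a \<Rightarrow> 'b::real_normed_vector"
    using has_derivative_within_convex_unique[OF D that(1) _ that(2)] that(2)
    by (metis differentiableI frechet_derivative_works)
  have grad: "gradient_within D u x = g x" if "x \<in> D" for x
    by (simp add: gradient_within_def frechet[OF that du] euclidean_representation)
  then show "x \<in> D \<Longrightarrow> gradient_within D u x = g x" .
  have dgrad: "(gradient_within D u has_derivative h x) (at x within D)" if "x \<in> D" for x
    by (rule has_derivative_transform[OF that _ dg]) (simp add: grad)
  have hess: "hessian_within D u x = h x" if "x \<in> D" for x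
    unfolding hessian_within_def by (rule frechet[OF that dgrad[OF that]])
  then show "x \<in> D \<Longrightarrow> hessian_within D u x = h x" .
  show "x \<in> D \<Longrightarrow> laplacian_within D u x = (\<Sum>b\<in>Basis. h x b \<bullet> b)"
    by (simp add: laplacian_within_def hess)
  have "continuous_on D (\<lambda>x. hessian_within D u x v)" for v
    using continuous_on_subset[OF C2_withD(3)[OF u, of v], of D] by (simp add: hess cong: continuous_on_cong)
  then show "C2_on D u"
    using du dgrad by (auto simp: C2_on_def differentiable_on_def differentiable_def)
qed

text \<open>How the Neumann condition is verified: a function symmetric about \<open>z\<close> in direction \<open>\<alpha>\<close> has zero
  derivative in that direction.\<close>

lemma C2_with_even_gradient:
  assumes u: "C2_with u g h" and ev: "\<forall>\<^sub>F t in nhds 0. u (z + t *\<^sub>R \<alpha>) = u (z - t *\<^sub>R \<alpha>)"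
  shows "g z \<bullet> \<alpha> = 0"
proof -
  have p: "((\<lambda>t. z + t *\<^sub>R (s *\<^sub>R \<alpha>)) has_derivative (\<lambda>t. t *\<^sub>R (s *\<^sub>R \<alpha>))) (at 0)" for s
    by (auto intro!: derivative_eq_intros)
  have "((\<lambda>t. u (z + t *\<^sub>R (s *\<^sub>R \<alpha>))) has_real_derivative g z \<bullet> (s *\<^sub>R \<alpha>)) (at 0)" for s
  proof -
    have "((\<lambda>t. u (z + t *\<^sub>R (s *\<^sub>R \<alpha>))) has_derivative (\<lambda>t. g z \<bullet> (t *\<^sub>R (s *\<^sub>R \<alpha>)))) (at 0)"
      using has_derivative_compose[OF p[of s], of u "\<lambda>v. g z \<bullet> v"] C2_withD(1)[OF u, of z] by simp
    then show ?thesis unfolding has_field_derivative_def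
      by (rule has_derivative_eq_rhs) (simp add: fun_eq_iff)
  qed
  from this[of 1] this[of "-1"]
  have 1: "((\<lambda>t. u (z + t *\<^sub>R \<alpha>)) has_real_derivative g z \<bullet> \<alpha>) (at 0)"
    and 2: "((\<lambda>t. u (z - t *\<^sub>R \<alpha>)) has_real_derivative - (g z \<bullet> \<alpha>)) (at 0)" by simp_all
  have "((\<lambda>t. u (z + t *\<^sub>R \<alpha>)) has_real_derivative - (g z \<bullet> \<alpha>)) (at 0)"
    using DERIV_cong_ev[OF refl ev refl] 2 by blast
  from DERIV_unique[OF 1 this] show ?thesis by simp
qed

text \<open>The singular quotients of the generator extend continuously to the wall of \<open>\<alpha>\<close>: the numerator vanishes
  on the whole hyperplane, so by the mean value theorem, applied along the normal through \<open>y\<close>, the quotient is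
  a second derivative at a point between \<open>y\<close> and its projection.\<close>

lemma wall_quotient_tendsto:
  assumes u: "C2_with u g h" and a: "\<alpha> \<noteq> 0" "\<alpha> \<bullet> x = 0"
    and wall: "\<And>z. \<alpha> \<bullet> z = 0 \<Longrightarrow> \<alpha> \<bullet> g z = 0"
    and C: "\<And>y. y \<in> C \<Longrightarrow> 0 < \<alpha> \<bullet> y"
  shows "((\<lambda>y. (\<alpha> \<bullet> g y) / (\<alpha> \<bullet> y)) \<longlongrightarrow> (\<alpha> \<bullet> h x \<alpha>) / (norm \<alpha>)\<^sup>2) (at x within C)"
proof (rule Lim_withinI)
  fix e :: real assume "0 < e"
  let ?q = "\<lambda>z. (\<alpha> \<bullet> h z \<alpha>) / (norm \<alpha>)\<^sup>2"
  have "continuous_on UNIV ?q" using a by (intro continuous_intros C2_withD(3)[OF u]) auto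
  then have "isCont ?q x" by (simp add: continuous_on_eq_continuous_at)
  then obtain d where d: "0 < d" "\<And>z. dist z x < d \<Longrightarrow> dist (?q z) (?q x) < e"
    using \<open>0 < e\<close> unfolding continuous_at_eps_delta by blast
  \<comment> \<open>The intermediate point is at distance at most twice that of y from x, so d / 3 is small enough.\<close>
  show "\<exists>d>0. \<forall>y\<in>C. 0 < dist y x \<and> dist y x < d \<longrightarrow> dist ((\<alpha> \<bullet> g y) / (\<alpha> \<bullet> y)) (?q x) \<le> e"
  proof (intro exI[of _ "d / 3"] conjI ballI impI)
    show "0 < d / 3" using d by simp
    fix y assume y: "y \<in> C" "0 < dist y x \<and> dist y x < d / 3"
    define \<tau> where "\<tau> = (\<alpha> \<bullet> y) / (norm \<alpha>)\<^sup>2"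
    define z where "z = y - \<tau> *\<^sub>R \<alpha>"
    have \<tau>: "0 < \<tau>" using C[OF y(1)] a by (simp add: \<tau>_def)
    have ay: "\<alpha> \<bullet> y = \<tau> * (norm \<alpha>)\<^sup>2" using a by (simp add: \<tau>_def)
    have az: "\<alpha> \<bullet> z = 0" by (simp add: z_def inner_diff_right ay power2_norm_eq_inner)
    have "\<tau> * (norm \<alpha>)\<^sup>2 = \<alpha> \<bullet> (y - x)" using a(2) ay by (simp add: inner_diff_right)
    also have "\<dots> \<le> norm \<alpha> * norm (y - x)" by (rule norm_cauchy_schwarz)
    finally have "\<tau> * norm \<alpha> \<le> norm (y - x)" using a by (simp add: power2_eq_square)
    then have small: "\<tau> * norm \<alpha> < d / 3" using y by (simp add: dist_norm)
    have der: "((\<lambda>t. \<alpha> \<bullet> g (z + t *\<^sub>R \<alpha>)) has_real_derivative \<alpha> \<bullet> h (z + t *\<^sub>R \<alpha>) \<alpha>) (at t)" for t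
    proof -
      have "((\<lambda>t. z + t *\<^sub>R \<alpha>) has_derivative (\<lambda>s. s *\<^sub>R \<alpha>)) (at t)"
        by (auto intro!: derivative_eq_intros)
      from has_derivative_compose[OF this C2_withD(2)[OF u]]
      have "((\<lambda>t. g (z + t *\<^sub>R \<alpha>)) has_derivative (\<lambda>s. h (z + t *\<^sub>R \<alpha>) (s *\<^sub>R \<alpha>))) (at t)" .
      then have "((\<lambda>t. \<alpha> \<bullet> g (z + t *\<^sub>R \<alpha>)) has_derivative (\<lambda>s. \<alpha> \<bullet> h (z + t *\<^sub>R \<alpha>) (s *\<^sub>R \<alpha>))) (at t)"
        by (rule has_derivative_inner_right)
      moreover have "linear (h (z + t *\<^sub>R \<alpha>))" using C2_withD(2)[OF u] by (rule has_derivative_linear)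
      ultimately show ?thesis
        by (simp add: has_field_derivative_def linear_scale mult_commute_abs)
    qed
    obtain \<xi> where \<xi>: "0 < \<xi>" "\<xi> < \<tau>"
      "\<alpha> \<bullet> g (z + \<tau> *\<^sub>R \<alpha>) - \<alpha> \<bullet> g (z + 0 *\<^sub>R \<alpha>) = (\<tau> - 0) * (\<alpha> \<bullet> h (z + \<xi> *\<^sub>R \<alpha>) \<alpha>)"
      using MVT2[OF \<tau> der] by auto
    then have "\<alpha> \<bullet> g y = \<tau> * (\<alpha> \<bullet> h (z + \<xi> *\<^sub>R \<alpha>) \<alpha>)" using wall[OF az] by (simp add: z_def)
    then have q: "(\<alpha> \<bullet> g y) / (\<alpha> \<bullet> y) = ?q (z + \<xi> *\<^sub>R \<alpha>)" using \<tau> by (simp add: ay)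
    have "dist (z + \<xi> *\<^sub>R \<alpha>) x = norm ((y - x) + (\<xi> - \<tau>) *\<^sub>R \<alpha>)"
      by (simp add: dist_norm z_def algebra_simps)
    also have "\<dots> \<le> norm (y - x) + (\<tau> - \<xi>) * norm \<alpha>"
      using norm_triangle_ineq[of "y - x" "(\<xi> - \<tau>) *\<^sub>R \<alpha>"] \<xi> by simp
    also have "\<dots> \<le> norm (y - x) + \<tau> * norm \<alpha>" using \<xi> by (intro add_mono mult_right_mono) auto
    also have "\<dots> < d" using small y d by (simp add: dist_norm)
    finally show "dist ((\<alpha> \<bullet> g y) / (\<alpha> \<bullet> y)) (?q x) \<le> e" unfolding q using d(2) by (simp add: less_imp_le)
  qed
qed

text \<open>At boundary points the generator is a \<open>Lim\<close>, which is meaningful only if the limit exists. Existence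
  follows from the behaviour of the quotients at the walls through \<open>x\<close>, and then an upper bound for the
  expression inside the chamber passes to the limit.\<close>

lemma generator_le:
  fixes R S :: "'a::euclidean_space set"
  defines "C \<equiv> weyl_chamber R S"
  assumes C: "open C" "convex C" "C \<noteq> {}" "finite (positive_roots R S)" "0 \<notin> positive_roots R S"
    and u: "C2_with u g h" and x: "x \<in> closure C"
    and wall: "\<And>\<alpha> z. \<alpha> \<in> positive_roots R S \<Longrightarrow> \<alpha> \<bullet> x = 0 \<Longrightarrow> \<alpha> \<bullet> z = 0 \<Longrightarrow> \<alpha> \<bullet> g z = 0"
    and bound: "\<forall>\<^sub>F y in at x within C. (\<Sum>b\<in>Basis. h y b \<bullet> b) / 2 +
        (\<Sum>\<alpha>\<in>positive_roots R S. k \<alpha> * ((\<alpha> \<bullet> g y) / (\<alpha> \<bullet> y))) \<le> B"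
  shows "radial_dunkl_generator R S k u x \<le> B"
proof -
  let ?D = "closure C"
  let ?f = "\<lambda>y. (\<Sum>b\<in>Basis. h y b \<bullet> b) / 2 +
        (\<Sum>\<alpha>\<in>positive_roots R S. k \<alpha> * ((\<alpha> \<bullet> g y) / (\<alpha> \<bullet> y)))"
  let ?G = "\<lambda>y. laplacian_within ?D u y / 2 +
        (\<Sum>\<alpha>\<in>positive_roots R S. k \<alpha> * ((\<alpha> \<bullet> gradient_within ?D u y) / (\<alpha> \<bullet> y)))"
  have pos: "\<And>y \<alpha>. y \<in> C \<Longrightarrow> \<alpha> \<in> positive_roots R S \<Longrightarrow> 0 < \<alpha> \<bullet> y" by (simp add: C_def weyl_chamber_def)
  have "C \<subseteq> interior ?D" using C(1) by (simp add: closure_subset interior_maximal)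
  then have D: "convex ?D" "interior ?D \<noteq> {}" using C(2,3) convex_closure by auto
  have eq: "?G y = ?f y" if "y \<in> C" for y
    using that closure_subset[of C] C2_with_within[OF D u] by auto
  have lim: "\<exists>l. ((\<lambda>y. k \<alpha> * ((\<alpha> \<bullet> g y) / (\<alpha> \<bullet> y))) \<longlongrightarrow> l) (at x within C)" if a: "\<alpha> \<in> positive_roots R S" for \<alpha>
  proof (cases "\<alpha> \<bullet> x = 0")
    case True
    have "((\<lambda>y. (\<alpha> \<bullet> g y) / (\<alpha> \<bullet> y)) \<longlongrightarrow> (\<alpha> \<bullet> h x \<alpha>) / (norm \<alpha>)\<^sup>2) (at x within C)"
      by (rule wall_quotient_tendsto[OF u]) (use True a C wall pos in auto)
    then show ?thesis by (intro exI) (rule tendsto_mult_left)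
  next
    case False
    have "(g \<longlongrightarrow> g x) (at x within C)"
      using C2_withD(5)[OF u] by (auto simp: continuous_on_def intro: tendsto_within_subset)
    then have "((\<lambda>y. k \<alpha> * ((\<alpha> \<bullet> g y) / (\<alpha> \<bullet> y))) \<longlongrightarrow> k \<alpha> * ((\<alpha> \<bullet> g x) / (\<alpha> \<bullet> x))) (at x within C)"
      using False by (intro tendsto_intros) auto
    then show ?thesis by blast
  qed
  then obtain l where l: "\<And>\<alpha>. \<alpha> \<in> positive_roots R S \<Longrightarrow>
      ((\<lambda>y. k \<alpha> * ((\<alpha> \<bullet> g y) / (\<alpha> \<bullet> y))) \<longlongrightarrow> l \<alpha>) (at x within C)" by metis
  have hc: "((\<lambda>y. h y b) \<longlongrightarrow> h x b) (at x within C)" for b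
    using C2_withD(3)[OF u, of b] by (auto simp: continuous_on_def intro: tendsto_within_subset)
  have f: "(?f \<longlongrightarrow> (\<Sum>b\<in>Basis. h x b \<bullet> b) / 2 + (\<Sum>\<alpha>\<in>positive_roots R S. l \<alpha>)) (at x within C)"
    by (intro tendsto_intros hc l) auto
  then have G: "(?G \<longlongrightarrow> (\<Sum>b\<in>Basis. h x b \<bullet> b) / 2 + (\<Sum>\<alpha>\<in>positive_roots R S. l \<alpha>)) (at x within C)"
  proof (rule Lim_transform_within[OF _ zero_less_one])
    show "?f y = ?G y" if "y \<in> C" for y using eq[OF that] by simp
  qed
  have nt: "\<not> trivial_limit (at x within C)"
  proof -
    have "x islimpt C"
    proof (cases "x \<in> C")
      case True
      then show ?thesis using C(1) by (simp add: interior_limit_point interior_open)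
    next
      case False
      then show ?thesis using x by (simp add: closure_def)
    qed
    then show ?thesis by (simp add: trivial_limit_within)
  qed
  have "radial_dunkl_generator R S k u x = (\<Sum>b\<in>Basis. h x b \<bullet> b) / 2 + (\<Sum>\<alpha>\<in>positive_roots R S. l \<alpha>)"
    unfolding radial_dunkl_generator_def Let_def C_def[symmetric]
    by (rule tendsto_Lim[OF nt G])
  also have "\<dots> \<le> B" by (rule tendsto_upperbound[OF f bound nt])
  finally show ?thesis .
qed

text \<open>With \<open>c t = (max 0 t)\<^sup>3\<close>, which is twice continuously differentiable, the function \<open>c (1 - c s)\<close> falls
  from one to zero between 0 and 1.\<close>

lemma cubic_cutoff:
  "\<exists>\<rho> \<rho>' \<rho>''. (\<forall>s. (\<rho> has_real_derivative \<rho>' s) (at s)) \<and> (\<forall>s. (\<rho>' has_real_derivative \<rho>'' s) (at s)) \<and>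
     continuous_on UNIV \<rho>'' \<and> (\<forall>s. 0 \<le> \<rho> s \<and> \<rho> s \<le> 1) \<and>
     (\<forall>s\<le>0. \<rho> s = 1 \<and> \<rho>' s = 0 \<and> \<rho>'' s = 0) \<and> (\<forall>s\<ge>1. \<rho> s = 0 \<and> \<rho>' s = 0 \<and> \<rho>'' s = (0::real))"
proof -
  define c where "c = (\<lambda>t::real. (max 0 t)^3)"
  define c' where "c' = (\<lambda>t::real. 3 * (max 0 t)\<^sup>2)"
  define c'' where "c'' = (\<lambda>t::real. 6 * max 0 t)"
  have plus: "((\<lambda>t. (max 0 t)^(Suc (Suc n))) has_real_derivative real (Suc (Suc n)) * (max 0 t)^(Suc n)) (at t)"
    for n and t :: real
  proof -
    consider "t < 0" | "0 < t" | "t = 0" by linarith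
    then show ?thesis
    proof cases
      case 1
      have ev: "\<forall>\<^sub>F s in nhds t. (max 0 s)^(Suc (Suc n)) = 0"
        using eventually_nhds_in_open[of "{..<0}" t] 1 by (auto elim!: eventually_mono)
      then show ?thesis using 1 by (subst DERIV_cong_ev[OF refl ev refl]) simp
    next
      case 2
      have ev: "\<forall>\<^sub>F s in nhds t. (max 0 s)^(Suc (Suc n)) = s^(Suc (Suc n))"
        using eventually_nhds_in_open[of "{0<..}" t] 2 by (auto elim!: eventually_mono)
      show ?thesis
        by (subst DERIV_cong_ev[OF refl ev refl])
          (use DERIV_pow[of "Suc (Suc n)" t] 2 in \<open>simp add: max_def\<close>)
    next
      case 3
      have "((\<lambda>h. ((max 0 (0 + h))^(Suc (Suc n)) - (max 0 0)^(Suc (Suc n))) / h) \<longlongrightarrow> (0::real)) (at 0)"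
      proof (rule tendsto_0_le[where K = 1])
        show "((\<lambda>h::real. \<bar>h\<bar>^(Suc n)) \<longlongrightarrow> 0) (at 0)" by (auto intro!: tendsto_eq_intros)
        show "\<forall>\<^sub>F h in at (0::real). norm (((max 0 (0 + h))^(Suc (Suc n)) - (max 0 0)^(Suc (Suc n))) / h)
            \<le> norm (\<bar>h\<bar>^(Suc n)) * 1"
        proof (intro always_eventually allI)
          fix h :: real
          show "norm (((max 0 (0 + h))^(Suc (Suc n)) - (max 0 0)^(Suc (Suc n))) / h) \<le> norm (\<bar>h\<bar>^(Suc n)) * 1"
            by (cases "h \<le> 0") (simp_all add: abs_mult mult_nonpos_nonneg)
        qed
      qed
      then show ?thesis using 3 by (simp add: DERIV_def)
    qed
  qed
  have c: "(c has_real_derivative c' t) (at t)" "(c' has_real_derivative c'' t) (at t)" for t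
    using plus[of 1 t] DERIV_cmult[OF plus[of 0 t], of 3]
    by (simp_all add: c_def c'_def c''_def numeral_eq_Suc)
  have cont: "continuous_on UNIV c" "continuous_on UNIV c'" "continuous_on UNIV c''"
    unfolding c_def c'_def c''_def by (auto intro!: continuous_intros)
  have cle: "c t \<le> 1" if "t \<le> 1" for t using that by (auto simp: c_def power_le_one)
  have c0: "0 \<le> c t" for t by (simp add: c_def)
  have cz: "c t = 0" "c' t = 0" "c'' t = 0" if "t \<le> 0" for t using that by (simp_all add: c_def c'_def c''_def)
  have cg: "1 \<le> c t" if "1 \<le> t" for t using that by (simp add: c_def)
  define \<rho> where "\<rho> s = c (1 - c s)" for s
  define \<rho>' where "\<rho>' s = c' (1 - c s) * - c' s" for s
  define \<rho>'' where "\<rho>'' s = (c'' (1 - c s) * - c' s) * - c' s + - c'' s * c' (1 - c s)" for s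
  have in1: "((\<lambda>s. 1 - c s) has_real_derivative - c' s) (at s)" for s
    using DERIV_diff[OF DERIV_const c(1)[of s], of 1] by simp
  have "(\<rho> has_real_derivative \<rho>' s) (at s)" for s
    unfolding \<rho>_def \<rho>'_def by (rule DERIV_chain2[OF c(1) in1])
  moreover have "(\<rho>' has_real_derivative \<rho>'' s) (at s)" for s
    unfolding \<rho>'_def \<rho>''_def by (rule DERIV_mult'[THEN DERIV_cong])
      (rule DERIV_chain2[OF c(2) in1] DERIV_minus[OF c(2)] | simp)+
  moreover have "continuous_on UNIV \<rho>''"
    unfolding \<rho>''_def
    by (intro continuous_intros cont continuous_on_compose2[OF cont(2), of UNIV]
        continuous_on_compose2[OF cont(3), of UNIV]) auto
  moreover have "0 \<le> \<rho> s \<and> \<rho> s \<le> 1" for s unfolding \<rho>_def using c0 cle[of "1 - c s"] by simp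
  moreover have "\<rho> s = 1 \<and> \<rho>' s = 0 \<and> \<rho>'' s = 0" if "s \<le> 0" for s
    using cz[OF that] by (simp add: \<rho>_def \<rho>'_def \<rho>''_def) (simp add: c_def)
  moreover have "\<rho> s = 0 \<and> \<rho>' s = 0 \<and> \<rho>'' s = 0" if "1 \<le> s" for s
    using cg[OF that] cz[of "1 - c s"] by (simp add: \<rho>_def \<rho>'_def \<rho>''_def)
  ultimately show ?thesis by (intro exI[of _ \<rho>] exI[of _ \<rho>'] exI[of _ \<rho>'']) blast
qed

text \<open>A function equal to the power \<open>s powr a\<close> from \<open>2 \<eta>\<close> on and constant up to \<open>\<eta>\<close>. It is the power of a
  positive function \<open>m\<close> that interpolates between the constant \<open>2 \<eta>\<close> and the identity, so the singularity of the
  power at zero is never met.\<close>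

lemma flattened_power:
  fixes a \<eta> :: real
  assumes "0 < \<eta>"
  shows "\<exists>F F' F''. (\<forall>s. (F has_real_derivative F' s) (at s)) \<and> (\<forall>s. (F' has_real_derivative F'' s) (at s)) \<and>
     continuous_on UNIV F'' \<and> (\<forall>s. 0 \<le> F s) \<and> (\<forall>s\<le>\<eta>. F s = F \<eta>) \<and>
     (\<forall>s\<ge>2 * \<eta>. F s = s powr a \<and> F' s = a * s powr (a - 1) \<and> F'' s = a * (a - 1) * s powr (a - 2))"
proof -
  obtain \<rho> \<rho>' \<rho>'' :: "real \<Rightarrow> real" where \<rho>: "\<And>s. (\<rho> has_real_derivative \<rho>' s) (at s)"
    "\<And>s. (\<rho>' has_real_derivative \<rho>'' s) (at s)" "continuous_on UNIV \<rho>''" "\<And>s. 0 \<le> \<rho> s \<and> \<rho> s \<le> 1"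
    "\<And>s. s \<le> 0 \<Longrightarrow> \<rho> s = 1 \<and> \<rho>' s = 0 \<and> \<rho>'' s = 0" "\<And>s. 1 \<le> s \<Longrightarrow> \<rho> s = 0 \<and> \<rho>' s = 0 \<and> \<rho>'' s = 0"
    using cubic_cutoff by blast
  define l where "l s = (s - \<eta>) / \<eta>" for s
  define m where "m s = 2 * \<eta> + (s - 2 * \<eta>) * (1 - \<rho> (l s))" for s
  define m' where "m' s = (1 - \<rho> (l s)) - (s - 2 * \<eta>) * (\<rho>' (l s) / \<eta>)" for s
  define m'' where "m'' s = - 2 * \<rho>' (l s) / \<eta> - (s - 2 * \<eta>) * (\<rho>'' (l s) / \<eta>\<^sup>2)" for s
  have l: "(l has_real_derivative 1 / \<eta>) (at s)" for s
    unfolding l_def using assms by (auto intro!: derivative_eq_intros)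
  have l': "l s = s / \<eta> - 1" for s using assms by (simp add: l_def diff_divide_distrib)
  have \<rho>l: "((\<lambda>s. \<rho> (l s)) has_real_derivative \<rho>' (l s) * (1 / \<eta>)) (at s)"
    "((\<lambda>s. \<rho>' (l s)) has_real_derivative \<rho>'' (l s) * (1 / \<eta>)) (at s)" for s
    by (rule DERIV_chain2[OF \<rho>(1) l] DERIV_chain2[OF \<rho>(2) l])+
  have dm: "(m has_real_derivative m' s) (at s)" for s
    unfolding m_def m'_def by (auto intro!: derivative_eq_intros \<rho>l)
  have dm': "(m' has_real_derivative m'' s) (at s)" for s
    unfolding m'_def m''_def
    by (rule derivative_eq_intros \<rho>l refl | use assms in \<open>simp add: field_simps power2_eq_square\<close>)+
  have cl: "continuous_on UNIV l" unfolding l' by (intro continuous_intros) (use assms in auto)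
  have cm: "continuous_on UNIV m" "continuous_on UNIV m'"
    using dm dm' by (auto intro!: DERIV_continuous_on)
  have c\<rho>: "continuous_on UNIV (\<lambda>s. \<rho>' (l s))" "continuous_on UNIV (\<lambda>s. \<rho>'' (l s))"
    using \<rho>l by (auto intro!: DERIV_continuous_on continuous_on_compose2[OF \<rho>(3) cl])
  have cm'': "continuous_on UNIV m''"
    unfolding m''_def by (intro continuous_intros c\<rho>) (use assms in auto)
  have low: "m s = 2 * \<eta>" if "s \<le> \<eta>" for s
    using \<rho>(5)[of "l s"] that assms by (simp add: m_def l_def divide_nonpos_pos)
  have high: "m s = s" "m' s = 1" "m'' s = 0" if "2 * \<eta> \<le> s" for s
  proof -
    have "1 \<le> l s" using that assms by (simp add: l_def field_simps)
    then show "m s = s" "m' s = 1" "m'' s = 0" using \<rho>(6)[of "l s"] by (simp_all add: m_def m'_def m''_def)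
  qed
  have pos: "0 < m s" for s
  proof (cases "2 * \<eta> \<le> s \<or> s \<le> \<eta>")
    case False
    have "(2 * \<eta> - s) * (1 - \<rho> (l s)) \<le> (2 * \<eta> - s) * 1"
      using \<rho>(4)[of "l s"] False by (intro mult_left_mono) auto
    also have "\<dots> \<le> \<eta>" using False by simp
    finally show ?thesis using assms by (simp add: m_def algebra_simps)
  qed (use low high assms in force)
  define F where "F s = m s powr a" for s
  define F' where "F' s = a * m s powr (a - 1) * m' s" for s
  define F'' where "F'' s = a * ((a - 1) * m s powr (a - 2) * m' s) * m' s + a * m s powr (a - 1) * m'' s" for s
  have pw: "((\<lambda>s. m s powr b) has_real_derivative b * m s powr (b - 1) * m' s) (at s)" for b s
    using DERIV_fun_powr[OF dm pos, of b s] by simp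
  have "(F has_real_derivative F' s) (at s)" for s
    unfolding F_def F'_def by (rule pw)
  moreover have "(F' has_real_derivative F'' s) (at s)" for s
  proof -
    have "((\<lambda>s. a * m s powr (a - 1) * m' s) has_real_derivative
        (a * m s powr (a - 1)) * m'' s + (a * ((a - 1) * m s powr (a - 1 - 1) * m' s)) * m' s) (at s)"
      by (intro DERIV_mult' DERIV_cmult pw dm')
    moreover have "a - 1 - 1 = a - 2" by simp
    ultimately show ?thesis unfolding F'_def F''_def by (simp add: add.commute)
  qed
  moreover have "continuous_on UNIV F''"
  proof -
    have "m s \<noteq> 0" for s using pos[of s] by simp
    then show ?thesis unfolding F''_def by (intro continuous_intros cm cm'') auto
  qed
  moreover have "0 \<le> F s" for s by (simp add: F_def)
  moreover have "F s = F \<eta>" if "s \<le> \<eta>" for s using low[OF that] low[of \<eta>] by (simp add: F_def)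
  moreover have "F s = s powr a \<and> F' s = a * s powr (a - 1) \<and> F'' s = a * (a - 1) * s powr (a - 2)"
    if "2 * \<eta> \<le> s" for s
    using high[OF that] by (simp add: F_def F'_def F''_def)
  ultimately show ?thesis by (intro exI[of _ F] exI[of _ F'] exI[of _ F'']) blast
qed

section \<open>Test functions of Bessel type\<close>

text \<open>The generator of a Bessel process applied to \<open>\<psi> powr a\<close>, with \<open>b\<close> for the squared gradient of \<open>\<psi>\<close>, which
  need not be the full \<open>n\<close>. Since \<open>\<psi> \<ge> \<epsilon>\<close>, the term with \<open>(n - b) / \<epsilon>\<close> outweighs the missing part
  of the concave second order term, and what remains is \<open>n (k\<^sub>0 - (1 - a) / 2) = - n a / 2\<close>.\<close>

lemma bessel_generator_estimate:
  fixes a k\<^sub>0 n \<epsilon> \<psi> b d R\<^sub>1 :: real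
  assumes a: "a = (1 - 2 * k\<^sub>0) / 2" and k: "0 \<le> k\<^sub>0" "k\<^sub>0 < 1 / 2"
    and "0 < \<epsilon>" "\<epsilon> \<le> \<psi>" "\<psi> \<le> R\<^sub>1" and b: "0 \<le> b" "b \<le> n" and d: "d \<le> k\<^sub>0 * n / \<psi>"
  shows "(a * \<psi> powr (a - 1) * - ((n - b) / \<epsilon>) + a * (a - 1) * \<psi> powr (a - 2) * b) / 2 + a * \<psi> powr (a - 1) * d
    \<le> - (a\<^sup>2 / 2 * n * R\<^sub>1 powr (a - 2))"
proof -
  define p where "p = \<psi> powr (a - 2)"
  have psi: "0 < \<psi>" using assms by linarith
  have a0: "0 < a" "a \<le> 1 / 2" using a k by auto
  have "\<psi> powr (a - 1) = \<psi> powr ((a - 2) + 1)" by (simp add: algebra_simps)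
  also have "\<dots> = p * \<psi>" unfolding p_def powr_add using psi by simp
  finally have p1: "\<psi> powr (a - 1) = p * \<psi>" .
  have p0: "0 < p" using psi by (simp add: p_def)
  have "R\<^sub>1 powr (a - 2) \<le> p" unfolding p_def using assms psi a0 by (intro powr_mono2') auto
  then have pR: "a\<^sup>2 / 2 * n * R\<^sub>1 powr (a - 2) \<le> a\<^sup>2 / 2 * n * p" using b by (intro mult_left_mono) auto
  define t where "t = \<psi> / \<epsilon> * (n - b)"
  have "1 \<le> \<psi> / \<epsilon>" using assms by simp
  then have 1: "1 - a \<le> \<psi> / \<epsilon>" using a0 by linarith
  have "(1 - a) * (n - b) \<le> t" unfolding t_def using 1 b by (intro mult_right_mono) auto
  moreover have "\<psi> * d \<le> k\<^sub>0 * n" using d psi by (simp add: field_simps)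
  moreover have t_eq: "\<psi> * - ((n - b) / \<epsilon>) = - t" by (simp add: t_def)
  ultimately have "(\<psi> * - ((n - b) / \<epsilon>) + (a - 1) * b) / 2 + \<psi> * d \<le> (- ((1 - a) * (n - b)) + (a - 1) * b) / 2 + k\<^sub>0 * n"
    unfolding t_eq by (intro add_mono divide_right_mono) auto
  also have "\<dots> = - (a / 2 * n)" unfolding a by (simp add: field_simps)
  finally have "a * p * ((\<psi> * - ((n - b) / \<epsilon>) + (a - 1) * b) / 2 + \<psi> * d) \<le> a * p * - (a / 2 * n)"
    using a0 p0 by (intro mult_left_mono) auto
  also have "\<dots> = - (a\<^sup>2 / 2 * n * p)" by (simp add: power2_eq_square)
  finally show ?thesis using pR unfolding p1 p_def[symmetric] by (simp add: algebra_simps add_divide_distrib)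
qed

context simple_root_data
begin

abbreviation "chamber \<equiv> weyl_chamber R S"

lemma chamber_open: "open chamber"
proof -
  have "chamber = (\<Inter>\<alpha>\<in>pos. {x. 0 < \<alpha> \<bullet> x})" by (auto simp: weyl_chamber_def)
  then show ?thesis using finite_pos by (auto intro!: open_INT open_halfspace_gt)
qed

lemma chamber_convex: "convex chamber"
proof -
  have "chamber = (\<Inter>\<alpha>\<in>pos. {x. 0 < \<alpha> \<bullet> x})" by (auto simp: weyl_chamber_def)
  then show ?thesis by (auto intro!: convex_INT convex_halfspace_gt)
qed

lemma closed_chamber_inner_nonneg: "x \<in> closure chamber \<Longrightarrow> \<alpha> \<in> pos \<Longrightarrow> 0 \<le> \<alpha> \<bullet> x"
proof -
  assume x: "x \<in> closure chamber" and a: "\<alpha> \<in> pos"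
  have "chamber \<subseteq> {x. 0 \<le> \<alpha> \<bullet> x}" using a by (auto simp: weyl_chamber_def less_imp_le)
  then have "closure chamber \<subseteq> {x. 0 \<le> \<alpha> \<bullet> x}" by (intro closure_minimal closed_halfspace_ge)
  then show ?thesis using x by auto
qed

definition softmin_sum :: "real \<Rightarrow> 'a \<Rightarrow> real" where
  "softmin_sum \<epsilon> x = (\<Sum>\<beta>\<in>orbit. exp (- (\<beta> \<bullet> x) / \<epsilon>))"

definition softmin :: "real \<Rightarrow> 'a \<Rightarrow> real" where
  "softmin \<epsilon> x = - \<epsilon> * ln (softmin_sum \<epsilon> x)"

definition softmin_gradient :: "real \<Rightarrow> 'a \<Rightarrow> 'a" where
  "softmin_gradient \<epsilon> x = (1 / softmin_sum \<epsilon> x) *\<^sub>R (\<Sum>\<beta>\<in>orbit. exp (- (\<beta> \<bullet> x) / \<epsilon>) *\<^sub>R \<beta>)"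

lemma softmin_sum_pos: "0 < softmin_sum \<epsilon> x"
  unfolding softmin_sum_def using finite_orbit root0_orbit by (intro sum_pos) auto

lemma softmin_le: "0 < \<epsilon> \<Longrightarrow> softmin \<epsilon> x \<le> \<alpha>\<^sub>0 \<bullet> x"
proof -
  assume e: "0 < \<epsilon>"
  have "(\<Sum>\<beta>\<in>{\<alpha>\<^sub>0}. exp (- (\<beta> \<bullet> x) / \<epsilon>)) \<le> softmin_sum \<epsilon> x"
    unfolding softmin_sum_def using finite_orbit root0_orbit by (intro sum_mono2) auto
  then have "- (\<alpha>\<^sub>0 \<bullet> x) / \<epsilon> \<le> ln (softmin_sum \<epsilon> x)"
    using softmin_sum_pos by (simp add: ln_ge_iff)
  then show ?thesis using e by (simp add: softmin_def field_simps)
qed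

lemma softmin_ge:
  assumes e: "0 < \<epsilon>" and x: "x \<in> closure chamber"
  shows "\<alpha>\<^sub>0 \<bullet> x - \<epsilon> * ln (real (card orbit)) \<le> softmin \<epsilon> x"
proof -
  have card: "0 < card orbit" using finite_orbit root0_orbit by (auto simp: card_gt_0_iff)
  have "\<alpha>\<^sub>0 \<bullet> x \<le> \<beta> \<bullet> x" if "\<beta> \<in> orbit" for \<beta>
    using inner_upper_ge[OF orbit_upper[OF that], of x] closed_chamber_inner_nonneg[OF x simple_pos] that
    by (simp add: orbit_def)
  then have "softmin_sum \<epsilon> x \<le> (\<Sum>\<beta>\<in>orbit. exp (- (\<alpha>\<^sub>0 \<bullet> x) / \<epsilon>))"
    unfolding softmin_sum_def using e by (intro sum_mono) (simp add: divide_right_mono)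
  then have "softmin_sum \<epsilon> x \<le> real (card orbit) * exp (- (\<alpha>\<^sub>0 \<bullet> x) / \<epsilon>)" by simp
  then have "ln (softmin_sum \<epsilon> x) \<le> ln (real (card orbit) * exp (- (\<alpha>\<^sub>0 \<bullet> x) / \<epsilon>))"
    using softmin_sum_pos card by (subst ln_le_cancel_iff) auto
  also have "\<dots> = ln (real (card orbit)) - (\<alpha>\<^sub>0 \<bullet> x) / \<epsilon>" using card by (simp add: ln_mult)
  finally have "\<epsilon> * ln (softmin_sum \<epsilon> x) \<le> \<epsilon> * (ln (real (card orbit)) - (\<alpha>\<^sub>0 \<bullet> x) / \<epsilon>)"
    using e by (intro mult_left_mono) auto
  then show ?thesis using e by (simp add: softmin_def algebra_simps)
qed

text \<open>Levi reflections permute \<open>orbit\<close> and hence the terms of the sum.\<close>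

lemma softmin_invariant:
  assumes "\<gamma> \<in> levi"
  shows "softmin \<epsilon> (root_reflection \<gamma> x) = softmin \<epsilon> x"
proof -
  have nz: "\<gamma> \<noteq> 0" using assms levi_root roots_nonzero by auto
  have "softmin_sum \<epsilon> (root_reflection \<gamma> x) = softmin_sum \<epsilon> x"
    unfolding softmin_sum_def
    by (rule sum.reindex_bij_witness[where i = "root_reflection \<gamma>" and j = "root_reflection \<gamma>"])
      (auto simp: root_reflection_involution[OF nz] levi_reflection_orbit[OF assms] root_reflection_swap[OF nz])
  then show ?thesis by (simp add: softmin_def)
qed

lemma norm_softmin_gradient: "norm (softmin_gradient \<epsilon> x) \<le> norm \<alpha>\<^sub>0"
proof -
  have "norm (\<Sum>\<beta>\<in>orbit. exp (- (\<beta> \<bullet> x) / \<epsilon>) *\<^sub>R \<beta>) \<le> (\<Sum>\<beta>\<in>orbit. exp (- (\<beta> \<bullet> x) / \<epsilon>) * norm \<alpha>\<^sub>0)"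
    by (rule sum_norm_le) (simp add: orbit_def)
  also have "\<dots> = softmin_sum \<epsilon> x * norm \<alpha>\<^sub>0" by (simp add: softmin_sum_def sum_distrib_right)
  finally show ?thesis using softmin_sum_pos[of \<epsilon> x] by (simp add: softmin_gradient_def field_simps)
qed

text \<open>Under the probability weights proportional to \<open>exp (- \<beta> \<bullet> x / \<epsilon>)\<close> the gradient is the mean of the \<open>\<beta>\<close>,
  and the Hessian is \<open>- 1 / \<epsilon>\<close> times their covariance. As all \<open>\<beta>\<close> have the norm of \<open>\<alpha>\<^sub>0\<close>, the
  Laplacian depends only on the norm of the gradient.\<close>

lemma softmin_C2:
  assumes e: "0 < \<epsilon>"
  shows "\<exists>h. C2_with (softmin \<epsilon>) (softmin_gradient \<epsilon>) h \<and>
    (\<forall>x. (\<Sum>b\<in>Basis. h x b \<bullet> b) = - (((norm \<alpha>\<^sub>0)\<^sup>2 - (norm (softmin_gradient \<epsilon> x))\<^sup>2) / \<epsilon>))"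
proof -
  let ?p = "\<lambda>\<beta> x. exp (- (\<beta> \<bullet> x) / \<epsilon>)"
  let ?g = "\<lambda>x. \<Sum>\<beta>\<in>orbit. (- (1 / \<epsilon>) * ?p \<beta> x) *\<^sub>R \<beta>"
  let ?h = "\<lambda>x v. \<Sum>\<beta>\<in>orbit. (- (1 / \<epsilon>) * ?p \<beta> x) *\<^sub>R 0 + ((1 / \<epsilon>\<^sup>2) * ?p \<beta> x * (\<beta> \<bullet> v)) *\<^sub>R \<beta>"
  have "C2_with (\<lambda>x. ?p \<beta> x) (\<lambda>x. (- (1 / \<epsilon>) * ?p \<beta> x) *\<^sub>R \<beta>)
      (\<lambda>x v. (- (1 / \<epsilon>) * ?p \<beta> x) *\<^sub>R 0 + ((1 / \<epsilon>\<^sup>2) * ?p \<beta> x * (\<beta> \<bullet> v)) *\<^sub>R \<beta>)" for \<beta>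
    by (rule C2_with_compose[OF C2_with_inner, where A = UNIV])
      (use e in \<open>auto intro!: derivative_eq_intros continuous_intros simp: power2_eq_square\<close>)
  then have sum: "C2_with (softmin_sum \<epsilon>) ?g ?h"
    unfolding softmin_sum_def[abs_def] using finite_orbit by (intro C2_with_sum)
  let ?H = "\<lambda>x v. (- \<epsilon> / softmin_sum \<epsilon> x) *\<^sub>R ?h x v +
      ((\<epsilon> / (softmin_sum \<epsilon> x)\<^sup>2) * (?g x \<bullet> v)) *\<^sub>R ?g x"
  have C2: "C2_with (softmin \<epsilon>) (\<lambda>x. (- \<epsilon> / softmin_sum \<epsilon> x) *\<^sub>R ?g x) ?H"
    unfolding softmin_def[abs_def]
    by (rule C2_with_compose[OF sum, where A = "{0<..}"])
      (use softmin_sum_pos in \<open>auto intro!: derivative_eq_intros continuous_intros simp: power2_eq_square\<close>)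
  have g: "?g x = - (1 / \<epsilon>) *\<^sub>R (\<Sum>\<beta>\<in>orbit. ?p \<beta> x *\<^sub>R \<beta>)" for x
    by (simp add: scaleR_sum_right sum_negf)
  have grad: "(- \<epsilon> / softmin_sum \<epsilon> x) *\<^sub>R ?g x = softmin_gradient \<epsilon> x" for x
    unfolding g softmin_gradient_def using e by simp
  have g': "?g x = - (softmin_sum \<epsilon> x / \<epsilon>) *\<^sub>R softmin_gradient \<epsilon> x" for x
    unfolding grad[symmetric] using e softmin_sum_pos[of \<epsilon> x] by simp
  have "(\<Sum>b\<in>Basis. ?H x b \<bullet> b) = - (((norm \<alpha>\<^sub>0)\<^sup>2 - (norm (softmin_gradient \<epsilon> x))\<^sup>2) / \<epsilon>)" for x
  proof -
    have tr: "(\<Sum>b\<in>Basis. (v \<bullet> b) * (v \<bullet> b)) = (norm v)\<^sup>2" for v :: 'a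
      by (metis euclidean_inner power2_norm_eq_inner)
    have "(\<Sum>b\<in>Basis. ?h x b \<bullet> b) = (\<Sum>b\<in>Basis. \<Sum>\<beta>\<in>orbit. (1 / \<epsilon>\<^sup>2) * ?p \<beta> x * ((\<beta> \<bullet> b) * (\<beta> \<bullet> b)))"
      by (simp add: inner_sum_left mult.assoc)
    also have "\<dots> = (\<Sum>\<beta>\<in>orbit. (1 / \<epsilon>\<^sup>2) * ?p \<beta> x * (norm \<beta>)\<^sup>2)"
      by (subst sum.swap) (simp only: sum_distrib_left[symmetric] tr)
    also have "\<dots> = (\<Sum>\<beta>\<in>orbit. (1 / \<epsilon>\<^sup>2) * (norm \<alpha>\<^sub>0)\<^sup>2 * ?p \<beta> x)"
      by (intro sum.cong) (auto simp: orbit_def)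
    also have "\<dots> = (1 / \<epsilon>\<^sup>2) * (norm \<alpha>\<^sub>0)\<^sup>2 * softmin_sum \<epsilon> x"
      by (simp only: sum_distrib_left[symmetric] softmin_sum_def)
    finally have h: "(\<Sum>b\<in>Basis. ?h x b \<bullet> b) = (1 / \<epsilon>\<^sup>2) * (norm \<alpha>\<^sub>0)\<^sup>2 * softmin_sum \<epsilon> x" .
    have split: "(\<Sum>b\<in>Basis. (r *\<^sub>R f b + (s * (v \<bullet> b)) *\<^sub>R v) \<bullet> b) =
        r * (\<Sum>b\<in>Basis. f b \<bullet> b) + s * (\<Sum>b\<in>Basis. (v \<bullet> b) * (v \<bullet> b))" for r s f and v :: 'a
      by (simp add: inner_add_left sum.distrib sum_distrib_left mult.assoc)
    have "(\<Sum>b\<in>Basis. ?H x b \<bullet> b) = (- \<epsilon> / softmin_sum \<epsilon> x) * (\<Sum>b\<in>Basis. ?h x b \<bullet> b) +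
        (\<epsilon> / (softmin_sum \<epsilon> x)\<^sup>2) * (\<Sum>b\<in>Basis. (?g x \<bullet> b) * (?g x \<bullet> b))"
      by (rule split)
    also have "(\<Sum>b\<in>Basis. (?g x \<bullet> b) * (?g x \<bullet> b)) = (softmin_sum \<epsilon> x / \<epsilon>)\<^sup>2 * (norm (softmin_gradient \<epsilon> x))\<^sup>2"
      unfolding tr unfolding g' by (simp add: power_mult_distrib power_divide)
    finally show ?thesis unfolding h
      using e softmin_sum_pos[of \<epsilon> x] by (simp add: power2_eq_square field_simps)
  qed
  then show ?thesis using C2 unfolding grad by blast
qed

lemma softmin_gradient_drift:
  assumes x: "x \<in> chamber" and d: "0 < \<delta>" "\<delta> \<le> \<alpha>\<^sub>0 \<bullet> x" and e: "0 < \<epsilon>"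
    and sep: "\<And>\<gamma> \<beta>. \<gamma> \<in> levi \<Longrightarrow> \<beta> \<in> orbit \<Longrightarrow> \<gamma> \<bullet> \<beta> \<noteq> 0 \<Longrightarrow>
          \<epsilon> \<le> 2 * (\<gamma> \<bullet> \<beta>)\<^sup>2 / ((norm \<alpha>\<^sub>0)\<^sup>2 * (norm \<gamma>)\<^sup>2) * \<delta>"
  shows "(\<Sum>\<alpha>\<in>pos. k \<alpha> * ((\<alpha> \<bullet> softmin_gradient \<epsilon> x) / (\<alpha> \<bullet> x))) \<le> k \<alpha>\<^sub>0 * (norm \<alpha>\<^sub>0)\<^sup>2 / (\<alpha>\<^sub>0 \<bullet> x)"
proof -
  have pos: "\<And>\<alpha>. \<alpha> \<in> pos \<Longrightarrow> 0 < \<alpha> \<bullet> x" using x by (simp add: weyl_chamber_def)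
  have "(\<Sum>\<alpha>\<in>pos. k \<alpha> * ((\<alpha> \<bullet> softmin_gradient \<epsilon> x) / (\<alpha> \<bullet> x))) =
    1 / softmin_sum \<epsilon> x * (\<Sum>\<alpha>\<in>pos. k \<alpha> * ((\<Sum>\<beta>\<in>orbit. exp (- (\<beta> \<bullet> x) / \<epsilon>) * (\<alpha> \<bullet> \<beta>)) / (\<alpha> \<bullet> x)))"
    unfolding sum_distrib_left
    by (intro sum.cong) (simp_all add: softmin_gradient_def inner_sum_right mult_ac)
  also have "\<dots> \<le> 1 / softmin_sum \<epsilon> x * (k \<alpha>\<^sub>0 * (norm \<alpha>\<^sub>0)\<^sup>2 / (\<alpha>\<^sub>0 \<bullet> x) * softmin_sum \<epsilon> x)"
    unfolding softmin_sum_def[of \<epsilon> x] using softmin_sum_pos[of \<epsilon> x]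
    by (intro mult_left_mono softmin_drift_bound[OF pos d e sep]) (auto simp: softmin_sum_def)
  also have "\<dots> = k \<alpha>\<^sub>0 * (norm \<alpha>\<^sub>0)\<^sup>2 / (\<alpha>\<^sub>0 \<bullet> x)" using softmin_sum_pos[of \<epsilon> x] by simp
  finally show ?thesis .
qed

text \<open>Finitely many smallness conditions: the first two keep the soft minimum close to \<open>\<alpha>\<^sub>0 \<bullet> x\<close> and above
  \<open>\<epsilon>\<close>, the last is the hypothesis of the drift bound.\<close>

lemma softmin_scale_exists:
  assumes "0 < \<delta>"
  shows "\<exists>\<epsilon>>0. \<epsilon> * ln (real (card orbit)) \<le> \<delta> / 2 \<and> \<epsilon> \<le> \<delta> / 2 \<and>
    (\<forall>\<gamma>\<in>levi. \<forall>\<beta>\<in>orbit. \<gamma> \<bullet> \<beta> \<noteq> 0 \<longrightarrow> \<epsilon> \<le> 2 * (\<gamma> \<bullet> \<beta>)\<^sup>2 / ((norm \<alpha>\<^sub>0)\<^sup>2 * (norm \<gamma>)\<^sup>2) * \<delta>)"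
proof -
  define f :: "'a \<times> 'a \<Rightarrow> real" where "f = (\<lambda>(\<gamma>, \<beta>). 2 * (\<gamma> \<bullet> \<beta>)\<^sup>2 / ((norm \<alpha>\<^sub>0)\<^sup>2 * (norm \<gamma>)\<^sup>2) * \<delta>)"
  define L where "L = 1 + \<bar>ln (real (card orbit))\<bar>"
  define Z where "Z = {(\<gamma>, \<beta>). \<gamma> \<in> levi \<and> \<beta> \<in> orbit \<and> \<gamma> \<bullet> \<beta> \<noteq> 0}"
  define A where "A = insert (\<delta> / 2) (insert (\<delta> / 2 / L) (f ` Z))"
  have "Z \<subseteq> levi \<times> orbit" by (auto simp: Z_def)
  then have fin: "finite A" unfolding A_def using finite_levi finite_orbit finite_subset by blast
  have nz: "\<gamma> \<noteq> 0" if "\<gamma> \<in> levi" for \<gamma> using that levi_root roots_nonzero by auto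
  have L: "0 < L" "ln (real (card orbit)) \<le> L" by (auto simp: L_def)
  have "0 < f z" if "z \<in> Z" for z
    using that assms nz roots_nonzero[OF root0_root] by (auto simp: f_def Z_def)
  then have "0 < z" if "z \<in> A" for z
    using that assms L by (auto simp: A_def)
  moreover have "Min A \<in> A" using fin by (intro Min_in) (auto simp: A_def)
  ultimately have pos: "0 < Min A" by blast
  have le: "Min A \<le> z" if "z \<in> A" for z using fin that by simp
  have "Min A * ln (real (card orbit)) \<le> Min A * L"
    using pos L by (intro mult_left_mono) auto
  also have "\<dots> \<le> \<delta> / 2"
    using le[of "\<delta> / 2 / L"] L(1) pos_le_divide_eq[of L "Min A" "\<delta> / 2"] by (simp add: A_def)
  finally have "Min A * ln (real (card orbit)) \<le> \<delta> / 2" .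
  moreover have "Min A \<le> \<delta> / 2" by (rule le) (simp add: A_def)
  moreover have "Min A \<le> f (\<gamma>, \<beta>)" if "\<gamma> \<in> levi" "\<beta> \<in> orbit" "\<gamma> \<bullet> \<beta> \<noteq> 0" for \<gamma> \<beta>
    by (rule le) (use that in \<open>auto simp: A_def Z_def\<close>)
  ultimately show ?thesis using pos by (intro exI[of _ "Min A"]) (auto simp: f_def)
qed


lemma even_at_wall:
  assumes a: "\<alpha> \<in> R" "\<alpha> \<bullet> z = 0"
  shows "root_reflection \<alpha> (z + t *\<^sub>R \<alpha>) = z - t *\<^sub>R \<alpha>"
proof -
  have "\<alpha> \<noteq> 0" using a roots_nonzero by auto
  then show ?thesis using a(2) by (simp add: root_reflection_def inner_add_right power2_norm_eq_inner scaleR_2[symmetric]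
     algebra_simps)
qed

lemma softmin_power_bound:
  assumes e: "0 < \<epsilon>" and x: "x \<in> chamber" and d: "0 < \<delta>" "\<delta> \<le> \<alpha>\<^sub>0 \<bullet> x" "\<alpha>\<^sub>0 \<bullet> x \<le> R\<^sub>1" "\<epsilon> \<le> softmin \<epsilon> x"
    and sep: "\<And>\<gamma> \<beta>. \<gamma> \<in> levi \<Longrightarrow> \<beta> \<in> orbit \<Longrightarrow> \<gamma> \<bullet> \<beta> \<noteq> 0 \<Longrightarrow>
          \<epsilon> \<le> 2 * (\<gamma> \<bullet> \<beta>)\<^sup>2 / ((norm \<alpha>\<^sub>0)\<^sup>2 * (norm \<gamma>)\<^sup>2) * \<delta>"
    and k: "k \<alpha>\<^sub>0 < 1 / 2" and a: "a = (1 - 2 * k \<alpha>\<^sub>0) / 2"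
    and F': "F' = a * softmin \<epsilon> x powr (a - 1)" and F'': "F'' = a * (a - 1) * softmin \<epsilon> x powr (a - 2)"
  shows "(F' * - (((norm \<alpha>\<^sub>0)\<^sup>2 - (norm (softmin_gradient \<epsilon> x))\<^sup>2) / \<epsilon>) + F'' * (norm (softmin_gradient \<epsilon> x))\<^sup>2) / 2 +
      (\<Sum>\<alpha>\<in>pos. k \<alpha> * ((\<alpha> \<bullet> (F' *\<^sub>R softmin_gradient \<epsilon> x)) / (\<alpha> \<bullet> x)))
    \<le> - (a\<^sup>2 / 2 * (norm \<alpha>\<^sub>0)\<^sup>2 * R\<^sub>1 powr (a - 2))"
proof -
  define d where "d = (\<Sum>\<alpha>\<in>pos. k \<alpha> * ((\<alpha> \<bullet> softmin_gradient \<epsilon> x) / (\<alpha> \<bullet> x)))"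
  have k0: "0 \<le> k \<alpha>\<^sub>0" using multiplicity_nonneg root0_root by auto
  have psi: "softmin \<epsilon> x \<le> \<alpha>\<^sub>0 \<bullet> x" "0 < softmin \<epsilon> x" using softmin_le[OF e] assms(1) assms(6) by auto
  have "d \<le> k \<alpha>\<^sub>0 * (norm \<alpha>\<^sub>0)\<^sup>2 / (\<alpha>\<^sub>0 \<bullet> x)"
    unfolding d_def by (rule softmin_gradient_drift[OF x assms(3,4) e sep])
  also have "\<dots> \<le> k \<alpha>\<^sub>0 * (norm \<alpha>\<^sub>0)\<^sup>2 / softmin \<epsilon> x"
    using psi k0 by (intro divide_left_mono) auto
  finally have d: "d \<le> k \<alpha>\<^sub>0 * (norm \<alpha>\<^sub>0)\<^sup>2 / softmin \<epsilon> x" .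
  have b: "0 \<le> (norm (softmin_gradient \<epsilon> x))\<^sup>2" "(norm (softmin_gradient \<epsilon> x))\<^sup>2 \<le> (norm \<alpha>\<^sub>0)\<^sup>2"
    using norm_softmin_gradient by (auto intro: power_mono)
  have "(\<Sum>\<alpha>\<in>pos. k \<alpha> * ((\<alpha> \<bullet> (F' *\<^sub>R softmin_gradient \<epsilon> x)) / (\<alpha> \<bullet> x))) = F' * d"
    unfolding d_def sum_distrib_left by (intro sum.cong) simp_all
  then show ?thesis
    using bessel_generator_estimate[OF a k0 k e assms(6) _ b d, of R\<^sub>1] psi assms(5) F' F'' by simp
qed

text \<open>The function is \<open>\<psi> powr a\<close>, flattened where the soft minimum \<open>\<psi>\<close> is small and multiplied by a radial cutoff. Near the
  walls of Levi roots it is invariant under their reflections; the walls of all other positive roots meet the closed chamber only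
  where \<open>\<alpha>\<^sub>0 \<bullet> x = 0\<close>, and there only the radial factor is not constant. The bound on the generator does not
  depend on \<open>\<delta>\<close> and \<open>N\<close>, which is what allows both to be removed later.\<close>

lemma test_function_exists:
  assumes k: "k \<alpha>\<^sub>0 < 1 / 2" and a: "a = (1 - 2 * k \<alpha>\<^sub>0) / 2" and ne: "chamber \<noteq> {}"
    and r: "0 < r" "r \<le> \<rho>" and d: "0 < \<delta>" and N: "0 < N"
  shows "\<exists>u\<in>radial_dunkl_domain R S. continuous_on UNIV u \<and> (\<exists>b. \<forall>x. 0 \<le> u x \<and> u x \<le> b) \<and>
    (\<forall>x\<in>closure chamber. \<delta> \<le> \<alpha>\<^sub>0 \<bullet> x \<longrightarrow> \<alpha>\<^sub>0 \<bullet> x \<le> \<rho> \<longrightarrow> norm x \<le> N \<longrightarrow>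
       radial_dunkl_generator R S k u x \<le> - (a\<^sup>2 / 2 * (norm \<alpha>\<^sub>0)\<^sup>2 * (\<rho> + 1) powr (a - 2))) \<and>
    (\<forall>x\<in>closure chamber. \<delta> \<le> \<alpha>\<^sub>0 \<bullet> x \<longrightarrow> \<alpha>\<^sub>0 \<bullet> x \<le> r \<longrightarrow> u x \<le> r powr a) \<and>
    (\<forall>x\<in>closure chamber. \<rho> < \<alpha>\<^sub>0 \<bullet> x \<longrightarrow> norm x \<le> N \<longrightarrow> (\<rho> / 2) powr a \<le> u x)"
proof -
  have a0: "0 < a" using k a by simp
  \<comment> \<open>The estimate is needed on a neighbourhood of the region, hence the smaller threshold here and the larger radius below.\<close>
  define \<delta>\<^sub>1 where "\<delta>\<^sub>1 = min \<delta> r / 2"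
  have d1: "0 < \<delta>\<^sub>1" "\<delta>\<^sub>1 < \<delta>" "\<delta>\<^sub>1 < \<rho>" using d r by (auto simp: \<delta>\<^sub>1_def min_def)
  define \<eta> where "\<eta> = \<delta>\<^sub>1 / 4"
  have eta: "0 < \<eta>" using d1 by (simp add: \<eta>_def)
  obtain \<epsilon> where e: "0 < \<epsilon>" "\<epsilon> * ln (real (card orbit)) \<le> \<delta>\<^sub>1 / 2" "\<epsilon> \<le> \<delta>\<^sub>1 / 2"
    and sep: "\<And>\<gamma> \<beta>. \<gamma> \<in> levi \<Longrightarrow> \<beta> \<in> orbit \<Longrightarrow> \<gamma> \<bullet> \<beta> \<noteq> 0 \<Longrightarrow>
        \<epsilon> \<le> 2 * (\<gamma> \<bullet> \<beta>)\<^sup>2 / ((norm \<alpha>\<^sub>0)\<^sup>2 * (norm \<gamma>)\<^sup>2) * \<delta>\<^sub>1"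
    using softmin_scale_exists[OF d1(1)] by auto
  obtain F F' F'' :: "real \<Rightarrow> real" where F: "\<And>s. (F has_real_derivative F' s) (at s)"
    "\<And>s. (F' has_real_derivative F'' s) (at s)" "continuous_on UNIV F''" "\<And>s. 0 \<le> F s"
    "\<And>s. s \<le> \<eta> \<Longrightarrow> F s = F \<eta>"
    "\<And>s. 2 * \<eta> \<le> s \<Longrightarrow> F s = s powr a \<and> F' s = a * s powr (a - 1) \<and> F'' s = a * (a - 1) * s powr (a - 2)"
    using flattened_power[OF eta, of a] by blast
  obtain \<kappa> \<kappa>' \<kappa>'' :: "real \<Rightarrow> real" where \<kappa>: "\<And>s. (\<kappa> has_real_derivative \<kappa>' s) (at s)"
    "\<And>s. (\<kappa>' has_real_derivative \<kappa>'' s) (at s)" "continuous_on UNIV \<kappa>''" "\<And>s. 0 \<le> \<kappa> s \<and> \<kappa> s \<le> 1"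
    "\<And>s. s \<le> 0 \<Longrightarrow> \<kappa> s = 1 \<and> \<kappa>' s = 0 \<and> \<kappa>'' s = 0" "\<And>s. 1 \<le> s \<Longrightarrow> \<kappa> s = 0 \<and> \<kappa>' s = 0 \<and> \<kappa>'' s = 0"
    using cubic_cutoff by blast
  obtain h where h: "C2_with (softmin \<epsilon>) (softmin_gradient \<epsilon>) h"
    "\<And>x. (\<Sum>b\<in>Basis. h x b \<bullet> b) = - (((norm \<alpha>\<^sub>0)\<^sup>2 - (norm (softmin_gradient \<epsilon> x))\<^sup>2) / \<epsilon>)"
    using softmin_C2[OF e(1)] by blast
  define N\<^sub>1 where "N\<^sub>1 = N + 1"
  define v where "v x = x \<bullet> x + - N\<^sub>1\<^sup>2" for x :: 'a
  define u where "u x = F (softmin \<epsilon> x) * \<kappa> (v x)" for x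
  let ?gF = "\<lambda>x. F' (softmin \<epsilon> x) *\<^sub>R softmin_gradient \<epsilon> x"
  let ?hF = "\<lambda>x w. F' (softmin \<epsilon> x) *\<^sub>R h x w + (F'' (softmin \<epsilon> x) * (softmin_gradient \<epsilon> x \<bullet> w)) *\<^sub>R softmin_gradient \<epsilon> x"
  let ?gK = "\<lambda>x. \<kappa>' (v x) *\<^sub>R (2 *\<^sub>R x + 0)"
  let ?hK = "\<lambda>x w. \<kappa>' (v x) *\<^sub>R (2 *\<^sub>R w + 0) + (\<kappa>'' (v x) * ((2 *\<^sub>R x + 0) \<bullet> w)) *\<^sub>R (2 *\<^sub>R x + 0)"
  define g where "g x = F (softmin \<epsilon> x) *\<^sub>R ?gK x + \<kappa> (v x) *\<^sub>R ?gF x" for x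
  define hh where "hh x w = F (softmin \<epsilon> x) *\<^sub>R ?hK x w + (?gF x \<bullet> w) *\<^sub>R ?gK x + (\<kappa> (v x) *\<^sub>R ?hF x w + (?gK x \<bullet> w) *\<^sub>R ?gF x)"
    for x w
  have CF: "C2_with (\<lambda>x. F (softmin \<epsilon> x)) ?gF ?hF"
    by (rule C2_with_compose[OF h(1), where A = UNIV]) (use F in auto)
  have Cv: "C2_with v (\<lambda>x. 2 *\<^sub>R x + 0) (\<lambda>_ w. 2 *\<^sub>R w + 0)"
    unfolding v_def[abs_def] by (rule C2_with_add[OF C2_with_inner_self C2_with_const])
  have CK: "C2_with (\<lambda>x. \<kappa> (v x)) ?gK ?hK"
    by (rule C2_with_compose[OF Cv, where A = UNIV]) (use \<kappa> in auto)
  have C2: "C2_with u g hh"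
    unfolding u_def[abs_def] g_def[abs_def] hh_def[abs_def] by (rule C2_with_mult[OF CF CK])
  have cont_u: "continuous_on UNIV u" by (rule C2_withD(4)[OF C2])
  have cont_s: "continuous_on UNIV (softmin \<epsilon>)" by (rule C2_withD(4)[OF h(1)])
  have v_small: "v x \<le> 0" if "norm x \<le> N\<^sub>1" for x
    using that N by (simp add: v_def power2_norm_eq_inner[symmetric] power_mono)
  have v_big: "1 \<le> v x" if "N\<^sub>1 + 1 \<le> norm x" for x
  proof -
    have "(N\<^sub>1 + 1)\<^sup>2 \<le> (norm x)\<^sup>2" using that N by (intro power_mono) (auto simp: N\<^sub>1_def)
    then show ?thesis using N by (simp add: v_def power2_norm_eq_inner[symmetric] N\<^sub>1_def power2_eq_square algebra_simps)
  qed
  have u0: "0 \<le> u x" for x using F(4) \<kappa>(4) by (simp add: u_def)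
  have uz: "u x = 0" if "N\<^sub>1 + 1 \<le> norm x" for x using \<kappa>(6)[OF v_big[OF that]] by (simp add: u_def)
  have "bounded (u ` cball 0 (N\<^sub>1 + 1))"
    by (intro compact_imp_bounded compact_continuous_image continuous_on_subset[OF cont_u]) auto
  then obtain b where "\<forall>x\<in>cball 0 (N\<^sub>1 + 1). \<bar>u x\<bar> \<le> b" by (auto simp: bounded_iff)
  then have b: "\<And>x. x \<in> cball 0 (N\<^sub>1 + 1) \<Longrightarrow> \<bar>u x\<bar> \<le> b" by blast
  have b0: "0 \<le> b" using b[of 0] N by (auto simp: N\<^sub>1_def)
  have ub: "0 \<le> u x \<and> u x \<le> b" for x
    using u0 b[of x] uz[of x] b0 by (cases "norm x \<le> N\<^sub>1 + 1") auto
  have psi_ge: "\<alpha>\<^sub>0 \<bullet> x - \<delta>\<^sub>1 / 2 \<le> softmin \<epsilon> x" if "x \<in> closure chamber" for x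
    using softmin_ge[OF e(1) that] e(2) by simp
  have psi_le: "softmin \<epsilon> x \<le> \<alpha>\<^sub>0 \<bullet> x" for x by (rule softmin_le[OF e(1)])
  have CD: "chamber \<subseteq> closure chamber" by (rule closure_subset)
  have levi_even: "g z \<bullet> \<alpha> = 0" if al: "\<alpha> \<in> levi" "\<alpha> \<bullet> z = 0" for \<alpha> z
  proof (rule C2_with_even_gradient[OF C2])
    have nz: "\<alpha> \<noteq> 0" "\<alpha> \<in> R" using al levi_root roots_nonzero by auto
    have "u (z + t *\<^sub>R \<alpha>) = u (z - t *\<^sub>R \<alpha>)" for t
    proof -
      have "u (root_reflection \<alpha> (z + t *\<^sub>R \<alpha>)) = u (z + t *\<^sub>R \<alpha>)"
        using nz by (simp only: u_def v_def softmin_invariant[OF al(1)] inner_root_reflection[OF nz(1)])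
      then show ?thesis unfolding even_at_wall[OF nz(2) al(2)] by simp
    qed
    then show "\<forall>\<^sub>F t in nhds 0. u (z + t *\<^sub>R \<alpha>) = u (z - t *\<^sub>R \<alpha>)" by simp
  qed
  have upper_even: "g x \<bullet> \<alpha> = 0" if x: "x \<in> closure chamber" and al: "\<alpha> \<in> upper" "\<alpha> \<bullet> x = 0" for \<alpha> x
  proof (rule C2_with_even_gradient[OF C2])
    have "coord \<alpha>\<^sub>0 \<alpha> * (\<alpha>\<^sub>0 \<bullet> x) \<le> 0"
      using inner_upper_ge[OF al(1), of x] closed_chamber_inner_nonneg[OF x simple_pos] al(2) by simp
    then have "\<alpha>\<^sub>0 \<bullet> x \<le> 0" using al(1) by (simp add: upper_def mult_le_0_iff)
    then have low: "softmin \<epsilon> x < \<eta>" using psi_le[of x] eta by linarith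
    \<comment> \<open>Near x the soft minimum stays in the flat range, where only the radial factor varies.\<close>
    have near: "\<forall>\<^sub>F t in nhds 0. softmin \<epsilon> (x + t *\<^sub>R w) < \<eta>" for w
    proof -
      have "isCont (\<lambda>t. softmin \<epsilon> (x + t *\<^sub>R w)) 0"
        by (rule continuous_on_interior[OF continuous_on_compose2[OF cont_s, of UNIV]])
          (auto intro!: continuous_intros)
      then have "((\<lambda>t. softmin \<epsilon> (x + t *\<^sub>R w)) \<longlongrightarrow> softmin \<epsilon> x) (nhds 0)"
        by (simp add: continuous_at tendsto_nhds_iff)
      then show ?thesis using low by (rule order_tendstoD)
    qed
    have v_eq: "v (x + t *\<^sub>R \<alpha>) = v (x - t *\<^sub>R \<alpha>)" for t
      using al(2) by (simp add: v_def inner_add_left inner_add_right inner_diff_left inner_diff_right inner_commute[of x \<alpha>])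
    show "\<forall>\<^sub>F t in nhds 0. u (x + t *\<^sub>R \<alpha>) = u (x - t *\<^sub>R \<alpha>)"
      using near[of \<alpha>] near[of "- \<alpha>"]
    proof eventually_elim
      case (elim t)
      then show ?case using F(5)[of "softmin \<epsilon> (x + t *\<^sub>R \<alpha>)"] F(5)[of "softmin \<epsilon> (x - t *\<^sub>R \<alpha>)"]
        by (simp add: u_def v_eq)
    qed
  qed
  have "chamber \<subseteq> interior (closure chamber)" using chamber_open CD by (simp add: interior_maximal)
  then have D: "convex (closure chamber)" "interior (closure chamber) \<noteq> {}"
    using chamber_convex ne convex_closure by auto
  have dom: "u \<in> radial_dunkl_domain R S"
    unfolding radial_dunkl_domain_def Let_def
  proof (intro CollectI conjI ballI impI)
    show "C2_on (closure chamber) u" by (rule C2_with_within(4)[OF D C2])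
    have "{x \<in> closure chamber. u x \<noteq> 0} \<subseteq> cball 0 (N\<^sub>1 + 1)" using uz by force
    then have "bounded {x \<in> closure chamber. u x \<noteq> 0}" by (rule bounded_subset[OF bounded_cball])
    then show "compact (closure {x \<in> closure chamber. u x \<noteq> 0})" by (simp add: compact_closure)
    fix \<alpha> x assume al: "\<alpha> \<in> pos" and x: "x \<in> closure chamber" and z: "\<alpha> \<bullet> x = 0"
    have "\<alpha> \<in> levi \<or> \<alpha> \<in> upper" using al pos_split(1) by blast
    then show "gradient_within (closure chamber) u x \<bullet> \<alpha> = 0"
      unfolding C2_with_within(1)[OF D C2 x] using levi_even upper_even x z by blast
  qed
  have gen: "radial_dunkl_generator R S k u x \<le> - (a\<^sup>2 / 2 * (norm \<alpha>\<^sub>0)\<^sup>2 * (\<rho> + 1) powr (a - 2))"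
    if x: "x \<in> closure chamber" "\<delta> \<le> \<alpha>\<^sub>0 \<bullet> x" "\<alpha>\<^sub>0 \<bullet> x \<le> \<rho>" "norm x \<le> N" for x
  proof (rule generator_le[OF chamber_open chamber_convex ne finite_pos _ C2 x(1)])
    show "0 \<notin> pos" using pos_root roots_nonzero by blast
    show "\<alpha> \<bullet> g z = 0" if al: "\<alpha> \<in> pos" "\<alpha> \<bullet> x = 0" and z: "\<alpha> \<bullet> z = 0" for \<alpha> z
    proof -
      have "\<alpha> \<notin> upper"
      proof
        assume up: "\<alpha> \<in> upper"
        have "coord \<alpha>\<^sub>0 \<alpha> * (\<alpha>\<^sub>0 \<bullet> x) \<le> 0"
          using inner_upper_ge[OF up, of x] closed_chamber_inner_nonneg[OF x(1) simple_pos] al(2) by simp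
        then show False using up x(2) d by (simp add: upper_def mult_le_0_iff)
      qed
      then have "\<alpha> \<in> levi" using al(1) pos_split(1) by blast
      then show ?thesis using levi_even z by (simp add: inner_commute)
    qed
    let ?V = "{y. \<delta>\<^sub>1 < \<alpha>\<^sub>0 \<bullet> y} \<inter> {y. \<alpha>\<^sub>0 \<bullet> y < \<rho> + 1} \<inter> ball 0 N\<^sub>1"
    have "open ?V" by (intro open_Int open_halfspace_gt open_halfspace_lt open_ball)
    moreover have "x \<in> ?V" using x d1 by (auto simp: N\<^sub>1_def)
    ultimately have "\<forall>\<^sub>F y in at x within chamber. y \<in> chamber \<and> y \<in> ?V"
      unfolding eventually_at_topological by blast
    then show "\<forall>\<^sub>F y in at x within chamber. (\<Sum>b\<in>Basis. hh y b \<bullet> b) / 2 +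
        (\<Sum>\<alpha>\<in>pos. k \<alpha> * ((\<alpha> \<bullet> g y) / (\<alpha> \<bullet> y)))
        \<le> - (a\<^sup>2 / 2 * (norm \<alpha>\<^sub>0)\<^sup>2 * (\<rho> + 1) powr (a - 2))"
    proof eventually_elim
      case (elim y)
      then have y: "y \<in> chamber" "\<delta>\<^sub>1 \<le> \<alpha>\<^sub>0 \<bullet> y" "\<alpha>\<^sub>0 \<bullet> y \<le> \<rho> + 1" "norm y \<le> N\<^sub>1" by auto
      have psi: "\<delta>\<^sub>1 / 2 \<le> softmin \<epsilon> y" using psi_ge[of y] y CD by force
      let ?p = "softmin \<epsilon> y" and ?s = "softmin_gradient \<epsilon> y"
      have Fy: "F ?p = ?p powr a" "F' ?p = a * ?p powr (a - 1)" "F'' ?p = a * (a - 1) * ?p powr (a - 2)"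
        using F(6)[of ?p] psi by (auto simp: \<eta>_def)
      have \<kappa>y: "\<kappa> (v y) = 1" "\<kappa>' (v y) = 0" "\<kappa>'' (v y) = 0" using \<kappa>(5)[OF v_small[OF y(4)]] by auto
      have gy: "g y = F' ?p *\<^sub>R ?s" by (simp add: g_def \<kappa>y)
      have hy: "hh y w = F' ?p *\<^sub>R h y w + (F'' ?p * (?s \<bullet> w)) *\<^sub>R ?s" for w by (simp add: hh_def \<kappa>y)
      have "(\<Sum>b\<in>Basis. (?s \<bullet> b) * (?s \<bullet> b)) = (norm ?s)\<^sup>2"
        by (metis euclidean_inner power2_norm_eq_inner)
      moreover have "(\<Sum>b\<in>Basis. hh y b \<bullet> b) = F' ?p * (\<Sum>b\<in>Basis. h y b \<bullet> b) + F'' ?p * (\<Sum>b\<in>Basis. (?s \<bullet> b) * (?s \<bullet> b))"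
        unfolding hy by (simp add: inner_add_left sum.distrib sum_distrib_left mult.assoc)
      ultimately have lap: "(\<Sum>b\<in>Basis. hh y b \<bullet> b) =
          F' ?p * - (((norm \<alpha>\<^sub>0)\<^sup>2 - (norm ?s)\<^sup>2) / \<epsilon>) + F'' ?p * (norm ?s)\<^sup>2"
        by (simp only: h(2))
      have "\<epsilon> \<le> ?p" using psi e(3) by linarith
      then show ?case unfolding lap gy
        by (rule softmin_power_bound[OF e(1) y(1) d1(1) y(2,3) _ sep k a Fy(2,3)])
    qed
  qed
  have low: "u x \<le> r powr a" if x: "x \<in> closure chamber" "\<delta> \<le> \<alpha>\<^sub>0 \<bullet> x" "\<alpha>\<^sub>0 \<bullet> x \<le> r" for x
  proof -
    have psi: "\<delta>\<^sub>1 / 2 \<le> softmin \<epsilon> x" "softmin \<epsilon> x \<le> r" using psi_ge[OF x(1)] psi_le[of x] x d1 by auto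
    have "u x \<le> F (softmin \<epsilon> x)" using F(4) \<kappa>(4) by (simp add: u_def mult_left_le)
    also have "\<dots> = softmin \<epsilon> x powr a" using F(6)[of "softmin \<epsilon> x"] psi by (simp add: \<eta>_def)
    also have "\<dots> \<le> r powr a" using psi d1 a0 by (intro powr_mono2) auto
    finally show ?thesis .
  qed
  have high: "(\<rho> / 2) powr a \<le> u x" if x: "x \<in> closure chamber" "\<rho> < \<alpha>\<^sub>0 \<bullet> x" "norm x \<le> N" for x
  proof -
    have psi: "\<delta>\<^sub>1 / 2 \<le> softmin \<epsilon> x" "\<rho> / 2 \<le> softmin \<epsilon> x" using psi_ge[OF x(1)] x d1 by auto
    have "\<kappa> (v x) = 1" using \<kappa>(5)[OF v_small[of x]] x(3) by (simp add: N\<^sub>1_def)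
    then have "u x = softmin \<epsilon> x powr a" using F(6)[of "softmin \<epsilon> x"] psi by (simp add: u_def \<eta>_def)
    then show ?thesis using psi r a0 by (simp add: powr_mono2)
  qed
  show ?thesis using dom cont_u ub gen low high by blast
qed

end

section \<open>Markov processes sampled on a time grid\<close>

lemma subalgebra_natural_filtration:
  assumes "\<And>t. 0 \<le> t \<Longrightarrow> X t \<in> M \<rightarrow>\<^sub>M E"
  shows "subalgebra M (natural_filtration M E X s)"
proof -
  have "{X r -` A \<inter> space M | r A. 0 \<le> r \<and> r \<le> s \<and> A \<in> sets E} \<subseteq> sets M"
    using assms measurable_sets by blast
  moreover from this have "{X r -` A \<inter> space M | r A. 0 \<le> r \<and> r \<le> s \<and> A \<in> sets E} \<subseteq> Pow (space M)"
    using sets.sets_into_space by blast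
  ultimately show ?thesis
    by (simp add: subalgebra_def natural_filtration_def space_measure_of_conv sets.sigma_sets_subset)
qed

lemma natural_filtration_sets:
  assumes "\<And>t. 0 \<le> t \<Longrightarrow> X t \<in> M \<rightarrow>\<^sub>M E" "A \<in> sets (natural_filtration M E X s)"
  shows "A \<in> sets M"
  using subalgebra_natural_filtration[of X M E s] assms by (auto simp: subalgebra_def)

lemma natural_filtration_vimage:
  assumes "0 \<le> r" "r \<le> s" "A \<in> sets E"
  shows "{\<omega>\<in>space M. X r \<omega> \<in> A} \<in> sets (natural_filtration M E X s)"
proof -
  have "{X r -` A \<inter> space M | r A. 0 \<le> r \<and> r \<le> s \<and> A \<in> sets E} \<subseteq> Pow (space M)" by auto
  moreover have "{\<omega>\<in>space M. X r \<omega> \<in> A} = X r -` A \<inter> space M" by auto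
  ultimately show ?thesis using assms unfolding natural_filtration_def by auto
qed

text \<open>The Markov property, given through conditional expectations, integrated over an event of the past.\<close>

lemma markov_measure:
  assumes "markov_process M E P X" "0 \<le> s" "0 \<le> t"
    and A: "A \<in> sets (natural_filtration M E X s)" and B: "B \<in> sets E"
  shows "measure M {\<omega>\<in>A. X (s + t) \<omega> \<in> B} = (\<integral>\<omega>. indicator A \<omega> * measure (P t (X s \<omega>)) B \<partial>M)"
proof -
  have X[measurable]: "\<And>t. 0 \<le> t \<Longrightarrow> X t \<in> M \<rightarrow>\<^sub>M E" and "prob_space M"
    and cond: "AE \<omega> in M. real_cond_exp M (natural_filtration M E X s) (\<lambda>\<omega>'. indicator B (X (s + t) \<omega>')) \<omega> =
        measure (P t (X s \<omega>)) B"
    using assms by (auto simp: markov_process_def)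
  interpret prob_space M by fact
  let ?F = "natural_filtration M E X s"
  have sub: "subalgebra M ?F" using X by (rule subalgebra_natural_filtration)
  interpret sigma_finite_subalgebra M ?F
    using sub by (intro finite_measure_subalgebra_is_sigma_finite)
      (simp add: finite_measure_subalgebra_def finite_measure_subalgebra_axioms_def finite_measure_axioms)
  have AM[measurable]: "A \<in> sets M" using A sub by (auto simp: subalgebra_def)
  have [measurable]: "X (s + t) \<in> M \<rightarrow>\<^sub>M E" "B \<in> sets E" using assms X by auto
  have int: "integrable M (\<lambda>\<omega>. indicator B (X (s + t) \<omega>) :: real)"
    by (intro integrable_const_bound[where B = 1]) (auto simp: indicator_def)
  have "measure M {\<omega>\<in>A. X (s + t) \<omega> \<in> B} = (\<integral>\<omega>. indicator {\<omega>\<in>A. X (s + t) \<omega> \<in> B} \<omega> \<partial>M)"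
  proof -
    have "{\<omega>\<in>A. X (s + t) \<omega> \<in> B} = A \<inter> (X (s + t) -` B \<inter> space M)"
      using sets.sets_into_space[OF AM] by auto
    also have "\<dots> \<in> sets M" by measurable
    finally show ?thesis by simp
  qed
  also have "\<dots> = (\<integral>\<omega>\<in>A. indicator B (X (s + t) \<omega>) \<partial>M)"
    unfolding set_lebesgue_integral_def by (intro Bochner_Integration.integral_cong) (auto simp: indicator_def)
  also have "\<dots> = (\<integral>\<omega>\<in>A. real_cond_exp M ?F (\<lambda>\<omega>'. indicator B (X (s + t) \<omega>')) \<omega> \<partial>M)"
    by (rule real_cond_exp_intA[OF int A])
  also have "\<dots> = (\<integral>\<omega>. indicator A \<omega> * measure (P t (X s \<omega>)) B \<partial>M)"
  proof -
    have "(\<lambda>\<omega>. measure (P t (X s \<omega>)) B) \<in> borel_measurable M"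
    proof -
      have "P t \<in> E \<rightarrow>\<^sub>M prob_algebra E"
        using assms by (simp add: markov_process_def transition_semigroup_def)
      then have "P t \<in> E \<rightarrow>\<^sub>M subprob_algebra E" by (rule measurable_prob_algebraD)
      from measurable_compose[OF X[OF \<open>0 \<le> s\<close>] this]
      show ?thesis by (rule measurable_compose[OF _ measurable_measure_subprob_algebra[OF B]])
    qed
    then show ?thesis unfolding set_lebesgue_integral_def
      using cond by (intro integral_cong_AE) auto
  qed
  finally show ?thesis .
qed

text \<open>Both sides are integrals of \<open>u\<close>, with respect to the law of \<open>X (s + t)\<close> on \<open>A\<close> and to the law of \<open>X s\<close> on
  \<open>A\<close> moved by the kernel \<open>P t\<close>. By \<open>markov_measure\<close> these two measures agree.\<close>

lemma markov_nn_integral: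
  assumes mp: "markov_process M E P X" and st: "0 \<le> s" "0 \<le> t"
    and A: "A \<in> sets (natural_filtration M E X s)" and u[measurable]: "u \<in> borel_measurable E"
  shows "(\<integral>\<^sup>+\<omega>. indicator A \<omega> * u (X (s + t) \<omega>) \<partial>M) =
    (\<integral>\<^sup>+\<omega>. indicator A \<omega> * (\<integral>\<^sup>+y. u y \<partial>P t (X s \<omega>)) \<partial>M)"
proof -
  have X: "\<And>t. 0 \<le> t \<Longrightarrow> X t \<in> M \<rightarrow>\<^sub>M E" and "prob_space M"
    and P: "P t \<in> E \<rightarrow>\<^sub>M prob_algebra E"
    using mp st by (auto simp: markov_process_def transition_semigroup_def)
  interpret prob_space M by fact
  have P'[measurable]: "P t \<in> E \<rightarrow>\<^sub>M subprob_algebra E" using P by (rule measurable_prob_algebraD)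
  have X'[measurable]: "X s \<in> M \<rightarrow>\<^sub>M E" "X (s + t) \<in> M \<rightarrow>\<^sub>M E" using X st by auto
  have AM[measurable]: "A \<in> sets M"
    using X A by (rule natural_filtration_sets)
  let ?D = "density M (indicator A)"
  let ?N1 = "distr ?D E (X (s + t))" and ?N2 = "distr ?D E (X s) \<bind> P t"
  have ne: "space E \<noteq> {}" using not_empty measurable_space[OF X'(1)] by blast
  have s2: "sets ?N2 = sets E"
  proof (rule sets_bind)
    show "sets (P t x) = sets E" if "x \<in> space (distr ?D E (X s))" for x
      by (rule sets_kernel[OF P']) (use that in simp)
  qed (use ne in simp)
  have "?N1 = ?N2"
  proof (rule measure_eqI)
    show "sets ?N1 = sets ?N2" by (simp add: s2)
    fix B assume "B \<in> sets ?N1"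
    then have B[measurable]: "B \<in> sets E" by simp
    have prob: "emeasure (P t (X s \<omega>)) B = ennreal (measure (P t (X s \<omega>)) B)" if "\<omega> \<in> space M" for \<omega>
    proof -
      have "prob_space (P t (X s \<omega>))"
        using measurable_space[OF P] measurable_space[OF X'(1)] that by (auto simp: space_prob_algebra)
      then interpret Q: prob_space "P t (X s \<omega>)" .
      show ?thesis by (rule Q.emeasure_eq_measure)
    qed
    have meas: "(\<lambda>\<omega>. measure (P t (X s \<omega>)) B) \<in> borel_measurable M"
      by (rule measurable_compose[OF measurable_compose[OF X'(1) P'] measurable_measure_subprob_algebra[OF B]])
    have le1: "measure (P t (X s \<omega>)) B \<le> 1" if "\<omega> \<in> space M" for \<omega>
    proof -
      have "prob_space (P t (X s \<omega>))"
        using measurable_space[OF P] measurable_space[OF X'(1)] that by (auto simp: space_prob_algebra)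
      then interpret Q: prob_space "P t (X s \<omega>)" .
      show ?thesis by (rule Q.prob_le_1)
    qed
    have "emeasure ?N1 B = (\<integral>\<^sup>+\<omega>. indicator B \<omega> \<partial>?N1)" by simp
    also have "\<dots> = (\<integral>\<^sup>+\<omega>. indicator A \<omega> * indicator B (X (s + t) \<omega>) \<partial>M)"
      by (simp add: nn_integral_distr nn_integral_density del: nn_integral_indicator)
    also have "\<dots> = (\<integral>\<^sup>+\<omega>. indicator {\<omega>\<in>A. X (s + t) \<omega> \<in> B} \<omega> \<partial>M)"
      by (intro nn_integral_cong) (auto simp: indicator_def)
    also have "\<dots> = emeasure M {\<omega>\<in>A. X (s + t) \<omega> \<in> B}"
    proof -
      have "{\<omega>\<in>A. X (s + t) \<omega> \<in> B} = A \<inter> (X (s + t) -` B \<inter> space M)"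
        using sets.sets_into_space[OF AM] by auto
      also have "\<dots> \<in> sets M" by measurable
      finally show ?thesis by simp
    qed
    also have "\<dots> = ennreal (\<integral>\<omega>. indicator A \<omega> * measure (P t (X s \<omega>)) B \<partial>M)"
      by (simp add: emeasure_eq_measure markov_measure[OF mp st A B])
    also have "\<dots> = (\<integral>\<^sup>+\<omega>. ennreal (indicator A \<omega> * measure (P t (X s \<omega>)) B) \<partial>M)"
    proof (rule nn_integral_eq_integral[symmetric])
      show "integrable M (\<lambda>\<omega>. indicator A \<omega> * measure (P t (X s \<omega>)) B)"
        using meas le1 by (intro integrable_const_bound[where B = 1]) (auto simp: indicator_def)
    qed simp
    also have "\<dots> = (\<integral>\<^sup>+\<omega>. indicator A \<omega> * emeasure (P t (X s \<omega>)) B \<partial>M)"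
      by (intro nn_integral_cong) (auto simp: prob indicator_def)
    also have "\<dots> = (\<integral>\<^sup>+x. emeasure (P t x) B \<partial>distr ?D E (X s))"
      using measurable_emeasure_kernel[OF P' B]
      by (simp add: nn_integral_distr nn_integral_density measurable_compose[OF X'(1)])
    also have "\<dots> = emeasure ?N2 B"
      by (rule emeasure_bind[OF _ _ B, symmetric]) (use ne P' in simp_all)
    finally show "emeasure ?N1 B = emeasure ?N2 B" .
  qed
  then have "(\<integral>\<^sup>+y. u y \<partial>?N1) = (\<integral>\<^sup>+y. u y \<partial>?N2)" by simp
  also have "\<dots> = (\<integral>\<^sup>+x. \<integral>\<^sup>+y. u y \<partial>P t x \<partial>distr ?D E (X s))"
    by (rule nn_integral_bind[OF u]) (use P' in simp)
  also have "\<dots> = (\<integral>\<^sup>+\<omega>. indicator A \<omega> * (\<integral>\<^sup>+y. u y \<partial>P t (X s \<omega>)) \<partial>M)"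
  proof -
    have "(\<lambda>x. \<integral>\<^sup>+y. u y \<partial>P t x) \<in> borel_measurable E"
      by (rule measurable_compose[OF P' nn_integral_measurable_subprob_algebra[OF u]])
    then show ?thesis by (simp add: nn_integral_distr nn_integral_density measurable_compose[OF X'(1)])
  qed
  finally show ?thesis by (simp add: nn_integral_distr nn_integral_density)
qed

lemma markov_step_le:
  assumes mp: "markov_process M E P X" and st: "0 \<le> s" "0 \<le> t"
    and A: "A \<in> sets (natural_filtration M E X s)" and u[measurable]: "u \<in> borel_measurable E"
    and bnd: "\<And>x. x \<in> space E \<Longrightarrow> 0 \<le> u x \<and> u x \<le> b"
    and step: "\<And>\<omega>. \<omega> \<in> A \<Longrightarrow> (\<integral>y. u y \<partial>P t (X s \<omega>)) \<le> u (X s \<omega>) - c"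
  shows "(\<integral>\<omega>. indicator A \<omega> * u (X (s + t) \<omega>) \<partial>M) \<le>
    (\<integral>\<omega>. indicator A \<omega> * u (X s \<omega>) \<partial>M) - c * measure M A"
proof -
  have X: "\<And>t. 0 \<le> t \<Longrightarrow> X t \<in> M \<rightarrow>\<^sub>M E" and "prob_space M"
    and P: "P t \<in> E \<rightarrow>\<^sub>M prob_algebra E"
    using mp st by (auto simp: markov_process_def transition_semigroup_def)
  interpret prob_space M by fact
  have P'[measurable]: "P t \<in> E \<rightarrow>\<^sub>M subprob_algebra E" using P by (rule measurable_prob_algebraD)
  have X'[measurable]: "X s \<in> M \<rightarrow>\<^sub>M E" "X (s + t) \<in> M \<rightarrow>\<^sub>M E" using X st by auto
  have AM[measurable]: "A \<in> sets M"
    using X A by (rule natural_filtration_sets)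
  have XE: "X s \<omega> \<in> space E" "X (s + t) \<omega> \<in> space E" if "\<omega> \<in> space M" for \<omega>
    using that X' measurable_space by fast+
  have int: "integrable M (\<lambda>\<omega>. indicator A \<omega> * u (X r \<omega>))" if "0 \<le> r" for r
  proof -
    have [measurable]: "X r \<in> M \<rightarrow>\<^sub>M E" using X that by auto
    have "norm (indicator A \<omega> * u (X r \<omega>)) \<le> b" if "\<omega> \<in> space M" for \<omega>
      using bnd[of "X r \<omega>"] measurable_space[OF X[OF \<open>0 \<le> r\<close>] that] by (auto simp: indicator_def)
    then show ?thesis by (intro integrable_const_bound[where B = b]) auto
  qed
  have intI: "integrable M (\<lambda>\<omega>. r * indicator Y \<omega> :: real)" if [measurable]: "Y \<in> sets M" for Y r
    by (intro integrable_mult_right integrable_const_bound[where B = 1]) (auto simp: indicator_def)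
  have Pu: "(\<integral>\<^sup>+y. ennreal (u y) \<partial>P t (X s \<omega>)) = ennreal (\<integral>y. u y \<partial>P t (X s \<omega>))"
    and Pu': "0 \<le> (\<integral>y. u y \<partial>P t (X s \<omega>))" if w: "\<omega> \<in> space M" for \<omega>
  proof -
    have Q: "prob_space (P t (X s \<omega>))" "sets (P t (X s \<omega>)) = sets E"
      using measurable_space[OF P] XE w by (auto simp: space_prob_algebra)
    interpret Q: prob_space "P t (X s \<omega>)" by fact
    have sp: "space (P t (X s \<omega>)) = space E" using Q(2) by (rule sets_eq_imp_space_eq)
    have meas: "u \<in> borel_measurable (P t (X s \<omega>))" using u Q(2) by (simp cong: measurable_cong_sets)
    have "integrable (P t (X s \<omega>)) u"
      using meas bnd sp by (intro Q.integrable_const_bound[where B = b]) auto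
    then show "(\<integral>\<^sup>+y. ennreal (u y) \<partial>P t (X s \<omega>)) = ennreal (\<integral>y. u y \<partial>P t (X s \<omega>))"
      using bnd sp by (intro nn_integral_eq_integral) auto
    show "0 \<le> (\<integral>y. u y \<partial>P t (X s \<omega>))" using bnd sp by (intro Bochner_Integration.integral_nonneg) auto
  qed
  have "ennreal (\<integral>\<omega>. indicator A \<omega> * u (X (s + t) \<omega>) \<partial>M)
      = (\<integral>\<^sup>+\<omega>. ennreal (indicator A \<omega> * u (X (s + t) \<omega>)) \<partial>M)"
    using int[of "s + t"] st bnd XE by (intro nn_integral_eq_integral[symmetric]) auto
  also have "\<dots> = (\<integral>\<^sup>+\<omega>. indicator A \<omega> * ennreal (u (X (s + t) \<omega>)) \<partial>M)"
    by (intro nn_integral_cong) (auto simp: indicator_def)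
  also have "\<dots> = (\<integral>\<^sup>+\<omega>. indicator A \<omega> * (\<integral>\<^sup>+y. ennreal (u y) \<partial>P t (X s \<omega>)) \<partial>M)"
    by (rule markov_nn_integral[OF mp st A]) simp
  also have "\<dots> \<le> (\<integral>\<^sup>+\<omega>. ennreal (indicator A \<omega> * u (X s \<omega>) - c * indicator A \<omega>) \<partial>M)"
  proof (rule nn_integral_mono)
    fix \<omega> assume "\<omega> \<in> space M"
    then show "indicator A \<omega> * (\<integral>\<^sup>+y. ennreal (u y) \<partial>P t (X s \<omega>))
        \<le> ennreal (indicator A \<omega> * u (X s \<omega>) - c * indicator A \<omega>)"
      using step[of \<omega>] by (auto simp: Pu indicator_def intro!: ennreal_leI)
  qed
  also have "\<dots> = ennreal (\<integral>\<omega>. indicator A \<omega> * u (X s \<omega>) - c * indicator A \<omega> \<partial>M)"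
  proof (rule nn_integral_eq_integral)
    show "integrable M (\<lambda>\<omega>. indicator A \<omega> * u (X s \<omega>) - c * indicator A \<omega>)"
      using int[OF st(1)] intI[OF AM] by (rule Bochner_Integration.integrable_diff)
    show "AE \<omega> in M. 0 \<le> indicator A \<omega> * u (X s \<omega>) - c * indicator A \<omega>"
    proof (rule AE_I2)
      fix \<omega> assume "\<omega> \<in> space M"
      then show "0 \<le> indicator A \<omega> * u (X s \<omega>) - c * indicator A \<omega>"
        using step[of \<omega>] Pu'[of \<omega>] by (auto simp: indicator_def)
    qed
  qed
  finally have "(\<integral>\<omega>. indicator A \<omega> * u (X (s + t) \<omega>) \<partial>M)
      \<le> (\<integral>\<omega>. indicator A \<omega> * u (X s \<omega>) - c * indicator A \<omega> \<partial>M)"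
  proof (subst (asm) ennreal_le_iff)
    show "0 \<le> (\<integral>\<omega>. indicator A \<omega> * u (X s \<omega>) - c * indicator A \<omega> \<partial>M)"
      using step Pu' by (intro Bochner_Integration.integral_nonneg) (fastforce simp: indicator_def)
  qed
  also have "\<dots> = (\<integral>\<omega>. indicator A \<omega> * u (X s \<omega>) \<partial>M) - c * measure M A"
    using int[OF st(1)] intI[OF AM] by (subst Bochner_Integration.integral_diff) auto
  finally show ?thesis .
qed

text \<open>The optional stopping argument on the grid \<open>t\<^sub>1 + i h\<close>. The event \<open>A i\<close> says that the process has stayed in
  \<open>G\<close> up to step \<open>i\<close>, and \<open>B i\<close> that it leaves \<open>G\<close> for \<open>K\<close> at the next step. In each step the expectation of
  \<open>u\<close> on the surviving event loses at least \<open>c h\<close> times the probability of survival, and it also pays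
  \<open>m\<close> for every exit into \<open>K\<close>; at the start it is at most \<open>q\<close>.\<close>

lemma discrete_exit_bound:
  assumes mp: "markov_process M E P X" and t: "0 \<le> t\<^sub>1" "0 < h"
    and u[measurable]: "u \<in> borel_measurable E"
    and bnd: "\<And>x. x \<in> space E \<Longrightarrow> 0 \<le> u x \<and> u x \<le> b"
    and G: "G \<in> sets E" "G\<^sub>0 \<in> sets E" and K: "K \<in> sets E" "G \<inter> K = {}"
    and step: "\<And>x. x \<in> G \<Longrightarrow> (\<integral>y. u y \<partial>P h x) \<le> u x - c * h"
    and start: "\<And>x. x \<in> G\<^sub>0 \<Longrightarrow> u x \<le> q" and c: "0 \<le> c" and q: "0 \<le> q"
    and m: "0 \<le> m" and K_ge: "\<And>x. x \<in> K \<Longrightarrow> m \<le> u x"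
  defines "A \<equiv> \<lambda>i. {\<omega>\<in>space M. X t\<^sub>1 \<omega> \<in> G\<^sub>0 \<and> (\<forall>j\<le>i. X (t\<^sub>1 + real j * h) \<omega> \<in> G)}"
  defines "B \<equiv> \<lambda>i. {\<omega>\<in>A i. X (t\<^sub>1 + real (Suc i) * h) \<omega> \<in> K}"
  shows "A i \<in> sets M" "B i \<in> sets M"
    "c * h * real n * measure M (A n) + m * measure M (\<Union>i<n. B i) \<le> q"
proof -
  have X: "\<And>t. 0 \<le> t \<Longrightarrow> X t \<in> M \<rightarrow>\<^sub>M E" and "prob_space M"
    using mp by (auto simp: markov_process_def)
  interpret prob_space M by fact
  have pt: "0 \<le> t\<^sub>1 + real i * h" for i using t by simp
  have AF: "A i \<in> sets (natural_filtration M E X (t\<^sub>1 + real i * h))" for i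
  proof -
    have "{\<omega>\<in>space M. X (t\<^sub>1 + real j * h) \<omega> \<in> G} \<in> sets (natural_filtration M E X (t\<^sub>1 + real i * h))" if "j \<le> i" for j
      using t G that pt by (intro natural_filtration_vimage) auto
    moreover have "{\<omega>\<in>space M. X t\<^sub>1 \<omega> \<in> G\<^sub>0} \<in> sets (natural_filtration M E X (t\<^sub>1 + real i * h))"
      using t G by (intro natural_filtration_vimage) auto
    moreover have "A i = {\<omega>\<in>space M. X t\<^sub>1 \<omega> \<in> G\<^sub>0} \<inter> (\<Inter>j\<in>{..i}. {\<omega>\<in>space M. X (t\<^sub>1 + real j * h) \<omega> \<in> G})"
      by (auto simp: A_def)
    ultimately show ?thesis by (auto intro!: sets.Int sets.finite_INT)
  qed
  have A[measurable]: "A i \<in> sets M" for i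
    using X AF by (rule natural_filtration_sets)
  then show "A i \<in> sets M" .
  have B[measurable]: "B i \<in> sets M" for i
  proof -
    have "B i = A i \<inter> (X (t\<^sub>1 + real (Suc i) * h) -` K \<inter> space M)"
      using sets.sets_into_space[OF A] unfolding B_def by auto
    also have "\<dots> \<in> sets M" using A measurable_sets[OF X[OF pt] K(1)] by (rule sets.Int)
    finally show ?thesis .
  qed
  then show "B i \<in> sets M" .
  define V where "V i = (\<integral>\<omega>. indicator (A i) \<omega> * u (X (t\<^sub>1 + real i * h) \<omega>) \<partial>M)" for i
  have XE: "X (t\<^sub>1 + real i * h) \<omega> \<in> space E" if "\<omega> \<in> space M" for \<omega> i
    using that X[OF pt] measurable_space by fast
  have int: "integrable M (\<lambda>\<omega>. indicator (Y::'a set) \<omega> * u (X (t\<^sub>1 + real i * h) \<omega>))" if [measurable]: "Y \<in> sets M" for Y i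
  proof -
    have [measurable]: "X (t\<^sub>1 + real i * h) \<in> M \<rightarrow>\<^sub>M E" using X pt by auto
    have "norm (indicator Y \<omega> * u (X (t\<^sub>1 + real i * h) \<omega>)) \<le> b" if "\<omega> \<in> space M" for \<omega>
      using bnd[OF XE[OF that, of i]] by (auto simp: indicator_def)
    then show ?thesis by (intro integrable_const_bound[where B = b]) auto
  qed
  have intI: "integrable M (\<lambda>\<omega>. r * indicator Y \<omega> :: real)" if [measurable]: "Y \<in> sets M" for Y r
    by (intro integrable_mult_right integrable_const_bound[where B = 1]) (auto simp: indicator_def)
  have disj: "A (Suc i) \<inter> B i = {}" for i
    using K(2) by (auto simp: A_def B_def)
  have sub: "A (Suc i) \<subseteq> A i" "B i \<subseteq> A i" for i by (auto simp: A_def B_def)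
  have one: "V (Suc i) + m * measure M (B i) + c * h * measure M (A i) \<le> V i" for i
  proof -
    have eq: "t\<^sub>1 + real i * h + h = t\<^sub>1 + real (Suc i) * h" by (simp add: algebra_simps)
    have "(\<integral>\<omega>. indicator (A i) \<omega> * u (X (t\<^sub>1 + real i * h + h) \<omega>) \<partial>M) \<le> V i - c * h * measure M (A i)"
      unfolding V_def
      by (rule markov_step_le[OF mp pt _ AF u bnd]) (use t step in \<open>auto simp: A_def\<close>)
    moreover have "V (Suc i) + m * measure M (B i) \<le> (\<integral>\<omega>. indicator (A i) \<omega> * u (X (t\<^sub>1 + real i * h + h) \<omega>) \<partial>M)"
    proof -
      have "V (Suc i) + m * measure M (B i) =
        (\<integral>\<omega>. indicator (A (Suc i)) \<omega> * u (X (t\<^sub>1 + real (Suc i) * h) \<omega>) + m * indicator (B i) \<omega> \<partial>M)"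
        unfolding V_def using Bochner_Integration.integral_add[OF int[OF A, of "Suc i" "Suc i"] intI[OF B, of m i]]
        by (simp del: of_nat_Suc)
      also have "\<dots> \<le> (\<integral>\<omega>. indicator (A i) \<omega> * u (X (t\<^sub>1 + real i * h + h) \<omega>) \<partial>M)"
        unfolding eq
      proof (rule integral_mono)
        show "integrable M (\<lambda>\<omega>. indicator (A (Suc i)) \<omega> * u (X (t\<^sub>1 + real (Suc i) * h) \<omega>) + m * indicator (B i) \<omega>)"
          using int[OF A] intI[OF B] by (rule Bochner_Integration.integrable_add)
        show "integrable M (\<lambda>\<omega>. indicator (A i) \<omega> * u (X (t\<^sub>1 + real (Suc i) * h) \<omega>))"
          by (rule int[OF A])
        fix \<omega> assume w: "\<omega> \<in> space M"
        have "0 \<le> u (X (t\<^sub>1 + real (Suc i) * h) \<omega>)" using bnd[OF XE[OF w]] by blast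
        moreover have "\<omega> \<in> B i \<Longrightarrow> m \<le> u (X (t\<^sub>1 + real (Suc i) * h) \<omega>)" using K_ge by (auto simp: B_def)
        ultimately show "indicator (A (Suc i)) \<omega> * u (X (t\<^sub>1 + real (Suc i) * h) \<omega>) + m * indicator (B i) \<omega>
            \<le> indicator (A i) \<omega> * u (X (t\<^sub>1 + real (Suc i) * h) \<omega>)"
          using disj[of i] sub[of i] by (auto simp: indicator_def)
      qed
      finally show ?thesis .
    qed
    ultimately show ?thesis by simp
  qed
  have dec: "measure M (A n) \<le> measure M (A i)" if "i \<le> n" for i n
    using that by (intro finite_measure_mono A) (auto simp: A_def)
  have "V n + m * (\<Sum>i<n. measure M (B i)) + c * h * (\<Sum>i<n. measure M (A i)) \<le> V 0" for n
  proof (induction n)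
    case (Suc n)
    then show ?case using one[of n] by (simp add: algebra_simps)
  qed simp
  note tele = this[of n]
  have "V 0 \<le> (\<integral>\<omega>. indicator (A 0) \<omega> * q \<partial>M)"
    unfolding V_def
  proof (rule integral_mono)
    show "integrable M (\<lambda>\<omega>. indicator (A 0) \<omega> * q)" using intI[OF A, of q 0] by (simp add: mult.commute)
  qed (use int[OF A, of 0 0] start in \<open>auto simp: indicator_def A_def\<close>)
  also have "\<dots> = measure M (A 0) * q" by simp
  also have "\<dots> \<le> q" using q prob_le_1[of "A 0"] by (simp add: mult_left_le_one_le)
  finally have V0: "V 0 \<le> q" .
  have Vn: "0 \<le> V n" unfolding V_def
  proof (rule Bochner_Integration.integral_nonneg)
    fix \<omega> assume "\<omega> \<in> space M"
    then show "0 \<le> indicator (A n) \<omega> * u (X (t\<^sub>1 + real n * h) \<omega>)" using bnd[OF XE] by simp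
  qed
  have "real n * measure M (A n) = (\<Sum>i<n. measure M (A n))" by simp
  also have "\<dots> \<le> (\<Sum>i<n. measure M (A i))" using dec by (intro sum_mono) auto
  finally have a: "c * h * (real n * measure M (A n)) \<le> c * h * (\<Sum>i<n. measure M (A i))"
    using c t by (intro mult_left_mono) auto
  show "c * h * real n * measure M (A n) + m * measure M (\<Union>i<n. B i) \<le> q"
  proof -
    have "measure M (\<Union>i<n. B i) \<le> (\<Sum>i<n. measure M (B i))"
      using B by (intro finite_measure_subadditive_finite) auto
    then have "m * measure M (\<Union>i<n. B i) \<le> m * (\<Sum>i<n. measure M (B i))"
      using m by (rule mult_left_mono)
    then show ?thesis using a tele V0 Vn by (simp add: mult.assoc)
  qed
qed

section \<open>Paths that keep a functional positive\<close>

text \<open>One function \<open>u\<close> at one level of truncation. The grid has mesh \<open>h = T / n\<close>, with \<open>n\<close> so large that the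
  one-step estimate applies. A path of the kind considered can leave the region at a grid
  time only through \<open>y > R\<close>, because the truncations are respected at all times.\<close>

lemma grid_exit_event:
  fixes X :: "real \<Rightarrow> 'w \<Rightarrow> 'a::euclidean_space" and y :: "'a \<Rightarrow> real"
  assumes mp: "markov_process M (restrict_space borel D) P X"
    and y: "continuous_on UNIV y" and T: "0 < T" and c: "0 < c" and m: "0 < m" and q: "0 \<le> q" and rR: "r \<le> R"
    and u: "u \<in> borel_measurable (restrict_space borel D)" "\<And>x. x \<in> D \<Longrightarrow> 0 \<le> u x \<and> u x \<le> b"
    and h0: "0 < h\<^sub>0"
    and step: "\<And>h x. 0 < h \<Longrightarrow> h < h\<^sub>0 \<Longrightarrow> x \<in> D \<Longrightarrow> \<delta> \<le> y x \<Longrightarrow> y x \<le> R \<Longrightarrow> norm x \<le> N \<Longrightarrow>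
        (\<integral>z. u z \<partial>P h x) \<le> u x - c * h"
    and low: "\<And>x. x \<in> D \<Longrightarrow> \<delta> \<le> y x \<Longrightarrow> y x \<le> r \<Longrightarrow> u x \<le> q"
    and high: "\<And>x. x \<in> D \<Longrightarrow> R < y x \<Longrightarrow> norm x \<le> N \<Longrightarrow> m \<le> u x"
  shows "\<exists>Z\<in>sets M. measure M Z \<le> q / (c * T) + q / m \<and>
    {\<omega>\<in>space M. y (X 1 \<omega>) \<le> r \<and> (\<forall>t\<in>{1..1 + T}. \<delta> \<le> y (X t \<omega>) \<and> norm (X t \<omega>) \<le> N)} \<subseteq> Z"
proof -
  let ?E = "restrict_space borel D"
  have X: "\<And>t. 0 \<le> t \<Longrightarrow> X t \<in> M \<rightarrow>\<^sub>M ?E" and "prob_space M"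
    using mp by (auto simp: markov_process_def)
  interpret prob_space M by fact
  have spE: "space ?E = D" by (simp add: space_restrict_space)
  have XD: "X t \<omega> \<in> D" if "\<omega> \<in> space M" "0 \<le> t" for t \<omega>
    using measurable_space[OF X[OF that(2)] that(1)] spE by simp
  obtain n :: nat where n: "T / h\<^sub>0 < real n" using reals_Archimedean2 by blast
  have n0: "0 < real n" using n T h0 by (smt (verit) divide_pos_pos)
  define h where "h = T / real n"
  have h: "0 < h" "h < h\<^sub>0" "h * real n = T" using n n0 T h0 by (auto simp: h_def field_simps)
  define G where "G = D \<inter> {x. \<delta> \<le> y x \<and> y x \<le> R \<and> norm x \<le> N}"
  define G0 where "G0 = D \<inter> {x. \<delta> \<le> y x \<and> y x \<le> r}"
  define K where "K = D \<inter> {x. R < y x \<and> norm x \<le> N}"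
  have [measurable]: "y \<in> borel_measurable borel" using y by (rule borel_measurable_continuous_onI)
  have restr: "D \<inter> V \<in> sets ?E" if "V \<in> sets borel" for V using that by (auto simp: sets_restrict_space)
  have sets: "G \<in> sets ?E" "G0 \<in> sets ?E" "K \<in> sets ?E"
    unfolding G_def G0_def K_def by (rule restr; measurable)+
  define A where "A i = {\<omega>\<in>space M. X 1 \<omega> \<in> G0 \<and> (\<forall>j\<le>i. X (1 + real j * h) \<omega> \<in> G)}" for i
  define B where "B i = {\<omega>\<in>A i. X (1 + real (Suc i) * h) \<omega> \<in> K}" for i
  have bound: "A i \<in> sets M" "B i \<in> sets M"
    "c * h * real n * measure M (A n) + m * measure M (\<Union>i<n. B i) \<le> q" for i
  proof -
    have 1: "\<And>x. x \<in> space ?E \<Longrightarrow> 0 \<le> u x \<and> u x \<le> b" using u(2) spE by simp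
    have 2: "G \<inter> K = {}" by (auto simp: G_def K_def)
    have 3: "\<And>x. x \<in> G \<Longrightarrow> (\<integral>z. u z \<partial>P h x) \<le> u x - c * h" using step[OF h(1,2)] by (simp add: G_def)
    have 4: "\<And>x. x \<in> G0 \<Longrightarrow> u x \<le> q" using low by (simp add: G0_def)
    have 5: "\<And>x. x \<in> K \<Longrightarrow> m \<le> u x" using high by (simp add: K_def)
    have 0: "(0::real) \<le> 1" "0 \<le> c" "0 \<le> m" using c m by auto
    note d = discrete_exit_bound[OF mp 0(1) h(1) u(1) 1 sets(1,2,3) 2 3 4 0(2) q 0(3) 5, folded A_def, folded B_def]
    show "A i \<in> sets M" "B i \<in> sets M" "c * h * real n * measure M (A n) + m * measure M (\<Union>i<n. B i) \<le> q"
      by (rule d; assumption)+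
  qed
  have nn: "0 \<le> c * T * measure M (A n)" "0 \<le> m * measure M (\<Union>i<n. B i)" using c T m by auto
  have eq: "c * h * real n = c * T" using h by simp
  have "c * T * measure M (A n) \<le> q" "m * measure M (\<Union>i<n. B i) \<le> q" using bound(3) nn unfolding eq by linarith+
  then have "measure M (A n) \<le> q / (c * T)" "measure M (\<Union>i<n. B i) \<le> q / m"
    using c T m by (simp_all add: pos_le_divide_eq mult.commute)
  moreover have "measure M (A n \<union> (\<Union>i<n. B i)) \<le> measure M (A n) + measure M (\<Union>i<n. B i)"
    using bound(1,2) by (intro measure_Un_le) auto
  ultimately have meas: "measure M (A n \<union> (\<Union>i<n. B i)) \<le> q / (c * T) + q / m" by linarith
  moreover have "A n \<union> (\<Union>i<n. B i) \<in> sets M" using bound(1,2) by auto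
  moreover have "\<omega> \<in> A n \<union> (\<Union>i<n. B i)"
    if w: "\<omega> \<in> space M" "y (X 1 \<omega>) \<le> r"
      "\<forall>t\<in>{1..1 + T}. \<delta> \<le> y (X t \<omega>) \<and> norm (X t \<omega>) \<le> N" for \<omega>
  proof -
    have t: "1 + real j * h \<in> {1..1 + T}" if "j \<le> n" for j
      using that h mult_right_mono[of "real j" "real n" h] by (auto simp: mult.commute)
    have start: "X 1 \<omega> \<in> G0" using w T XD[OF w(1), of 1] by (auto simp: G0_def)
    have inG: "X (1 + real j * h) \<omega> \<in> G" if "j \<le> n" "y (X (1 + real j * h) \<omega>) \<le> R" for j
      using w(3) t[OF that(1)] that XD[OF w(1)] by (auto simp: G_def)
    show ?thesis
    proof (cases "\<exists>j\<le>n. R < y (X (1 + real j * h) \<omega>)")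
      case False
      then have "\<omega> \<in> A n" using w start inG by (force simp: A_def not_less)
      then show ?thesis by simp
    next
      case True
      define j where "j = (LEAST j. j \<le> n \<and> R < y (X (1 + real j * h) \<omega>))"
      have j: "j \<le> n \<and> R < y (X (1 + real j * h) \<omega>)" unfolding j_def using True by (rule LeastI_ex)
      have less: "y (X (1 + real i * h) \<omega>) \<le> R" if "i < j" for i
        using not_less_Least[of i "\<lambda>j. j \<le> n \<and> R < y (X (1 + real j * h) \<omega>)"] that j j_def by force
      have "j \<noteq> 0"
      proof
        assume "j = 0"
        then show False using j w(2) rR by simp
      qed
      then obtain i where i: "j = Suc i" using not0_implies_Suc by blast
      have "\<omega> \<in> A i" using w(1) start inG less j i by (auto simp: A_def)
      moreover have "X (1 + real (Suc i) * h) \<omega> \<in> K"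
        using j i w(3) t[of j] XD[OF w(1), of "1 + real (Suc i) * h"] h by (auto simp: K_def)
      ultimately have "\<omega> \<in> B i" by (simp add: B_def)
      then show ?thesis using i j by auto
    qed
  qed
  ultimately show ?thesis by (intro bexI[of _ "A n \<union> (\<Union>i<n. B i)"]) auto
qed

text \<open>A continuous path with \<open>y > 0\<close> has \<open>y\<close> bounded below and is bounded in norm on a compact time interval, so it
  respects all but finitely many of the truncations \<open>\<delta> = 1 / (l + 1)\<close>, \<open>N = l + 1\<close>. It therefore lies in
  the lower limit of the exceptional events, whose probability inherits their common bound. Time starts at 1 because the initial
  point may lie on the wall.\<close>

lemma survival_outer_bound:
  fixes X :: "real \<Rightarrow> 'w \<Rightarrow> 'a::euclidean_space" and y :: "'a \<Rightarrow> real"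
  assumes mp: "markov_process M (restrict_space borel D) P X"
    and cont: "\<And>\<omega>. \<omega> \<in> space M \<Longrightarrow> continuous_on {0..} (\<lambda>t. X t \<omega>)"
    and y: "continuous_on UNIV y" and T: "0 < T" and c: "0 < c" and m: "0 < m" and q: "0 \<le> q" and rR: "r \<le> R"
    and test: "\<And>\<delta> N. 0 < \<delta> \<Longrightarrow> 0 < N \<Longrightarrow> \<exists>u b h\<^sub>0. u \<in> borel_measurable (restrict_space borel D) \<and>
       (\<forall>x\<in>D. 0 \<le> u x \<and> u x \<le> b) \<and> 0 < h\<^sub>0 \<and>
       (\<forall>h x. 0 < h \<longrightarrow> h < h\<^sub>0 \<longrightarrow> x \<in> D \<longrightarrow> \<delta> \<le> y x \<longrightarrow> y x \<le> R \<longrightarrow> norm x \<le> N \<longrightarrow>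
          (\<integral>z. u z \<partial>P h x) \<le> u x - c * h) \<and>
       (\<forall>x\<in>D. \<delta> \<le> y x \<longrightarrow> y x \<le> r \<longrightarrow> u x \<le> q) \<and>
       (\<forall>x\<in>D. R < y x \<longrightarrow> norm x \<le> N \<longrightarrow> m \<le> u x)"
  shows "\<exists>Z\<in>sets M. measure M Z \<le> q / (c * T) + q / m \<and>
    {\<omega>\<in>space M. y (X 1 \<omega>) \<le> r \<and> (\<forall>t>0. 0 < y (X t \<omega>))} \<subseteq> Z"
proof -
  interpret prob_space M using mp by (simp add: markov_process_def)
  let ?S = "\<lambda>l. {\<omega>\<in>space M. y (X 1 \<omega>) \<le> r \<and>
      (\<forall>t\<in>{1..1 + T}. 1 / real (Suc l) \<le> y (X t \<omega>) \<and> norm (X t \<omega>) \<le> real (Suc l))}"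
  have "\<exists>Z. Z \<in> sets M \<and> measure M Z \<le> q / (c * T) + q / m \<and> ?S l \<subseteq> Z" for l
  proof -
    obtain u b h\<^sub>0 where "u \<in> borel_measurable (restrict_space borel D)"
       "\<forall>x\<in>D. 0 \<le> u x \<and> u x \<le> b" "0 < h\<^sub>0"
       "\<forall>h x. 0 < h \<longrightarrow> h < h\<^sub>0 \<longrightarrow> x \<in> D \<longrightarrow> 1 / real (Suc l) \<le> y x \<longrightarrow> y x \<le> R \<longrightarrow> norm x \<le> real (Suc l) \<longrightarrow>
          (\<integral>z. u z \<partial>P h x) \<le> u x - c * h"
       "\<forall>x\<in>D. 1 / real (Suc l) \<le> y x \<longrightarrow> y x \<le> r \<longrightarrow> u x \<le> q"
       "\<forall>x\<in>D. R < y x \<longrightarrow> norm x \<le> real (Suc l) \<longrightarrow> m \<le> u x"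
      using test[of "1 / real (Suc l)" "real (Suc l)"] by auto
    then have "\<exists>Z\<in>sets M. measure M Z \<le> q / (c * T) + q / m \<and> ?S l \<subseteq> Z"
      by (intro grid_exit_event[OF mp y T c m q rR, of u b h\<^sub>0]) blast+
    then show ?thesis by blast
  qed
  then have "\<exists>Z. \<forall>l. Z l \<in> sets M \<and> measure M (Z l) \<le> q / (c * T) + q / m \<and> ?S l \<subseteq> Z l"
    by (intro choice) simp
  then obtain Z where "\<forall>l. Z l \<in> sets M \<and> measure M (Z l) \<le> q / (c * T) + q / m \<and> ?S l \<subseteq> Z l" ..
  then have Z: "\<And>l. Z l \<in> sets M" "\<And>l. measure M (Z l) \<le> q / (c * T) + q / m" "\<And>l. ?S l \<subseteq> Z l"
    by simp_all
  define F where "F l = (\<Inter>i\<in>{l..}. Z i)" for l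
  have F: "F l \<in> sets M" for l unfolding F_def using Z(1) by (intro sets.countable_INT') auto
  have inc: "incseq F" by (auto simp: incseq_def F_def)
  have "(\<lambda>l. measure M (F l)) \<longlonglongrightarrow> measure M (\<Union>l. F l)"
    using F inc by (intro finite_Lim_measure_incseq) auto
  moreover have "measure M (F l) \<le> q / (c * T) + q / m" for l
    using finite_measure_mono[OF _ Z(1), of "F l" l] Z(2)[of l] by (force simp: F_def)
  ultimately have "measure M (\<Union>l. F l) \<le> q / (c * T) + q / m"
    by (intro LIMSEQ_le_const2) auto
  moreover have "\<omega> \<in> (\<Union>l. F l)"
    if w: "\<omega> \<in> space M" "y (X 1 \<omega>) \<le> r" "\<forall>t>0. 0 < y (X t \<omega>)" for \<omega>
  proof -
    have Xc: "continuous_on {1..1 + T} (\<lambda>t. X t \<omega>)"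
      using cont[OF w(1)] by (rule continuous_on_subset) auto
    have yc: "continuous_on {1..1 + T} (\<lambda>t. y (X t \<omega>))"
      by (rule continuous_on_compose2[OF y Xc]) auto
    have ne: "{1..1 + T} \<noteq> {}" using T by simp
    obtain t0 where t0: "t0 \<in> {1..1 + T}" "\<forall>t\<in>{1..1 + T}. y (X t0 \<omega>) \<le> y (X t \<omega>)"
      using continuous_attains_inf[OF _ ne yc] by auto
    have "bounded ((\<lambda>t. X t \<omega>) ` {1..1 + T})"
      using compact_continuous_image[OF Xc] compact_imp_bounded by blast
    then obtain b where b: "\<forall>t\<in>{1..1 + T}. norm (X t \<omega>) \<le> b" by (auto simp: bounded_iff)
    have pos: "0 < y (X t0 \<omega>)" using w(3) t0(1) by auto
    obtain l :: nat where l: "max b (1 / y (X t0 \<omega>)) < real l" using reals_Archimedean2 by blast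
    have "\<omega> \<in> Z i" if "l \<le> i" for i
    proof -
      have i: "b \<le> real (Suc i)" "1 / y (X t0 \<omega>) \<le> real (Suc i)" using l that by linarith+
      then have "1 / real (Suc i) \<le> y (X t0 \<omega>)" using pos by (simp add: field_simps)
      then have "\<omega> \<in> ?S i" using w t0(2) b i(1) by fastforce
      then show ?thesis using Z(3) by blast
    qed
    then show ?thesis by (auto simp: F_def)
  qed
  ultimately show ?thesis using F by (intro bexI[of _ "\<Union>l. F l"]) auto
qed

section \<open>Hitting the wall\<close>

lemma (in finite_measure) outer_null:
  assumes "\<And>e. 0 < e \<Longrightarrow> \<exists>Z\<in>sets M. measure M Z \<le> e \<and> B \<subseteq> Z"
  shows "\<exists>Z\<in>null_sets M. B \<subseteq> Z"
proof -
  have "\<exists>Z. \<forall>n::nat. Z n \<in> sets M \<and> measure M (Z n) \<le> 1 / real (Suc n) \<and> B \<subseteq> Z n"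
    using assms[of "1 / real (Suc n)" for n] by (intro choice) (auto simp: Bex_def)
  then obtain Z where Z: "\<And>n::nat. Z n \<in> sets M" "\<And>n. measure M (Z n) \<le> 1 / real (Suc n)" "\<And>n. B \<subseteq> Z n"
    by blast
  have I: "(\<Inter>n. Z n) \<in> sets M" using Z(1) by auto
  have "measure M (\<Inter>n. Z n) \<le> 1 / real (Suc n)" for n
    using finite_measure_mono[of "\<Inter>n. Z n" "Z n"] Z(1,2)[of n] by fastforce
  then have "measure M (\<Inter>n. Z n) \<le> 0"
    by (intro LIMSEQ_le_const[OF LIMSEQ_inverse_real_of_nat]) (auto simp: inverse_eq_divide)
  then have "measure M (\<Inter>n. Z n) = 0" by (simp add: antisym)
  then have "(\<Inter>n. Z n) \<in> null_sets M" using I by (simp add: null_sets_def emeasure_eq_measure)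
  then show ?thesis using Z(3) by blast
qed

context simple_root_data
begin

text \<open>On the closed chamber a positive root vanishes only if some simple root in its support does.\<close>

lemma frontier_chamber:
  assumes "x \<in> closure chamber"
  shows "x \<in> frontier chamber \<longleftrightarrow> (\<exists>\<alpha>\<in>S. \<alpha> \<bullet> x = 0)"
proof
  assume "x \<in> frontier chamber"
  then have "x \<notin> chamber" using chamber_open by (simp add: frontier_def interior_open)
  then obtain \<alpha> where "\<alpha> \<in> pos" "\<not> 0 < \<alpha> \<bullet> x" by (auto simp: weyl_chamber_def)
  then have "\<alpha> \<in> pos" "\<alpha> \<bullet> x = 0" using closed_chamber_inner_nonneg[OF assms, of \<alpha>] by auto
  then show "\<exists>\<alpha>\<in>S. \<alpha> \<bullet> x = 0"
    using pos_inner_zero[of \<alpha> x] closed_chamber_inner_nonneg[OF assms simple_pos] by blast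
next
  assume "\<exists>\<alpha>\<in>S. \<alpha> \<bullet> x = 0"
  then have "x \<notin> chamber" using simple_pos by (force simp: weyl_chamber_def)
  then show "x \<in> frontier chamber" using assms chamber_open by (simp add: frontier_def interior_open)
qed

text \<open>The order of the choices matters: the level \<open>\<rho>\<close> makes the exit at the top unlikely, it determines the rate
  \<open>c\<close>, and only then is the time \<open>T\<close> chosen so large that remaining in the strip is unlikely.\<close>

lemma wall_survival_outer_bound:
  fixes X :: "real \<Rightarrow> 'w \<Rightarrow> 'a"
  assumes mp: "markov_process M (restrict_space borel (closure chamber)) P X"
    and cont: "\<And>\<omega>. \<omega> \<in> space M \<Longrightarrow> continuous_on {0..} (\<lambda>t. X t \<omega>)"
    and gen: "\<And>u. u \<in> radial_dunkl_domain R S \<Longrightarrow>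
        uniform_limit (closure chamber) (\<lambda>t x. ((\<integral>y. u y \<partial>P t x) - u x) / t)
          (radial_dunkl_generator R S k u) (at_right 0)"
    and ne: "chamber \<noteq> {}" and k: "k \<alpha>\<^sub>0 < 1 / 2" and r: "0 < r" and e: "0 < e"
  shows "\<exists>Z\<in>sets M. measure M Z \<le> e \<and>
    {\<omega>\<in>space M. \<alpha>\<^sub>0 \<bullet> X 1 \<omega> \<le> r \<and> (\<forall>t>0. 0 < \<alpha>\<^sub>0 \<bullet> X t \<omega>)} \<subseteq> Z"
proof -
  define a where "a = (1 - 2 * k \<alpha>\<^sub>0) / 2"
  have a: "0 < a" using k by (simp add: a_def)
  \<comment> \<open>This choice makes (r / (rho / 2)) powr a at most e / 2.\<close>
  define \<rho> where "\<rho> = 2 * r * (1 + (2 / e) powr (1 / a))"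
  \<comment> \<open>Half of the rate of the test function: the other half pays for the error of the difference quotient.\<close>
  define c where "c = a\<^sup>2 / 4 * (norm \<alpha>\<^sub>0)\<^sup>2 * (\<rho> + 1) powr (a - 2)"
  define q where "q = r powr a"
  define m where "m = (\<rho> / 2) powr a"
  have "r \<le> r * (1 + (2 / e) powr (1 / a))" using r by simp
  then have rho: "r \<le> \<rho>" "0 < \<rho>" using r unfolding \<rho>_def by linarith+
  have c: "0 < c" using a rho roots_nonzero[OF root0_root] by (simp add: c_def)
  have q: "0 < q" using r by (simp add: q_def)
  have "q * (2 / e) = q * ((2 / e) powr (1 / a)) powr a" using a e by (simp add: powr_powr)
  also have "\<dots> \<le> q * (1 + (2 / e) powr (1 / a)) powr a"
    using q a by (intro mult_left_mono powr_mono2) auto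
  also have "\<dots> = m" using r by (simp add: q_def m_def \<rho>_def powr_mult)
  finally have "q * (2 / e) \<le> m" .
  moreover have m0: "0 < m" using rho by (simp add: m_def)
  ultimately have m: "0 < m" "q / m \<le> e / 2"
    using e by (simp_all add: field_simps)
  define T where "T = 2 * q / (c * e)"
  have T: "0 < T" "q / (c * T) = e / 2" using q c e by (auto simp: T_def field_simps)
  have test: "\<exists>u b h\<^sub>0. u \<in> borel_measurable (restrict_space borel (closure chamber)) \<and>
       (\<forall>x\<in>closure chamber. 0 \<le> u x \<and> u x \<le> b) \<and> 0 < h\<^sub>0 \<and>
       (\<forall>h x. 0 < h \<longrightarrow> h < h\<^sub>0 \<longrightarrow> x \<in> closure chamber \<longrightarrow> \<delta> \<le> \<alpha>\<^sub>0 \<bullet> x \<longrightarrow> \<alpha>\<^sub>0 \<bullet> x \<le> \<rho> \<longrightarrow> norm x \<le> N \<longrightarrow>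
          (\<integral>z. u z \<partial>P h x) \<le> u x - c * h) \<and>
       (\<forall>x\<in>closure chamber. \<delta> \<le> \<alpha>\<^sub>0 \<bullet> x \<longrightarrow> \<alpha>\<^sub>0 \<bullet> x \<le> r \<longrightarrow> u x \<le> q) \<and>
       (\<forall>x\<in>closure chamber. \<rho> < \<alpha>\<^sub>0 \<bullet> x \<longrightarrow> norm x \<le> N \<longrightarrow> m \<le> u x)"
    if dN: "0 < \<delta>" "0 < N" for \<delta> N
  proof -
    obtain u b where u: "u \<in> radial_dunkl_domain R S" "continuous_on UNIV u" "\<forall>x. 0 \<le> u x \<and> u x \<le> b"
      "\<forall>x\<in>closure chamber. \<delta> \<le> \<alpha>\<^sub>0 \<bullet> x \<longrightarrow> \<alpha>\<^sub>0 \<bullet> x \<le> \<rho> \<longrightarrow> norm x \<le> N \<longrightarrow>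
         radial_dunkl_generator R S k u x \<le> - (a\<^sup>2 / 2 * (norm \<alpha>\<^sub>0)\<^sup>2 * (\<rho> + 1) powr (a - 2))"
      "\<forall>x\<in>closure chamber. \<delta> \<le> \<alpha>\<^sub>0 \<bullet> x \<longrightarrow> \<alpha>\<^sub>0 \<bullet> x \<le> r \<longrightarrow> u x \<le> q"
      "\<forall>x\<in>closure chamber. \<rho> < \<alpha>\<^sub>0 \<bullet> x \<longrightarrow> norm x \<le> N \<longrightarrow> m \<le> u x"
      using test_function_exists[OF k a_def ne r rho(1) dN] unfolding q_def m_def by blast
    have "\<forall>\<^sub>F h in at_right 0. \<forall>x\<in>closure chamber.
        dist (((\<integral>y. u y \<partial>P h x) - u x) / h) (radial_dunkl_generator R S k u x) < c"
      using uniform_limitD[OF gen[OF u(1)] c] .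
    then obtain h\<^sub>0 where h0: "0 < h\<^sub>0" "\<And>h x. 0 < h \<Longrightarrow> h < h\<^sub>0 \<Longrightarrow> x \<in> closure chamber \<Longrightarrow>
        dist (((\<integral>y. u y \<partial>P h x) - u x) / h) (radial_dunkl_generator R S k u x) < c"
      unfolding eventually_at_right_field by blast
    have "(\<integral>z. u z \<partial>P h x) \<le> u x - c * h"
      if x: "0 < h" "h < h\<^sub>0" "x \<in> closure chamber" "\<delta> \<le> \<alpha>\<^sub>0 \<bullet> x" "\<alpha>\<^sub>0 \<bullet> x \<le> \<rho>" "norm x \<le> N" for h x
    proof -
      have "radial_dunkl_generator R S k u x \<le> - (2 * c)"
      proof -
        have "2 * c = a\<^sup>2 / 2 * (norm \<alpha>\<^sub>0)\<^sup>2 * (\<rho> + 1) powr (a - 2)" by (simp add: c_def)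
        moreover have "radial_dunkl_generator R S k u x \<le> - (a\<^sup>2 / 2 * (norm \<alpha>\<^sub>0)\<^sup>2 * (\<rho> + 1) powr (a - 2))"
          using u(4) x by blast
        ultimately show ?thesis by (simp only:)
      qed
      then have "((\<integral>y. u y \<partial>P h x) - u x) / h \<le> - c"
        using h0(2)[OF x(1-3)] by (simp add: dist_real_def abs_less_iff)
      then show ?thesis using x(1) by (simp add: field_simps)
    qed
    moreover have "u \<in> borel_measurable (restrict_space borel (closure chamber))"
      using u(2) by (intro measurable_restrict_space1 borel_measurable_continuous_onI)
    ultimately show ?thesis using u h0(1) by blast
  qed
  have "continuous_on UNIV (\<lambda>x. \<alpha>\<^sub>0 \<bullet> x)" by (intro continuous_intros)
  from survival_outer_bound[OF mp cont this T(1) c m(1) less_imp_le[OF q] rho(1) test]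
  obtain Z where Z: "Z \<in> sets M" "measure M Z \<le> q / (c * T) + q / m"
    "{\<omega>\<in>space M. \<alpha>\<^sub>0 \<bullet> X 1 \<omega> \<le> r \<and> (\<forall>t>0. 0 < \<alpha>\<^sub>0 \<bullet> X t \<omega>)} \<subseteq> Z" by auto
  have "q / (c * T) + q / m \<le> e / 2 + e / 2" using T(2) m(2) by (intro add_mono) simp_all
  then have "measure M Z \<le> e" using Z(2) by simp
  then show ?thesis using Z by blast
qed

end

theorem proposition1:
  fixes R S :: "'a::euclidean_space set"
    and k :: "'a \<Rightarrow> real"
    and M :: "'w measure"
    and X :: "real \<Rightarrow> 'w \<Rightarrow> 'a"
    and T :: "'a \<Rightarrow> 'w \<Rightarrow> ereal"
    and T\<^sub>0 :: "'w \<Rightarrow> ereal"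
    and \<alpha>\<^sub>0 :: 'a
  assumes "reduced_root_system R"
    and "simple_system R S"
    and "multiplicity_function R k"
    and "radial_dunkl_process R S k M X"
    and T_def: "\<And>\<alpha>. T \<alpha> = hitting_time (\<lambda>t \<omega>. \<alpha> \<bullet> X t \<omega>) {0}"
    and T0_def: "T\<^sub>0 = hitting_time X (frontier (weyl_chamber R S))"
    and "\<alpha>\<^sub>0 \<in> S" and "0 \<le> k \<alpha>\<^sub>0" and "k \<alpha>\<^sub>0 < 1 / 2"
  shows "(\<forall>\<omega>\<in>space M. T\<^sub>0 \<omega> = (INF \<alpha>\<in>S. T \<alpha> \<omega>)) \<and>
         (AE \<omega> in M. \<exists>t>0. \<alpha>\<^sub>0 \<bullet> X t \<omega> = 0) \<and>
         (AE \<omega> in M. T\<^sub>0 \<omega> \<le> T \<alpha>\<^sub>0 \<omega> \<and> T \<alpha>\<^sub>0 \<omega> < \<infinity>)"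
proof -
  interpret simple_root_data R S k \<alpha>\<^sub>0
    using assms by unfold_locales
  obtain P where mp: "markov_process M (restrict_space borel (closure chamber)) P X"
    and gen: "\<And>u. u \<in> radial_dunkl_domain R S \<Longrightarrow>
        uniform_limit (closure chamber) (\<lambda>t x. ((\<integral>y. u y \<partial>P t x) - u x) / t)
          (radial_dunkl_generator R S k u) (at_right 0)"
    and cont: "\<And>\<omega>. \<omega> \<in> space M \<Longrightarrow> continuous_on {0..} (\<lambda>t. X t \<omega>)"
    using assms(4) unfolding radial_dunkl_process_def Let_def by blast
  interpret prob_space M using mp by (simp add: markov_process_def)
  have XD: "X t \<omega> \<in> closure chamber" if "\<omega> \<in> space M" "0 \<le> t" for t \<omega>
  proof -
    have "X t \<in> M \<rightarrow>\<^sub>M restrict_space borel (closure chamber)" using mp that by (simp add: markov_process_def)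
    from measurable_space[OF this that(1)] show ?thesis by (simp add: space_restrict_space)
  qed
  have ne: "chamber \<noteq> {}"
  proof
    assume "chamber = {}"
    then have "closure chamber = {}" by simp
    then show False using XD[of _ 0] not_empty by auto
  qed
  have T0: "T\<^sub>0 \<omega> = (INF \<alpha>\<in>S. T \<alpha> \<omega>)" if w: "\<omega> \<in> space M" for \<omega>
  proof -
    have "{ereal t | t. t > 0 \<and> X t \<omega> \<in> frontier chamber} = (\<Union>\<alpha>\<in>S. {ereal t | t. t > 0 \<and> \<alpha> \<bullet> X t \<omega> \<in> {0}})"
      using frontier_chamber[OF XD[OF w]] by auto
    moreover have "Inf (\<Union>\<alpha>\<in>S. A \<alpha>) = (INF \<alpha>\<in>S. Inf (A \<alpha>))" for A :: "'a \<Rightarrow> ereal set"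
    proof (intro antisym INF_greatest Inf_greatest)
      show "Inf (\<Union>\<alpha>\<in>S. A \<alpha>) \<le> z" if "\<alpha> \<in> S" "z \<in> A \<alpha>" for \<alpha> z
        using that by (intro Inf_lower) auto
      show "(INF \<alpha>\<in>S. Inf (A \<alpha>)) \<le> z" if "z \<in> (\<Union>\<alpha>\<in>S. A \<alpha>)" for z
        using that by (auto intro: INF_lower2 Inf_lower)
    qed
    ultimately show ?thesis unfolding T0_def T_def hitting_time_def by simp
  qed
  let ?B = "\<lambda>r. {\<omega>\<in>space M. \<alpha>\<^sub>0 \<bullet> X 1 \<omega> \<le> r \<and> (\<forall>t>0. 0 < \<alpha>\<^sub>0 \<bullet> X t \<omega>)}"
  have "\<exists>Z\<in>null_sets M. ?B (real (Suc n)) \<subseteq> Z" for n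
    by (rule outer_null, rule wall_survival_outer_bound[OF mp cont gen ne assms(9)]) auto
  then have "\<exists>Z. \<forall>n. Z n \<in> null_sets M \<and> ?B (real (Suc n)) \<subseteq> Z n"
    by (intro choice) blast
  then obtain Z where Z: "\<forall>n. Z n \<in> null_sets M \<and> ?B (real (Suc n)) \<subseteq> Z n" ..
  have hit: "AE \<omega> in M. \<exists>t>0. \<alpha>\<^sub>0 \<bullet> X t \<omega> = 0"
  proof (rule AE_I')
    show "(\<Union>n. Z n) \<in> null_sets M" using Z by (intro null_sets_UN) simp
    show "{\<omega>\<in>space M. \<not> (\<exists>t>0. \<alpha>\<^sub>0 \<bullet> X t \<omega> = 0)} \<subseteq> (\<Union>n. Z n)"
    proof
      fix \<omega> assume w: "\<omega> \<in> {\<omega>\<in>space M. \<not> (\<exists>t>0. \<alpha>\<^sub>0 \<bullet> X t \<omega> = 0)}"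
      have "0 < \<alpha>\<^sub>0 \<bullet> X t \<omega>" if "0 < t" for t
        using closed_chamber_inner_nonneg[OF XD simple_pos[OF root0], of \<omega> t] w that by force
      moreover obtain n where "\<alpha>\<^sub>0 \<bullet> X 1 \<omega> \<le> real n" using real_arch_simple by blast
      then have "\<alpha>\<^sub>0 \<bullet> X 1 \<omega> \<le> real (Suc n)" by simp
      ultimately have "\<omega> \<in> ?B (real (Suc n))" using w by simp
      then show "\<omega> \<in> (\<Union>n. Z n)" using Z by blast
    qed
  qed
  moreover have "AE \<omega> in M. T\<^sub>0 \<omega> \<le> T \<alpha>\<^sub>0 \<omega> \<and> T \<alpha>\<^sub>0 \<omega> < \<infinity>"
    using hit AE_space
  proof eventually_elim
    case (elim \<omega>)
    then obtain t where t: "t > 0" "\<alpha>\<^sub>0 \<bullet> X t \<omega> = 0" by blast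
    have "T \<alpha>\<^sub>0 \<omega> \<le> ereal t" unfolding T_def hitting_time_def using t by (intro Inf_lower) auto
    also have "\<dots> < \<infinity>" by simp
    finally show ?case using T0[OF elim(2)] root0 by (auto intro: INF_lower)
  qed
  ultimately show ?thesis using T0 by blast
qed

end
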